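(* There is an algorithm which, given a strongly orderable graph $G=(V,E)$ and a weight function $w:V\to\mathbb{Q}$ with positive values, computes \[ Z(G,w)=\sum_{S \in \mathcal{I}(G)} \prod_{v \in S} w(v) \] in time polynomial in the size of the input (the graph together with the binary encoding of the rational weights).
   Context: Graphs are finite, simple and undirected. $\mathcal{I}(G)$ denotes the set of all independent sets of $G$ (including the empty set). A graph $G$ is strongly orderable if there is an ordering $v_1,\dots,v_n$ of its vertices such that for all $i<j$ and $k<l$, whenever $v_iv_k$, $v_iv_l$ and $v_kv_j$ are edges of $G$, then $v_jv_l$ is also an edge of $G$ (such an ordering is called a strong ordering). *)

theory Defs
  imports Complex_Main "HOL-Library.Log_Nat" "HOL-Computational_Algebra.Polynomial"
begin

definition simple_graph :: "'a set \<Rightarrow> 'a set set \<Rightarrow> bool" where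
  "simple_graph V E \<longleftrightarrow> finite V \<and> E \<subseteq> {{u, v} | u v. u \<in> V \<and> v \<in> V \<and> u \<noteq> v}"

text \<open>
  The ordering is the list \<open>vs\<close>. The condition is imposed only for \<open>j \<noteq> l\<close>: for \<open>j = l\<close> the
  required edge would be a loop, so the condition would exclude every triangle, although strongly
  orderable graphs are meant to include all strongly chordal graphs. Leaving out the case \<open>j = l\<close>
  only enlarges the class of graphs.
\<close>

definition strong_ordering :: "'a set \<Rightarrow> 'a set set \<Rightarrow> 'a list \<Rightarrow> bool" where
  "strong_ordering V E vs \<longleftrightarrow> distinct vs \<and> set vs = V \<and>
     (\<forall>i j k l. i < j \<longrightarrow> j < length vs \<longrightarrow> k < l \<longrightarrow> l < length vs \<longrightarrow> j \<noteq> l \<longrightarrow>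
        {vs ! i, vs ! k} \<in> E \<longrightarrow> {vs ! i, vs ! l} \<in> E \<longrightarrow> {vs ! k, vs ! j} \<in> E \<longrightarrow>
        {vs ! j, vs ! l} \<in> E)"

definition strongly_orderable :: "'a set \<Rightarrow> 'a set set \<Rightarrow> bool" where
  "strongly_orderable V E \<longleftrightarrow> simple_graph V E \<and> (\<exists>vs. strong_ordering V E vs)"

definition independent_sets :: "'a set \<Rightarrow> 'a set set \<Rightarrow> 'a set set" where
  "independent_sets V E = {S. S \<subseteq> V \<and> (\<forall>u\<in>S. \<forall>v\<in>S. {u, v} \<notin> E)}"

definition Z :: "'a set \<Rightarrow> 'a set set \<Rightarrow> ('a \<Rightarrow> rat) \<Rightarrow> rat" where
  "Z V E w = (\<Sum>S\<in>independent_sets V E. \<Prod>v\<in>S. w v)"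

text \<open>
  The machine model is the random access machine with logarithmic cost, presented as a language of
  structured programs. The memory consists of named arrays of natural numbers of unbounded size; a
  program uses only finitely many of them, and a register is an array of which only cell \<open>0\<close> is
  used. The four arithmetic operations are elementary, but each operation is charged the binary
  length of every number it handles, addresses included. So running times agree with those of a
  Turing machine up to a polynomial.
\<close>

type_synonym state = "string \<Rightarrow> nat \<Rightarrow> nat"

datatype exp =
    Num nat
  | Cell string exp
  | Add exp exp
  | Sub exp exp
  | Mul exp exp
  | Div exp exp

datatype com =
    Skip
  | Assign string exp exp  \<comment> \<open>\<open>Assign x a e\<close> stands for \<open>x[a] := e\<close>\<close>
  | Seq com com
  | If exp com com
  | While exp com

fun val :: "exp \<Rightarrow> state \<Rightarrow> nat" where
  "val (Num k) s = k"
| "val (Cell x a) s = s x (val a s)"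
| "val (Add a b) s = val a s + val b s"
| "val (Sub a b) s = val a s - val b s"
| "val (Mul a b) s = val a s * val b s"
| "val (Div a b) s = val a s div val b s"

text \<open>\<open>floorlog 2 k\<close> is the number of binary digits of \<open>k\<close>, which is \<open>0\<close> for \<open>k = 0\<close>.\<close>

definition bit_size :: "nat \<Rightarrow> nat" where
  "bit_size k = Suc (floorlog 2 k)"

text \<open>The cost of an expression is the total length of the values of all its subexpressions.\<close>

fun cost :: "exp \<Rightarrow> state \<Rightarrow> nat" where
  "cost (Num k) s = bit_size k"
| "cost (Cell x a) s = cost a s + bit_size (val (Cell x a) s)"
| "cost (Add a b) s = cost a s + cost b s + bit_size (val (Add a b) s)"
| "cost (Sub a b) s = cost a s + cost b s + bit_size (val (Sub a b) s)"
| "cost (Mul a b) s = cost a s + cost b s + bit_size (val (Mul a b) s)"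
| "cost (Div a b) s = cost a s + cost b s + bit_size (val (Div a b) s)"

text \<open>
  \<open>exec c s t s'\<close>: started in \<open>s\<close>, the program \<open>c\<close> halts in \<open>s'\<close> after time \<open>t\<close>. A test succeeds
  if its value is nonzero.
\<close>

inductive exec :: "com \<Rightarrow> state \<Rightarrow> nat \<Rightarrow> state \<Rightarrow> bool" where
  Skip: "exec Skip s 1 s"
| Assign: "exec (Assign x a e) s (1 + cost a s + cost e s) (s(x := (s x)(val a s := val e s)))"
| Seq: "exec c1 s t1 s' \<Longrightarrow> exec c2 s' t2 s'' \<Longrightarrow> exec (Seq c1 c2) s (t1 + t2) s''"
| IfTrue: "val b s \<noteq> 0 \<Longrightarrow> exec c1 s t s' \<Longrightarrow> exec (If b c1 c2) s (1 + cost b s + t) s'"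
| IfFalse: "val b s = 0 \<Longrightarrow> exec c2 s t s' \<Longrightarrow> exec (If b c1 c2) s (1 + cost b s + t) s'"
| WhileFalse: "val b s = 0 \<Longrightarrow> exec (While b c) s (1 + cost b s) s"
| WhileTrue: "val b s \<noteq> 0 \<Longrightarrow> exec c s t1 s' \<Longrightarrow> exec (While b c) s' t2 s'' \<Longrightarrow>
    exec (While b c) s (1 + cost b s + t1 + t2) s''"

inductive_cases SkipE: "exec Skip s t s'"
inductive_cases AssignE: "exec (Assign x a e) s t s'"
inductive_cases SeqE: "exec (Seq c1 c2) s t s'"
inductive_cases IfE: "exec (If b c1 c2) s t s'"
inductive_cases WhileE: "exec (While b c) s t s'"

text \<open>Programs are deterministic, so the final state and the running time are well defined.\<close>

lemma exec_deterministic: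
  "exec c s t s' \<Longrightarrow> exec c s u s'' \<Longrightarrow> t = u \<and> s' = s''"
proof (induction arbitrary: u s'' rule: exec.induct)
  case (Skip s) then show ?case by (auto elim: SkipE)
next
  case (Assign x a e s) then show ?case by (auto elim: AssignE)
next
  case (Seq c1 s t1 s' c2 t2 s3) then show ?case by (blast elim: SeqE)
next
  case (IfTrue b s c1 t s' c2)
  from IfTrue.prems IfTrue.hyps show ?case by (auto elim!: IfE dest: IfTrue.IH)
next
  case (IfFalse b s c2 t s' c1)
  from IfFalse.prems IfFalse.hyps show ?case by (auto elim!: IfE dest: IfFalse.IH)
next
  case (WhileFalse b s c) then show ?case by (auto elim: WhileE)
next
  case (WhileTrue b s c t1 s' t2 s3)
  from WhileTrue.prems WhileTrue.hyps(1) obtain v1 v2 r where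
    "exec c s v1 r" "exec (While b c) r v2 s''" "u = 1 + cost b s + v1 + v2"
    by (auto elim: WhileE)
  with WhileTrue.IH show ?case by blast
qed

definition start_state :: "nat list \<Rightarrow> state" where
  "start_state xs = (\<lambda>x i. if x = ''input'' \<and> i < length xs then xs ! i else 0)"

definition output_is :: "state \<Rightarrow> nat list \<Rightarrow> bool" where
  "output_is s ys \<longleftrightarrow> (\<forall>i<length ys. s ''output'' i = ys ! i)"

definition computes_within :: "com \<Rightarrow> nat list \<Rightarrow> nat list \<Rightarrow> nat \<Rightarrow> bool" where
  "computes_within c xs ys T \<longleftrightarrow>
     (\<exists>t s. exec c (start_state xs) t s \<and> output_is s ys \<and> t \<le> T)"

definition input_size :: "nat list \<Rightarrow> nat" where
  "input_size xs = (\<Sum>x\<leftarrow>xs. bit_size x)"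

text \<open>
  Nonnegative rationals are given by numerator and denominator in lowest terms. A graph with
  vertex set \<open>{..<n}\<close> is given by \<open>n\<close> and the rows of its adjacency matrix.
\<close>

definition encode_rat :: "rat \<Rightarrow> nat list" where
  "encode_rat q = [nat (fst (quotient_of q)), nat (snd (quotient_of q))]"

definition encode_graph :: "nat \<Rightarrow> nat set set \<Rightarrow> nat list" where
  "encode_graph n E = n # [if {u, v} \<in> E then 1 else 0. u \<leftarrow> [0..<n], v \<leftarrow> [0..<n]]"

definition encode_instance :: "nat \<Rightarrow> nat set set \<Rightarrow> (nat \<Rightarrow> rat) \<Rightarrow> nat list" where
  "encode_instance n E w = encode_graph n E @ concat (map (\<lambda>v. encode_rat (w v)) [0..<n])"

end

theory Submission
  imports Defs
begin

text \<open>
  Call \<open>x\<close> nested in the induced subgraph on \<open>X\<close> if the neighbourhoods of its neighbours form a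
  chain, up to the neighbours themselves. The first vertex of a strong ordering is nested, and strong
  orderability is hereditary, so every nonempty \<open>X\<close> has a nested vertex; the chain order is read off
  the degrees, so no strong ordering has to be computed. A nested vertex can be eliminated:
  \<open>Z(X, w) = (1 + w x) Z(X - x, w')\<close>, where only the weights of the neighbours \<open>u\<close> of \<open>x\<close> change, to
  \<open>w' u = w u z / (w x + z)\<close> with \<open>z\<close> the partition function of the smaller non-neighbours of \<open>u\<close>
  among the neighbours of \<open>x\<close>. Those partition functions obey a linear recursion.

  Exact weights could grow too fast, so each new weight is rounded down to a multiple of \<open>1/M\<close>. Weights
  never increase, hence the rounding errors only add up, to less than \<open>1/D\<close>, where \<open>D\<close> is the product
  of the denominators of the input and \<open>M\<close> is suitably large but of polynomial length. As \<open>D Z\<close> is an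
  integer, it is recovered exactly, and Euclid's algorithm reduces the result to lowest terms.
\<close>

section \<open>Eliminating a nested vertex\<close>

text \<open>The recursion at a single vertex branches and so gives no polynomial algorithm;
  elimination replaces the two branches by one smaller graph. The new weights can be chosen once and
  for all because the factorisation holds on every subset in which the neighbours of
  \<open>x\<close> form an initial segment of the chain: such subsets survive both branches of the
  recursion, and at the largest neighbour the recursion is one linear equation for its new weight.
  The accuracy rests on a potential: the factors \<open>1 + w x\<close> split off so far times the
  product of \<open>1 + w v\<close> over the remaining vertices. It starts below
  \<open>B = (\<Prod>v<n. 1 + w v)\<close> and never rises, since an elimination moves one factor
  and lowers the others. It bounds the effect of each rounding by \<open>n / M * B\<close> and,
  multiplied by \<open>M ^ n\<close>, the size of the split-off factors and of the tabulated
  partition functions. There are \<open>n + 1\<close> roundings, counting that of the input, so the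
  total error is at most \<open>(n + 1) * n * B / M\<close>. This leads to
  \<open>M = (n + 1)^2 * D * B\<close>, which is an integer.\<close>

abbreviation nbrs :: "'a set set \<Rightarrow> 'a set \<Rightarrow> 'a \<Rightarrow> 'a set" where
  "nbrs E X x \<equiv> {y \<in> X. {x, y} \<in> E}"

section \<open>Recursion, bounds and perturbation of the partition function\<close>

lemma finite_independent_sets: "finite X \<Longrightarrow> finite (independent_sets X E)"
  unfolding independent_sets_def by simp

lemma Z_empty [simp]: "Z {} E w = 1"
proof -
  have "independent_sets {} E = {{}}" by (auto simp: independent_sets_def)
  then show ?thesis by (simp add: Z_def)
qed

text \<open>The two terms collect the independent sets without and with \<open>x\<close>. For
  \<open>u = v\<close> the definition of \<open>independent_sets\<close> reads
  \<open>{u} \<notin> E\<close>, so \<open>{x} \<notin> E\<close> is what allows \<open>x\<close> to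
  be inserted.\<close>

lemma Z_rec:
  assumes "finite X" "x \<in> X" "{x} \<notin> E"
  shows "Z X E w = Z (X - {x}) E w + w x * Z {y \<in> X - {x}. {x, y} \<notin> E} E w"
proof -
  let ?Y = "{y \<in> X - {x}. {x, y} \<notin> E}"
  have eq: "independent_sets X E =
      independent_sets (X - {x}) E \<union> insert x ` independent_sets ?Y E"
  proof (intro equalityI subsetI)
    fix S assume S: "S \<in> independent_sets X E"
    show "S \<in> independent_sets (X - {x}) E \<union> insert x ` independent_sets ?Y E"
    proof (cases "x \<in> S")
      case True
      then have "S = insert x (S - {x})" "S - {x} \<in> independent_sets ?Y E"
        using S by (auto simp: independent_sets_def)
      then show ?thesis by blast
    next
      case False
      then show ?thesis using S by (auto simp: independent_sets_def)
    qed
  next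
    fix S assume "S \<in> independent_sets (X - {x}) E \<union> insert x ` independent_sets ?Y E"
    then show "S \<in> independent_sets X E"
      using assms by (auto simp: independent_sets_def insert_commute)
  qed
  have fin: "finite (independent_sets (X - {x}) E)" "finite (independent_sets ?Y E)"
    using assms by (simp_all add: finite_independent_sets)
  have "Z X E w = (\<Sum>S\<in>independent_sets (X - {x}) E. \<Prod>v\<in>S. w v)
      + (\<Sum>S\<in>insert x ` independent_sets ?Y E. \<Prod>v\<in>S. w v)"
    unfolding Z_def eq
    by (rule sum.union_disjoint) (use fin in \<open>auto simp: independent_sets_def\<close>)
  also have "(\<Sum>S\<in>insert x ` independent_sets ?Y E. \<Prod>v\<in>S. w v)
      = (\<Sum>S\<in>independent_sets ?Y E. \<Prod>v\<in>insert x S. w v)"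
    by (subst sum.reindex) (auto simp: inj_on_def independent_sets_def insert_ident)
  also have "\<dots> = (\<Sum>S\<in>independent_sets ?Y E. w x * (\<Prod>v\<in>S. w v))"
  proof (rule sum.cong[OF refl])
    fix S assume "S \<in> independent_sets ?Y E"
    then have "finite S" "x \<notin> S"
      using assms finite_subset[of S X] by (auto simp: independent_sets_def)
    then show "(\<Prod>v\<in>insert x S. w v) = w x * (\<Prod>v\<in>S. w v)" by simp
  qed
  finally show ?thesis by (simp add: Z_def sum_distrib_left)
qed

lemma Z_ge_1:
  assumes "finite X" "\<And>v. v \<in> X \<Longrightarrow> 0 \<le> w v"
  shows "1 \<le> Z X E w"
proof -
  have "{} \<in> independent_sets X E" by (simp add: independent_sets_def)
  then have "(\<Prod>v\<in>{}. w v) \<le> Z X E w" unfolding Z_def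
    by (intro member_le_sum prod_nonneg)
      (use assms in \<open>auto simp: finite_independent_sets independent_sets_def\<close>)
  then show ?thesis by simp
qed

text \<open>Forgetting independence leaves the sum over all subsets, which is the expansion of the
  product.\<close>

lemma Z_le_prod:
  assumes "finite X" "\<And>v. v \<in> X \<Longrightarrow> 0 \<le> w v"
  shows "Z X E w \<le> (\<Prod>v\<in>X. 1 + w v)"
proof -
  have "Z X E w \<le> (\<Sum>S\<in>Pow X. \<Prod>v\<in>S. w v)" unfolding Z_def
    by (intro sum_mono2 prod_nonneg) (use assms in \<open>auto simp: independent_sets_def\<close>)
  also have "\<dots> = (\<Prod>v\<in>X. 1 + w v)"
    using prod_add[OF assms(1), of "\<lambda>_. 1" w] prod.subset_diff assms(1)
    by (subst prod.cong[OF refl, of _ _ "\<lambda>v. w v + 1"]) (auto simp: prod_add)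
  finally show ?thesis .
qed

lemma prod_subset_le:
  fixes f :: "'a \<Rightarrow> 'b :: linordered_idom"
  assumes "finite X" "Y \<subseteq> X" "\<And>v. v \<in> X \<Longrightarrow> 1 \<le> f v"
  shows "prod f Y \<le> prod f X"
proof -
  have "prod f X = prod f (X - Y) * prod f Y"
    using assms by (simp add: prod.subset_diff)
  moreover have "1 \<le> prod f (X - Y)" by (intro prod_ge_1) (use assms in auto)
  moreover have "0 \<le> prod f Y"
    by (intro prod_nonneg) (use assms in \<open>force intro: order_trans[OF zero_le_one]\<close>)
  ultimately show ?thesis by (metis mult_left_le_one_le mult_right_mono mult_1)
qed

lemma Z_mono_weights:
  assumes "finite X" "\<And>v. v \<in> X \<Longrightarrow> 0 \<le> w' v" "\<And>v. v \<in> X \<Longrightarrow> w' v \<le> w v"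
  shows "Z X E w' \<le> Z X E w"
  unfolding Z_def
  by (intro sum_mono prod_mono) (use assms in \<open>auto simp: independent_sets_def\<close>)

text \<open>Each weight enters multilinearly, and no partial derivative exceeds \<open>\<Prod>v. 1 + w v\<close>.\<close>

lemma Z_perturb:
  fixes E :: "'a set set"
  assumes "finite X" "\<And>v. v \<in> X \<Longrightarrow> {v} \<notin> E"
    and "\<And>v. v \<in> X \<Longrightarrow> 0 \<le> w' v" "\<And>v. v \<in> X \<Longrightarrow> w' v \<le> w v"
    and "\<And>v. v \<in> X \<Longrightarrow> w v \<le> w' v + \<epsilon>" and "0 \<le> \<epsilon>"
  shows "Z X E w \<le> Z X E w' + of_nat (card X) * \<epsilon> * (\<Prod>v\<in>X. 1 + w v)"
  using assms
proof (induction "card X" arbitrary: X rule: less_induct)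
  case less
  show ?case
  proof (cases "X = {}")
    case False
    then obtain x where x: "x \<in> X" by blast
    let ?Y = "X - {x}" and ?N = "{y \<in> X - {x}. {x, y} \<notin> E}"
    let ?P = "\<Prod>v\<in>?Y. 1 + w v"
    have w0: "0 \<le> w v" if "v \<in> X" for v using less.prems that by force
    have cX: "card X = Suc (card ?Y)" using x less.prems(1)
      by (metis card_Suc_Diff1)
    have cN: "card ?N \<le> card ?Y" using less.prems(1) by (intro card_mono) auto
    have IH1: "Z ?Y E w \<le> Z ?Y E w' + of_nat (card ?Y) * \<epsilon> * ?P"
      by (rule less.hyps) (use less.prems cX in auto)
    have "Z ?N E w \<le> Z ?N E w' + of_nat (card ?N) * \<epsilon> * (\<Prod>v\<in>?N. 1 + w v)"
      by (rule less.hyps) (use less.prems cX cN in auto)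
    also have "of_nat (card ?N) * \<epsilon> * (\<Prod>v\<in>?N. 1 + w v) \<le> of_nat (card ?Y) * \<epsilon> * ?P"
      using cN less.prems(1,6) w0
      by (intro mult_mono prod_subset_le prod_nonneg mult_nonneg_nonneg) auto
    finally have IH2: "Z ?N E w \<le> Z ?N E w' + of_nat (card ?Y) * \<epsilon> * ?P" by simp
    have "Z ?N E w' \<le> Z ?N E w" by (intro Z_mono_weights) (use less.prems in auto)
    also have "\<dots> \<le> (\<Prod>v\<in>?N. 1 + w v)" by (intro Z_le_prod) (use less.prems w0 in auto)
    also have "\<dots> \<le> ?P" by (intro prod_subset_le) (use less.prems w0 in auto)
    finally have ZP: "Z ?N E w' \<le> ?P" .
    have ZN1: "1 \<le> Z ?N E w'" by (intro Z_ge_1) (use less.prems in auto)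
    have P1: "1 \<le> ?P" using ZP ZN1 by simp
    have "Z X E w = Z ?Y E w + w x * Z ?N E w"
      using Z_rec[of X x E w] x less.prems by auto
    also have "\<dots> \<le> (Z ?Y E w' + of_nat (card ?Y) * \<epsilon> * ?P)
        + w x * (Z ?N E w' + of_nat (card ?Y) * \<epsilon> * ?P)"
      using IH1 IH2 w0[OF x] by (intro add_mono mult_left_mono) auto
    also have "w x * (Z ?N E w' + of_nat (card ?Y) * \<epsilon> * ?P)
        = w x * Z ?N E w' + w x * (of_nat (card ?Y) * \<epsilon> * ?P)" by (simp add: algebra_simps)
    \<comment> \<open>Changing the weight of \<open>x\<close> itself costs at most
      \<open>\<epsilon> * ?P\<close>; the two induction hypotheses together cost
      \<open>card ?Y\<close> times \<open>\<epsilon> * ?P * (1 + w x)\<close>. Hence the factor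
      \<open>card X\<close>.\<close>
    also have "w x * Z ?N E w' \<le> (w' x + \<epsilon>) * Z ?N E w'"
      using less.prems(5)[OF x] ZN1 by (intro mult_right_mono) auto
    also have "(w' x + \<epsilon>) * Z ?N E w' \<le> w' x * Z ?N E w' + \<epsilon> * ?P"
      using ZP less.prems(6) by (simp add: algebra_simps mult_left_mono)
    also have "\<epsilon> * ?P \<le> \<epsilon> * ?P * (1 + w x)"
      using w0[OF x] less.prems(6) P1 by (simp add: algebra_simps)
    finally have "Z X E w \<le> Z ?Y E w' + w' x * Z ?N E w'
        + of_nat (Suc (card ?Y)) * \<epsilon> * (?P * (1 + w x))"
      by (simp add: algebra_simps)
    also have "?P * (1 + w x) = (\<Prod>v\<in>X. 1 + w v)"
      using prod.remove[OF less.prems(1) x, of "\<lambda>v. 1 + w v"] by (simp add: mult.commute)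
    also have "Z ?Y E w' + w' x * Z ?N E w' = Z X E w'"
      using Z_rec[of X x E w'] x less.prems by auto
    finally show ?thesis using cX by simp
  qed simp
qed

section \<open>Nested vertices and the elimination identity\<close>

text \<open>For adjacent \<open>a\<close> and \<open>b\<close> the choice \<open>c = b\<close> would
  demand a loop, whence \<open>c \<noteq> b\<close>. The order is an abstract \<open>key\<close>, of
  which the elimination identity uses only nestedness and injectivity.\<close>

definition nested_at :: "'a set set \<Rightarrow> 'a set \<Rightarrow> ('a \<Rightarrow> nat) \<Rightarrow> 'a \<Rightarrow> bool" where
  "nested_at E X key x \<longleftrightarrow> (\<forall>a\<in>nbrs E X x. \<forall>b\<in>nbrs E X x. key a < key b \<longrightarrow>
     (\<forall>c\<in>X. c \<noteq> b \<longrightarrow> {a, c} \<in> E \<longrightarrow> {b, c} \<in> E))"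

definition below :: "'a set set \<Rightarrow> 'a set \<Rightarrow> ('a \<Rightarrow> nat) \<Rightarrow> 'a \<Rightarrow> 'a \<Rightarrow> 'a set" where
  "below E X key x u = {y \<in> nbrs E X x. key y < key u \<and> {u, y} \<notin> E}"

definition elim_weight ::
  "'a set set \<Rightarrow> 'a set \<Rightarrow> ('a \<Rightarrow> nat) \<Rightarrow> ('a \<Rightarrow> rat) \<Rightarrow> 'a \<Rightarrow> 'a \<Rightarrow> rat" where
  "elim_weight E X key w x u =
    (if u \<in> nbrs E X x
     then w u * Z (below E X key x u) E w / (w x + Z (below E X key x u) E w) else w u)"

text \<open>Down-closedness is inherited by both branches of \<open>Z_rec\<close>, so both fall
  under the induction hypothesis. Vertices outside the neighbourhood of \<open>x\<close> are split
  off first and keep their weight. Once only neighbours remain, the largest one is split off, and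
  this fixes its new weight.\<close>

lemma Z_eliminate_down_closed:
  assumes fin: "finite X" and x: "x \<in> X" and loopless: "\<And>v. v \<in> X \<Longrightarrow> {v} \<notin> E"
    and inj: "inj_on key X" and w: "\<And>v. v \<in> X \<Longrightarrow> 0 \<le> w v"
    and nested: "nested_at E X key x"
    and A: "A \<subseteq> X - {x}"
    and down: "\<And>u y. u \<in> A \<Longrightarrow> u \<in> nbrs E X x \<Longrightarrow> y \<in> nbrs E X x \<Longrightarrow> key y < key u \<Longrightarrow> y \<in> A"
  shows "Z (insert x A) E w = (1 + w x) * Z A E (elim_weight E X key w x)"
  using A down
proof (induction "card A" arbitrary: A rule: less_induct)
  case less
  let ?N = "nbrs E X x" and ?w = "elim_weight E X key w x"
  have finA: "finite A" using less.prems(1) fin finite_subset by blast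
  have xA: "x \<notin> A" and finxA: "finite (insert x A)" using less.prems finA by auto
  show ?case
  proof (cases "A \<subseteq> ?N")
    case False
    then obtain t where t: "t \<in> A" "t \<notin> ?N" by blast
    have tX: "t \<in> X" "t \<noteq> x" using t less.prems by auto
    have tx: "{t, x} \<notin> E" using t tX by (auto simp: insert_commute)
    let ?B = "A - {t}" and ?C = "{y \<in> A - {t}. {t, y} \<notin> E}"
    have cB: "card ?B < card A" using finA t by (meson card_Diff1_less)
    have cC: "card ?C < card A"
      using finA t by (intro psubset_card_mono) auto
    have IB: "Z (insert x ?B) E w = (1 + w x) * Z ?B E ?w"
      by (rule less.hyps[OF cB]) (use less.prems t in auto)
    have IC: "Z (insert x ?C) E w = (1 + w x) * Z ?C E ?w"
    proof (rule less.hyps[OF cC])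
      show "?C \<subseteq> X - {x}" using less.prems by auto
    next
      fix u y assume u: "u \<in> ?C" "u \<in> ?N" and y: "y \<in> ?N" "key y < key u"
      have yA: "y \<in> A" using less.prems(2)[of u y] u y by auto
      \<comment> \<open>By nestedness a neighbour \<open>t\<close> of the smaller vertex
        \<open>y\<close> is also one of the larger vertex \<open>u\<close>, but \<open>u\<close> has
        survived the deletion of the neighbours of \<open>t\<close>.\<close>
      have "{t, y} \<notin> E"
      proof
        assume "{t, y} \<in> E"
        then have "{y, t} \<in> E" by (simp add: insert_commute)
        moreover have "t \<noteq> u" using u by auto
        ultimately have "{u, t} \<in> E"
          using nested u y tX unfolding nested_at_def by blast
        then show False using u by (auto simp: insert_commute)
      qed
      then show "y \<in> ?C" using yA t y by auto
    qed
    have sets: "insert x A - {t} = insert x ?B"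
      "{y \<in> insert x A - {t}. {t, y} \<notin> E} = insert x ?C"
      using tX tx by auto
    have wt: "?w t = w t" using t(2) by (simp only: elim_weight_def if_False)
    have "Z (insert x A) E w = Z (insert x ?B) E w + w t * Z (insert x ?C) E w"
      using Z_rec[of "insert x A" t E w] finxA t loopless[OF tX(1)] sets by simp
    also have "\<dots> = (1 + w x) * (Z ?B E ?w + ?w t * Z ?C E ?w)"
      unfolding IB IC wt by (simp add: algebra_simps)
    also have "Z ?B E ?w + ?w t * Z ?C E ?w = Z A E ?w"
      using Z_rec[of A t E ?w] finA t loopless[OF tX(1)] by simp
    finally show ?thesis .
  next
    case AN: True
    \<comment> \<open>Now \<open>x\<close> is joined to all of \<open>A\<close>, so
      \<open>{x}\<close> is the only independent set through \<open>x\<close>, and adding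
      \<open>x\<close> adds just \<open>w x\<close>.\<close>
    have xN: "{y \<in> insert x A - {x}. {x, y} \<notin> E} = {}" using AN by auto
    have Zx: "Z (insert x A') E w = Z A' E w + w x" if "A' \<subseteq> A" for A'
    proof -
      have "insert x A' - {x} = A'" "{y \<in> insert x A' - {x}. {x, y} \<notin> E} = {}"
        "finite (insert x A')"
        using that xA AN finite_subset[OF that finA] by auto
      then show ?thesis
        using Z_rec[of "insert x A'" x E w] loopless[OF x]
          by (simp only: insertI1 Z_empty mult_1_right not_False_eq_True True_implies_equals)
    qed
    show ?thesis
    proof (cases "A = {}")
      case True
      then show ?thesis using Zx[of "{}"] by simp
    next
      case False
      then obtain u where uA: "u \<in> A" "key u = Max (key ` A)"
        using Max_in[of "key ` A"] finA by fastforce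
      then have u: "u \<in> A" "\<And>y. y \<in> A \<Longrightarrow> key y \<le> key u"
        using finA by auto
      have AX: "A \<subseteq> X" using less.prems by auto
      have uX: "u \<in> X" and uN: "u \<in> ?N" using u AX AN by auto
      let ?B = "A - {u}" and ?R = "below E X key x u"
      \<comment> \<open>\<open>below\<close> does not mention \<open>A\<close>. Since
        \<open>A\<close> is down-closed and \<open>u\<close> is its largest element, it is
        nevertheless exactly what is left of \<open>A\<close> when \<open>u\<close> is chosen; so
        the new weight is the same for all \<open>A\<close>.\<close>
      have R: "?R = {y \<in> A - {u}. {u, y} \<notin> E}"
      proof (intro equalityI subsetI)
        fix y assume y: "y \<in> ?R"
        then have "y \<in> A" using less.prems(2)[OF u(1) uN, of y] by (auto simp: below_def)
        then show "y \<in> {y \<in> A - {u}. {u, y} \<notin> E}" using y by (auto simp: below_def)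
      next
        fix y assume y: "y \<in> {y \<in> A - {u}. {u, y} \<notin> E}"
        then have "key y \<noteq> key u" using inj AX u by (auto dest: inj_onD)
        then have "key y < key u" using u(2)[of y] y by auto
        then show "y \<in> ?R" using y AN by (auto simp: below_def)
      qed
      have cB: "card ?B < card A" using finA u by (meson card_Diff1_less)
      have cR: "card ?R < card A"
        unfolding R using finA u by (intro psubset_card_mono) auto
      have IB: "Z (insert x ?B) E w = (1 + w x) * Z ?B E ?w"
      proof (rule less.hyps[OF cB])
        fix v y assume "v \<in> ?B" "v \<in> ?N" "y \<in> ?N" "key y < key v"
        then show "y \<in> ?B" using less.prems(2)[of v y] u(2)[of v] by force
      qed (use less.prems in auto)
      have IR: "Z (insert x ?R) E w = (1 + w x) * Z ?R E ?w"
      proof (rule less.hyps[OF cR])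
        show "?R \<subseteq> X - {x}" using R less.prems by auto
      next
        fix v y assume v: "v \<in> ?R" "v \<in> ?N" and y: "y \<in> ?N" "key y < key v"
        have "{u, y} \<notin> E"
        proof
          assume "{u, y} \<in> E"
          then have "{y, u} \<in> E" by (simp add: insert_commute)
          moreover have "u \<noteq> v" using v by (auto simp: below_def)
          ultimately have "{v, u} \<in> E"
            using nested v y uX unfolding nested_at_def by blast
          then show False using v by (auto simp: below_def insert_commute)
        qed
        then show "y \<in> ?R" using v y by (auto simp: below_def)
      qed
      have RA: "?R \<subseteq> A" using R by auto
      have "1 \<le> Z ?R E w"
        by (rule Z_ge_1) (use finite_subset[OF RA finA] w RA AX in auto)
      then have pos: "w x + Z ?R E w \<noteq> 0" using w[OF x] by linarith
      have wu: "?w u * (w x + Z ?R E w) = w u * Z ?R E w"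
        using uN pos by (simp add: elim_weight_def)
      \<comment> \<open>With \<open>z = Z ?R E w\<close> the result must be
        \<open>Z ?B E w + w u * z + w x\<close>. Comparison gives
        \<open>?w u * (w x + z) = w u * z\<close>, the equation that \<open>elim_weight\<close>
        solves.\<close>
      have "(1 + w x) * Z A E ?w = (1 + w x) * Z ?B E ?w + ?w u * ((1 + w x) * Z ?R E ?w)"
        using Z_rec[of A u E ?w] finA u loopless[OF uX] R by (simp add: algebra_simps)
      also have "\<dots> = Z ?B E w + w x + ?w u * (w x + Z ?R E w)"
        using IB IR Zx[of ?B] Zx[of ?R] RA by (simp add: add.commute)
      also have "\<dots> = Z ?B E w + w u * Z ?R E w + w x" by (simp add: wu)
      also have "Z ?B E w + w u * Z ?R E w = Z A E w"
        using Z_rec[of A u E w] finA u loopless[OF uX] R by simp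
      finally show ?thesis using Zx[of A] by simp
    qed
  qed
qed

lemma Z_eliminate:
  assumes "finite X" "x \<in> X" "\<And>v. v \<in> X \<Longrightarrow> {v} \<notin> E" "inj_on key X"
    and "\<And>v. v \<in> X \<Longrightarrow> 0 \<le> w v" "nested_at E X key x"
  shows "Z X E w = (1 + w x) * Z (X - {x}) E (elim_weight E X key w x)"
proof -
  have "Z (insert x (X - {x})) E w = (1 + w x) * Z (X - {x}) E (elim_weight E X key w x)"
    by (rule Z_eliminate_down_closed[OF assms]) (use assms(3)[OF assms(2)] in auto)
  then show ?thesis using assms(2) by (simp add: insert_absorb)
qed

text \<open>As \<open>z \<ge> 1\<close>, the factor \<open>z / (w x + z)\<close> lies between 0 and
  1. That weights never rise is what later keeps the error potential from growing.\<close>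

lemma elim_weight_bounds:
  assumes "finite X" "x \<in> X" "\<And>v. v \<in> X \<Longrightarrow> 0 \<le> w v" "u \<in> X"
  shows "0 \<le> elim_weight E X key w x u" "elim_weight E X key w x u \<le> w u"
proof -
  let ?z = "Z (below E X key x u) E w"
  have "1 \<le> ?z" by (rule Z_ge_1) (use assms in \<open>auto simp: below_def\<close>)
  moreover have "0 \<le> w x" "0 \<le> w u" using assms by auto
  ultimately have "0 \<le> w u * ?z / (w x + ?z)" "w u * ?z / (w x + ?z) \<le> w u"
    by (auto simp: divide_le_eq mult_left_mono intro!: divide_nonneg_nonneg)
  then show "0 \<le> elim_weight E X key w x u" "elim_weight E X key w x u \<le> w u"
    using \<open>0 \<le> w u\<close> by (auto simp: elim_weight_def)
qed

section \<open>The degree order and the existence of a nested vertex\<close>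

text \<open>Nestedness forces smaller neighbourhoods first; vertices of equal degree are twins there, so ties
  can be broken by the vertex number.\<close>

definition degree_key :: "nat \<Rightarrow> nat set set \<Rightarrow> nat set \<Rightarrow> nat \<Rightarrow> nat" where
  "degree_key n E X u = card (nbrs E X u) * n + u"

text \<open>A vertex below \<open>n\<close> is the residue of its key modulo \<open>n\<close>; the
  program recovers vertices from keys in the same way.\<close>

lemma inj_on_degree_key: "X \<subseteq> {..<n} \<Longrightarrow> inj_on (degree_key n E X) X"
proof (rule inj_onI)
  fix u v assume "X \<subseteq> {..<n}" "u \<in> X" "v \<in> X" "degree_key n E X u = degree_key n E X v"
  then have "u < n" "v < n" "(card (nbrs E X u) * n + u) mod n = (card (nbrs E X v) * n + v) mod n"
    by (auto simp: degree_key_def)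
  then show "u = v" by simp
qed

text \<open>The witness is the vertex of \<open>X\<close> that comes first in the ordering. Along
  the positions of its neighbours the neighbourhoods grow; what remains is to pass from positions to
  degrees.\<close>

lemma exists_nested:
  assumes so: "strong_ordering {..<n} E vs" and E: "simple_graph {..<n} E"
    and X: "X \<subseteq> {..<n}" "X \<noteq> {}"
  shows "\<exists>x\<in>X. nested_at E X (degree_key n E X) x"
proof -
  have finX: "finite X" using X finite_subset by blast
  have set: "set vs = {..<n}" and dist: "distinct vs" using so by (auto simp: strong_ordering_def)
  define pos where "pos u = (THE i. i < length vs \<and> vs ! i = u)" for u
  have pos: "pos u < length vs" "vs ! pos u = u" if "u \<in> X" for u
  proof -
    have "u \<in> set vs" using that X set by auto
    then have "\<exists>!i. i < length vs \<and> vs ! i = u"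
      using dist by (auto simp: in_set_conv_nth nth_eq_iff_index_eq)
    from theI'[OF this] show "pos u < length vs" "vs ! pos u = u" by (auto simp: pos_def)
  qed
  obtain x where x: "x \<in> X" "\<And>y. y \<in> X \<Longrightarrow> pos x \<le> pos y"
    using finX X by (metis arg_min_if_finite(1) arg_min_least)
  \<comment> \<open>The strong ordering is applied with \<open>i\<close>, \<open>j\<close>,
    \<open>k\<close>, \<open>l\<close> the positions of \<open>x\<close>, \<open>c\<close>,
    \<open>a\<close>, \<open>b\<close>.\<close>
  have step: "{b, c} \<in> E"
    if a: "a \<in> nbrs E X x" and b: "b \<in> nbrs E X x" and ab: "pos a < pos b"
      and c: "c \<in> X" "c \<noteq> b" "{a, c} \<in> E" for a b c
  proof (cases "c = x")
    case True
    then show ?thesis using b by (simp add: insert_commute)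
  next
    case False
    then have "pos x \<noteq> pos c" using pos[OF x(1)] pos[OF c(1)] by metis
    then have "pos x < pos c" using x(2)[OF c(1)] by simp
    moreover have "pos c \<noteq> pos b" using pos[of b] pos[OF c(1)] b c by auto
    moreover have "pos c < length vs" "pos b < length vs" using pos b c by auto
    moreover have "{vs ! pos x, vs ! pos a} \<in> E" "{vs ! pos x, vs ! pos b} \<in> E"
      "{vs ! pos a, vs ! pos c} \<in> E"
      using pos a b c x by auto
    ultimately have "{vs ! pos c, vs ! pos b} \<in> E"
      using so ab unfolding strong_ordering_def by blast
    then show ?thesis using pos[of b] pos[OF c(1)] b by (simp add: insert_commute)
  qed
  have loopless: "{v} \<notin> E" for v using E by (auto simp: simple_graph_def doubleton_eq_iff)
  have sub: "nbrs E X a - {b} \<subseteq> nbrs E X b - {a}"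
    if "a \<in> nbrs E X x" "b \<in> nbrs E X x" "pos a < pos b" for a b
    using step[OF that] loopless by auto
  have deg: "card (nbrs E X a) = card (nbrs E X a - {b}) + (if {a, b} \<in> E then 1 else 0)"
    if "b \<in> X" for a b
  proof (cases "{a, b} \<in> E")
    case True
    then have "b \<in> nbrs E X a" using that by simp
    moreover have "finite (nbrs E X a)" using finX by simp
    ultimately have "card (nbrs E X a) = Suc (card (nbrs E X a - {b}))"
      by (rule card.remove[rotated])
    then show ?thesis using True by simp
  qed simp
  show ?thesis
  proof (rule bexI[OF _ x(1)], unfold nested_at_def, intro ballI impI)
    fix a b c
    assume a: "a \<in> nbrs E X x" and b: "b \<in> nbrs E X x"
      and key: "degree_key n E X a < degree_key n E X b"
      and c: "c \<in> X" "c \<noteq> b" "{a, c} \<in> E"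
    have "pos a \<noteq> pos b" using pos a b key by (metis less_irrefl mem_Collect_eq)
    then consider "pos a < pos b" | "pos b < pos a" by linarith
    then show "{b, c} \<in> E"
    proof cases
      case 1
      then show ?thesis using step a b c by blast
    next
      case 2
      \<comment> \<open>Key and position disagree only on twins: the inclusion holds one way and the
        inequality of cardinalities the other way, so the sets are equal.\<close>
      have sub': "nbrs E X b - {a} \<subseteq> nbrs E X a - {b}" using sub[OF b a 2] .
      have da: "card (nbrs E X a) = card (nbrs E X a - {b}) + (if {a, b} \<in> E then 1 else 0)"
        and db: "card (nbrs E X b) = card (nbrs E X b - {a}) + (if {a, b} \<in> E then 1 else 0)"
        using deg[of b a] deg[of a b] a b by (auto simp: insert_commute)
      \<comment> \<open>The summand \<open>b < n\<close> of the key cannot outweigh a difference in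
        degree, which counts at least \<open>n\<close>.\<close>
      have "card (nbrs E X a) \<le> card (nbrs E X b)"
      proof (rule ccontr)
        assume "\<not> ?thesis"
        then have "Suc (card (nbrs E X b)) * n \<le> card (nbrs E X a) * n" by (intro mult_le_mono1) simp
        moreover have "b < n" using b X by auto
        ultimately show False using key by (simp add: degree_key_def)
      qed
      then have "card (nbrs E X a - {b}) \<le> card (nbrs E X b - {a})" using da db by simp
      then have "nbrs E X b - {a} = nbrs E X a - {b}"
        using sub' finX by (intro card_seteq) auto
      moreover have "c \<in> nbrs E X a - {b}" using c by auto
      ultimately show ?thesis by blast
    qed
  qed
qed

section \<open>Running time of structured programs\<close>

text \<open>A literal has size \<open>Suc k\<close> rather than one, so that
  \<open>2 ^ (L * exp_size e)\<close> bounds its value too.\<close>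

fun exp_size :: "exp \<Rightarrow> nat" where
  "exp_size (Num k) = Suc k"
| "exp_size (Cell x a) = Suc (exp_size a)"
| "exp_size (Add a b) = Suc (exp_size a + exp_size b)"
| "exp_size (Sub a b) = Suc (exp_size a + exp_size b)"
| "exp_size (Mul a b) = Suc (exp_size a + exp_size b)"
| "exp_size (Div a b) = Suc (exp_size a + exp_size b)"

text \<open>One exponent serves all cells of all arrays, whatever their addresses. The condition
  \<open>1 \<le> L\<close> lets literals obey the bound of \<open>val_less\<close>.\<close>

definition bounded_by :: "nat \<Rightarrow> state \<Rightarrow> bool" where
  "bounded_by L s \<longleftrightarrow> 1 \<le> L \<and> (\<forall>x i. s x i < 2 ^ L)"

lemma exp_size_pos: "0 < exp_size e" by (induction e) auto

lemma bit_size_le: "v < 2 ^ k \<Longrightarrow> bit_size v \<le> Suc k"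
  unfolding bit_size_def by (simp add: floorlog_leD floorlog_le_iff)

lemma add_less_power2: "a < 2 ^ p \<Longrightarrow> b < 2 ^ q \<Longrightarrow> 1 \<le> p \<Longrightarrow> 1 \<le> q \<Longrightarrow> a + b < (2::nat) ^ (p + q)"
proof -
  assume *: "a < 2 ^ p" "b < 2 ^ q" "1 \<le> p" "1 \<le> q"
  have "(2::nat) \<le> 2 ^ p" "(2::nat) \<le> 2 ^ q"
    using *(3,4) power_increasing[of 1 p "2::nat"] power_increasing[of 1 q "2::nat"] by auto
  then obtain c d where cd: "(2::nat) ^ p = 2 + c" "(2::nat) ^ q = 2 + d" by (metis le_Suc_ex)
  have "(2 + c) + (2 + d) \<le> (2 + c) * (2 + d)" by (simp add: algebra_simps)
  then show ?thesis using *(1,2) cd by (simp add: power_add)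
qed

text \<open>Exponents add under sums and products, just as \<open>exp_size\<close> does.\<close>

lemma val_less: "bounded_by L s \<Longrightarrow> val e s < 2 ^ (L * exp_size e)"
proof (induction e)
  case (Num k)
  have "k < 2 ^ Suc k"
    by (metis less_exp less_SucI lessI power_strict_increasing_iff one_less_numeral_iff semiring_norm(76) less_trans)
  also have "\<dots> \<le> 2 ^ (L * Suc k)"
    using Num mult_le_mono1[of 1 L "Suc k"] by (intro power_increasing) (auto simp: bounded_by_def)
  finally show ?case by simp
next
  case (Cell x a)
  have "s x (val a s) < 2 ^ L" using Cell by (simp add: bounded_by_def)
  also have "\<dots> \<le> 2 ^ (L * exp_size (Cell x a))" by (intro power_increasing) auto
  finally show ?case by simp
next
  case (Add a b)
  have "val a s + val b s < 2 ^ (L * exp_size a + L * exp_size b)"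
    using Add exp_size_pos[of a] exp_size_pos[of b] by (intro add_less_power2) (auto simp: bounded_by_def Suc_le_eq)
  also have "\<dots> \<le> 2 ^ (L * exp_size (Add a b))" by (intro power_increasing) (auto simp: algebra_simps)
  finally show ?case by simp
next
  case (Sub a b)
  have "val a s - val b s < 2 ^ (L * exp_size a)" using Sub by (meson diff_le_self le_less_trans)
  also have "\<dots> \<le> 2 ^ (L * exp_size (Sub a b))" by (intro power_increasing) (auto simp: algebra_simps)
  finally show ?case by simp
next
  case (Mul a b)
  have "val a s * val b s < 2 ^ (L * exp_size a) * 2 ^ (L * exp_size b)"
    using Mul by (intro mult_strict_mono) auto
  also have "\<dots> \<le> 2 ^ (L * exp_size (Mul a b))"
    unfolding power_add[symmetric] by (intro power_increasing) (auto simp: algebra_simps)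
  finally show ?case by simp
next
  case (Div a b)
  have "val a s div val b s < 2 ^ (L * exp_size a)" using Div by (meson div_le_dividend le_less_trans)
  also have "\<dots> \<le> 2 ^ (L * exp_size (Div a b))" by (intro power_increasing) (auto simp: algebra_simps)
  finally show ?case by simp
qed

text \<open>There are at most \<open>exp_size e\<close> subexpressions, each with a value of bit
  size at most \<open>Suc (L * exp_size e)\<close>.\<close>

lemma cost_le: "bounded_by L s \<Longrightarrow> cost e s \<le> exp_size e * Suc (L * exp_size e)"
proof -
  assume b: "bounded_by L s"
  have *: "cost a s + cost c s + bit_size (val e' s) \<le> k * Suc (L * k)"
    if "cost a s \<le> p * Suc (L * p)" "cost c s \<le> q * Suc (L * q)" "k = Suc (p + q)"
      "val e' s < 2 ^ (L * k)" for a c e' p q k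
  proof -
    have "L * p \<le> L * k" "L * q \<le> L * k" using that(3) by (intro mult_le_mono2; simp)+
    then have "p * Suc (L * p) + q * Suc (L * q) + Suc (L * k)
        \<le> p * Suc (L * k) + q * Suc (L * k) + Suc (L * k)"
      by (intro add_mono mult_le_mono) auto
    also have "\<dots> = k * Suc (L * k)" unfolding that(3) by (simp add: distrib_right)
    finally show ?thesis using that bit_size_le[OF that(4)] by linarith
  qed
  show ?thesis
  proof (induction e)
    case (Num k)
    show ?case using bit_size_le[OF val_less[OF b, of "Num k"]] by simp
  next
    case (Cell x a)
    have "cost (Cell x a) s \<le> exp_size a * Suc (L * exp_size a) + Suc (L * exp_size (Cell x a))"
      using Cell bit_size_le[OF val_less[OF b, of "Cell x a"]] by (simp del: exp_size.simps mult_Suc_right)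
    also have "\<dots> \<le> exp_size a * Suc (L * exp_size (Cell x a)) + Suc (L * exp_size (Cell x a))"
      by (intro add_mono mult_le_mono) auto
    finally show ?case by simp
  next
    case (Add a c) then show ?case using *[OF Add _ val_less[OF b, of "Add a c"]] by simp
  next
    case (Sub a c) then show ?case using *[OF Sub _ val_less[OF b, of "Sub a c"]] by simp
  next
    case (Mul a c) then show ?case using *[OF Mul _ val_less[OF b, of "Mul a c"]] by simp
  next
    case (Div a c) then show ?case using *[OF Div _ val_less[OF b, of "Div a c"]] by simp
  qed
qed

text \<open>The size \<open>200\<close> exceeds that of every expression in the program below, so that one elementary
  step on numbers of at most \<open>L\<close> bits costs at most \<open>unit_cost L\<close>.\<close>

definition unit_cost :: "nat \<Rightarrow> nat" where
  "unit_cost L = 1 + 200 * Suc (L * 200)"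

lemma cost_le_unit:
  assumes "bounded_by L s" "exp_size a + exp_size e \<le> 200"
  shows "1 + cost a s + cost e s \<le> unit_cost L"
proof -
  have "cost a s + cost e s \<le> exp_size a * Suc (L * exp_size a) + exp_size e * Suc (L * exp_size e)"
    using cost_le[OF assms(1)] by (intro add_mono)
  also have "\<dots> \<le> exp_size a * Suc (L * 200) + exp_size e * Suc (L * 200)"
    using assms by (intro add_mono mult_le_mono) auto
  also have "\<dots> = (exp_size a + exp_size e) * Suc (L * 200)" by (simp add: algebra_simps)
  also have "\<dots> \<le> 200 * Suc (L * 200)" using assms by (intro mult_le_mono) auto
  finally show ?thesis by (simp add: unit_cost_def)
qed

lemma cost_le_unit1: "bounded_by L s \<Longrightarrow> exp_size e < 200 \<Longrightarrow> 1 + cost e s \<le> unit_cost L"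
  using cost_le_unit[of L s "Num 0" e] by simp

section \<open>A step calculus for programs with bounded memory\<close>

text \<open>\<open>k\<close> counts elementary steps, each charged \<open>unit_cost L\<close>. The
  bound on the final state is carried along because the cost of the next command depends on
  it.\<close>

definition runs :: "nat \<Rightarrow> com \<Rightarrow> state \<Rightarrow> nat \<Rightarrow> (state \<Rightarrow> bool) \<Rightarrow> bool" where
  "runs L c s k Q \<longleftrightarrow> (\<exists>t s'. exec c s t s' \<and> t \<le> k * unit_cost L \<and> bounded_by L s' \<and> Q s')"

lemma runs_mono:
  assumes "runs L c s k Q" "k \<le> k'" "\<And>s'. bounded_by L s' \<Longrightarrow> Q s' \<Longrightarrow> Q' s'"
  shows "runs L c s k' Q'"
  using assms unfolding runs_def by (meson le_trans mult_le_mono1)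

lemma runs_Skip: "bounded_by L s \<Longrightarrow> Q s \<Longrightarrow> runs L Skip s 1 Q"
  unfolding runs_def using exec.Skip by (fastforce simp: unit_cost_def)

lemma bounded_upd: "bounded_by L s \<Longrightarrow> v < 2 ^ L \<Longrightarrow> bounded_by L (s(x := (s x)(i := v)))"
  by (simp add: bounded_by_def)

text \<open>The premise \<open>val e s < 2 ^ L\<close> has to come from the mathematics behind each
  assignment: with \<open>val_less\<close> alone the exponent would grow every time.\<close>

lemma runs_Assign:
  assumes "bounded_by L s" "exp_size a + exp_size e \<le> 200" "val e s < 2 ^ L"
    and "Q (s(x := (s x)(val a s := val e s)))"
  shows "runs L (Assign x a e) s 1 Q"
  unfolding runs_def using exec.Assign cost_le_unit[OF assms(1,2)] bounded_upd[OF assms(1,3)] assms(4)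
  by (metis mult_1)

lemma runs_Seq:
  assumes "runs L c1 s k1 R" "\<And>s'. bounded_by L s' \<Longrightarrow> R s' \<Longrightarrow> runs L c2 s' k2 Q"
  shows "runs L (Seq c1 c2) s (k1 + k2) Q"
proof -
  obtain t1 s1 where 1: "exec c1 s t1 s1" "t1 \<le> k1 * unit_cost L" "bounded_by L s1" "R s1"
    using assms(1) by (auto simp: runs_def)
  obtain t2 s2 where 2: "exec c2 s1 t2 s2" "t2 \<le> k2 * unit_cost L" "bounded_by L s2" "Q s2"
    using assms(2)[OF 1(3,4)] by (auto simp: runs_def)
  show ?thesis unfolding runs_def using exec.Seq[OF 1(1) 2(1)] 1 2
    by (metis add_mono add_mult_distrib)
qed

lemma runs_If:
  assumes "bounded_by L s" "exp_size b < 200"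
    and "val b s \<noteq> 0 \<Longrightarrow> runs L c1 s k Q" "val b s = 0 \<Longrightarrow> runs L c2 s k Q"
  shows "runs L (If b c1 c2) s (Suc k) Q"
proof (cases "val b s = 0")
  case True
  then obtain t s' where 1: "exec c2 s t s'" "t \<le> k * unit_cost L" "bounded_by L s'" "Q s'"
    using assms(4) by (auto simp: runs_def)
  have "1 + cost b s + t \<le> Suc k * unit_cost L"
    using cost_le_unit1[OF assms(1,2)] 1(2) by simp
  then show ?thesis unfolding runs_def using exec.IfFalse[OF True 1(1)] 1 by blast
next
  case False
  then obtain t s' where 1: "exec c1 s t s'" "t \<le> k * unit_cost L" "bounded_by L s'" "Q s'"
    using assms(3) by (auto simp: runs_def)
  have "1 + cost b s + t \<le> Suc k * unit_cost L"
    using cost_le_unit1[OF assms(1,2)] 1(2) by simp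
  then show ?thesis unfolding runs_def using exec.IfTrue[OF False 1(1)] 1 by blast
qed

text \<open>Each pass costs \<open>k\<close> steps and a test and lowers \<open>\<mu>\<close>; the
  extra 1 is the failing test.\<close>

lemma runs_While:
  assumes "bounded_by L s" "P s" and b: "exp_size b < 200"
    and exit: "\<And>s. bounded_by L s \<Longrightarrow> P s \<Longrightarrow> val b s = 0 \<Longrightarrow> Q s"
    and body: "\<And>s. bounded_by L s \<Longrightarrow> P s \<Longrightarrow> val b s \<noteq> 0 \<Longrightarrow> runs L c s k (\<lambda>s'. P s' \<and> \<mu> s' < \<mu> s)"
  shows "runs L (While b c) s (1 + \<mu> s * Suc k) Q"
  using assms(1,2)
proof (induction "\<mu> s" arbitrary: s rule: less_induct)
  case less
  show ?case
  proof (cases "val b s = 0")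
    case True
    have "exec (While b c) s (1 + cost b s) s" by (rule exec.WhileFalse[OF True])
    moreover have "1 + cost b s \<le> (1 + \<mu> s * Suc k) * unit_cost L"
      using cost_le_unit1[OF less.prems(1) b] by (simp add: trans_le_add1)
    ultimately show ?thesis unfolding runs_def using less.prems exit True by blast
  next
    case False
    obtain t s' where 1: "exec c s t s'" "t \<le> k * unit_cost L" "bounded_by L s'" "P s'" "\<mu> s' < \<mu> s"
      using body[OF less.prems False] by (auto simp: runs_def)
    obtain t2 s2 where 2: "exec (While b c) s' t2 s2" "t2 \<le> (1 + \<mu> s' * Suc k) * unit_cost L"
      "bounded_by L s2" "Q s2"
      using less.hyps[OF 1(5,3,4)] by (auto simp: runs_def)
    have "1 + cost b s + t + t2 \<le> (1 + k + (1 + \<mu> s' * Suc k)) * unit_cost L"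
      using cost_le_unit1[OF less.prems(1) b] 1 2 by (simp add: add_mult_distrib)
    also have "1 + k + (1 + \<mu> s' * Suc k) = 1 + Suc (\<mu> s') * Suc k" by simp
    also have "(1 + Suc (\<mu> s') * Suc k) * unit_cost L \<le> (1 + \<mu> s * Suc k) * unit_cost L"
      using 1(5) by (intro mult_le_mono1 add_le_mono mult_le_mono) auto
    finally show ?thesis
      unfolding runs_def using exec.WhileTrue[OF False 1(1) 2(1)] 2 by blast
  qed
qed

fun mods :: "com \<Rightarrow> string set" where
  "mods Skip = {}"
| "mods (Assign x a e) = {x}"
| "mods (Seq c1 c2) = mods c1 \<union> mods c2"
| "mods (If b c1 c2) = mods c1 \<union> mods c2"
| "mods (While b c) = mods c"

definition agree :: "string set \<Rightarrow> state \<Rightarrow> state \<Rightarrow> bool" where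
  "agree S s s' \<longleftrightarrow> (\<forall>y. y \<notin> S \<longrightarrow> s' y = s y)"

lemma agree_refl [simp]: "agree S s s" by (simp add: agree_def)

lemma agree_trans: "agree S s s' \<Longrightarrow> agree T s' s'' \<Longrightarrow> T \<subseteq> S \<Longrightarrow> agree S s s''"
  by (auto simp: agree_def)

lemma agree_upd [simp]: "x \<in> S \<Longrightarrow> agree S s (s'(x := f)) = agree S s s'"
  by (auto simp: agree_def)

lemma agreeD: "agree S s s' \<Longrightarrow> y \<notin> S \<Longrightarrow> s' y = s y"
  by (simp add: agree_def)

lemma exec_agree: "exec c s t s' \<Longrightarrow> agree (mods c) s s'"
  by (induction rule: exec.induct) (auto simp: agree_def)

lemma runs_frame: "runs L c s k Q \<Longrightarrow> runs L c s k (\<lambda>s'. Q s' \<and> agree (mods c) s s')"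
  unfolding runs_def using exec_agree by blast

abbreviation Reg :: "string \<Rightarrow> exp" where "Reg x \<equiv> Cell x (Num 0)"

abbreviation set_reg :: "string \<Rightarrow> exp \<Rightarrow> com" where "set_reg x e \<equiv> Assign x (Num 0) e"

text \<open>Subtraction truncates, so the test is nonzero exactly while the counter is below
  \<open>b\<close>, which is evaluated anew before each pass.\<close>

definition For :: "string \<Rightarrow> exp \<Rightarrow> com \<Rightarrow> com" where
  "For i b c = Seq (set_reg i (Num 0))
     (While (Sub b (Reg i)) (Seq c (set_reg i (Add (Reg i) (Num 1)))))"

lemma mods_For [simp]: "mods (For i b c) = insert i (mods c)"
  by (auto simp: For_def)

text \<open>A pass consists of a test, \<open>k\<close> steps and the increment; the remaining 2 are
  the initial assignment and the failing test.\<close>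

lemma runs_For:
  assumes "bounded_by L s" and b: "exp_size b < 190" and N: "N < 2 ^ L"
    and start: "I 0 (s(i := (s i)(0 := 0)))"
    and bound: "\<And>j s'. j \<le> N \<Longrightarrow> I j s' \<Longrightarrow> s' i 0 = j \<Longrightarrow> val b s' = N"
    and exit: "\<And>s'. bounded_by L s' \<Longrightarrow> I N s' \<Longrightarrow> Q s'"
    and body: "\<And>j s'. j < N \<Longrightarrow> bounded_by L s' \<Longrightarrow> I j s' \<Longrightarrow> s' i 0 = j \<Longrightarrow>
      runs L c s' k (\<lambda>s''. s'' i 0 = j \<and> I (Suc j) (s''(i := (s'' i)(0 := Suc j))))"
  shows "runs L (For i b c) s (2 + N * (k + 2)) Q"
proof -
  let ?P = "\<lambda>s'. s' i 0 \<le> N \<and> I (s' i 0) s'"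
  let ?c = "Seq c (set_reg i (Add (Reg i) (Num 1)))"
  have val_b: "val b s' = N" if "?P s'" for s' using bound that by blast
  have body': "runs L ?c s' (k + 1) (\<lambda>s''. ?P s'' \<and> N - s'' i 0 < N - s' i 0)"
    if s': "bounded_by L s'" "?P s'" "val (Sub b (Reg i)) s' \<noteq> 0" for s'
  proof (rule runs_Seq)
    have "s' i 0 < N" using s' val_b[OF s'(2)] by simp
    then show "runs L c s' k (\<lambda>s''. s'' i 0 = s' i 0 \<and> s' i 0 < N \<and>
        I (Suc (s' i 0)) (s''(i := (s'' i)(0 := Suc (s' i 0)))))"
      using body[of "s' i 0" s'] s' by simp
  next
    fix s''
    assume "bounded_by L s''" and "s'' i 0 = s' i 0 \<and> s' i 0 < N \<and>
        I (Suc (s' i 0)) (s''(i := (s'' i)(0 := Suc (s' i 0))))"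
    then show "runs L (set_reg i (Add (Reg i) (Num 1))) s'' 1
        (\<lambda>s''. ?P s'' \<and> N - s'' i 0 < N - s' i 0)"
      using N by (intro runs_Assign) auto
  qed
  have "runs L (While (Sub b (Reg i)) ?c) s' (1 + N * (k + 2)) Q"
    if s': "bounded_by L s'" "?P s' \<and> s' i 0 = 0" for s'
  proof -
    have "runs L (While (Sub b (Reg i)) ?c) s' (1 + (N - s' i 0) * Suc (k + 1)) Q"
    proof (rule runs_While[where P = ?P and \<mu> = "\<lambda>s'. N - s' i 0"])
      show "Q s''" if "bounded_by L s''" "?P s''" "val (Sub b (Reg i)) s'' = 0" for s''
        using exit that val_b[OF that(2)] by (metis diff_is_0_eq le_antisym val.simps(1,2,4))
    qed (use s' b body' in auto)
    then show ?thesis using s' by simp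
  qed
  then have "runs L (For i b c) s (1 + (1 + N * (k + 2))) Q"
    unfolding For_def
    by (intro runs_Seq[where R = "\<lambda>s'. ?P s' \<and> s' i 0 = 0"] runs_Assign) (use assms(1) start in auto)
  then show ?thesis by (simp add: numeral_2_eq_2)
qed

section \<open>Counting loops\<close>

fun reads :: "exp \<Rightarrow> string set" where
  "reads (Num k) = {}"
| "reads (Cell x a) = insert x (reads a)"
| "reads (Add a b) = reads a \<union> reads b"
| "reads (Sub a b) = reads a \<union> reads b"
| "reads (Mul a b) = reads a \<union> reads b"
| "reads (Div a b) = reads a \<union> reads b"

lemma val_cong: "(\<And>x. x \<in> reads e \<Longrightarrow> s x = s' x) \<Longrightarrow> val e s = val e s'"
  by (induction e) auto

text \<open>Cardinalities are counts of this kind, and a universal statement is decided by counting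
  its counterexamples and comparing with zero.\<close>

fun count_loop :: "string \<Rightarrow> string list \<Rightarrow> exp \<Rightarrow> com" where
  "count_loop c [] e = If e (set_reg c (Add (Reg c) (Num 1))) Skip"
| "count_loop c (x # xs) e = For x (Reg ''n'') (count_loop c xs e)"

fun tuples :: "nat \<Rightarrow> string list \<Rightarrow> exp \<Rightarrow> state \<Rightarrow> nat" where
  "tuples n [] e s = (if val e s \<noteq> 0 then 1 else 0)"
| "tuples n (x # xs) e s = (\<Sum>j<n. tuples n xs e (s(x := (s x)(0 := j))))"

lemma mods_count_loop [simp]: "mods (count_loop c xs e) = insert c (set xs)"
  by (induction xs) auto

text \<open>Cell 0 of every counter is overwritten before \<open>e\<close> is evaluated. Its other
  cells can still be read by \<open>e\<close> and have to agree.\<close>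

lemma tuples_cong:
  assumes "\<And>y i. y \<in> reads e \<Longrightarrow> y \<notin> set xs \<or> i \<noteq> 0 \<Longrightarrow> s y i = s' y i"
  shows "tuples n xs e s = tuples n xs e s'"
  using assms
proof (induction xs arbitrary: s s')
  case Nil
  then show ?case using val_cong[of e s s'] by (force simp: fun_eq_iff)
next
  case (Cons x xs)
  show ?case
    by (simp, intro sum.cong refl Cons.IH) (use Cons.prems in auto)
qed

lemma tuples_le: "tuples n xs e s \<le> n ^ length xs"
proof (induction xs arbitrary: s)
  case (Cons x xs)
  have "tuples n (x # xs) e s \<le> (\<Sum>j<n. n ^ length xs)" 
    unfolding tuples.simps by (intro sum_mono Cons)
  then show ?case by simp
qed simp

text \<open>The \<open>- 2\<close> makes the induction close:
  \<open>2 + n * (4 * Suc n ^ k) \<le> 4 * Suc n ^ Suc k - 2\<close>, because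
  \<open>Suc n ^ k \<ge> 1\<close>.\<close>

lemma runs_count_loop:
  assumes "bounded_by L s" "distinct xs" "c \<notin> set xs" "''n'' \<notin> set xs" "c \<noteq> ''n''" "c \<notin> reads e"
    and "exp_size e < 200" "s ''n'' 0 = n" "s c 0 + n ^ length xs < 2 ^ L" "n < 2 ^ L"
  shows "runs L (count_loop c xs e) s (4 * Suc n ^ length xs - 2)
    (\<lambda>s'. s' c 0 = s c 0 + tuples n xs e s \<and>
      (\<forall>y i. y \<notin> insert c (set xs) \<or> i \<noteq> 0 \<longrightarrow> s' y i = s y i))"
  using assms
proof (induction xs arbitrary: s)
  case Nil
  have "runs L (count_loop c [] e) s (Suc 1)
    (\<lambda>s'. s' c 0 = s c 0 + tuples n [] e s \<and>
      (\<forall>y i. y \<notin> insert c (set []) \<or> i \<noteq> 0 \<longrightarrow> s' y i = s y i))"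
    unfolding count_loop.simps
  proof (rule runs_If)
    show "runs L (set_reg c (Add (Reg c) (Num 1))) s 1
      (\<lambda>s'. s' c 0 = s c 0 + tuples n [] e s \<and>
        (\<forall>y i. y \<notin> insert c (set []) \<or> i \<noteq> 0 \<longrightarrow> s' y i = s y i))"
      if "val e s \<noteq> 0"
      by (rule runs_Assign) (use that Nil.prems in auto)
    show "runs L Skip s 1
      (\<lambda>s'. s' c 0 = s c 0 + tuples n [] e s \<and>
        (\<forall>y i. y \<notin> insert c (set []) \<or> i \<noteq> 0 \<longrightarrow> s' y i = s y i))"
      if "val e s = 0"
      by (rule runs_Skip) (use that Nil.prems in auto)
  qed (use Nil.prems in auto)
  then show ?case by (simp add: numeral_2_eq_2)
next
  case (Cons x xs)
  let ?k = "4 * Suc n ^ length xs - 2"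
  let ?F = "\<lambda>s' :: state. \<forall>y i. y \<notin> insert c (set (x # xs)) \<or> i \<noteq> 0 \<longrightarrow> s' y i = s y i"
  let ?I = "\<lambda>j s'. s' c 0 = s c 0 + (\<Sum>l<j. tuples n xs e (s(x := (s x)(0 := l)))) \<and> ?F s'"
  have "runs L (For x (Reg ''n'') (count_loop c xs e)) s (2 + n * (?k + 2))
      (\<lambda>s'. s' c 0 = s c 0 + tuples n (x # xs) e s \<and> ?F s')"
  proof (rule runs_For[where I = ?I])
    fix j s' assume j: "j < n" "bounded_by L s'" "?I j s'" "s' x 0 = j"
    have eq: "tuples n xs e s' = tuples n xs e (s(x := (s x)(0 := j)))"
    proof (rule tuples_cong)
      fix y and i :: nat assume *: "y \<in> reads e" "y \<notin> set xs \<or> i \<noteq> 0"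
      then have "y \<noteq> c" using Cons.prems by auto
      then show "s' y i = (s(x := (s x)(0 := j))) y i" using * j by auto
    qed
    have "(\<Sum>l<j. tuples n xs e (s(x := (s x)(0 := l)))) + n ^ length xs
        \<le> (\<Sum>l<j. n ^ length xs) + n ^ length xs" by (intro add_mono sum_mono tuples_le) simp
    also have "\<dots> = Suc j * n ^ length xs" by simp
    also have "\<dots> \<le> n ^ length (x # xs)" using j(1) by (simp add: Suc_le_eq del: mult_Suc)
    finally have "s' c 0 + n ^ length xs < 2 ^ L" using j Cons.prems(9) by simp
    then have "runs L (count_loop c xs e) s' ?k
      (\<lambda>s''. s'' c 0 = s' c 0 + tuples n xs e s' \<and>
        (\<forall>y i. y \<notin> insert c (set xs) \<or> i \<noteq> 0 \<longrightarrow> s'' y i = s' y i))"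
      using Cons.prems j by (intro Cons.IH) auto
    then show "runs L (count_loop c xs e) s' ?k
      (\<lambda>s''. s'' x 0 = j \<and> ?I (Suc j) (s''(x := (s'' x)(0 := Suc j))))"
      by (rule runs_mono) (use j Cons.prems eq in auto)
  next
    show "val (Reg ''n'') s' = n" if "?I j s'" for j s'
      using that Cons.prems by auto
  qed (use Cons.prems in auto)
  then show ?case unfolding count_loop.simps
  proof (rule runs_mono)
    have "4 * Suc n ^ length xs \<ge> 4" by simp
    then have "2 + n * (?k + 2) = 2 + n * (4 * Suc n ^ length xs)"
      by (metis Nat.le_imp_diff_is_add add.commute add_leD2 le_add_diff_inverse2 numeral_Bit0)
    also have "\<dots> \<le> 4 * Suc n ^ length xs + n * (4 * Suc n ^ length xs) - 2"
      using \<open>4 * Suc n ^ length xs \<ge> 4\<close> by linarith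
    also have "\<dots> = 4 * Suc n ^ length (x # xs) - 2" by (simp add: algebra_simps)
    finally show "2 + n * (?k + 2) \<le> 4 * Suc n ^ length (x # xs) - 2" .
  qed (use Cons.prems in auto)
qed

section \<open>Finding a nested vertex\<close>

lemma runs_Assign_Seq:
  assumes "bounded_by L s" "exp_size a + exp_size e \<le> 200" "val e s < 2 ^ L"
    and "bounded_by L (s(x := (s x)(val a s := val e s))) \<Longrightarrow> runs L c (s(x := (s x)(val a s := val e s))) k Q"
  shows "runs L (Seq (Assign x a e) c) s (1 + k) Q"
proof (rule runs_Seq)
  show "runs L (Assign x a e) s 1 (\<lambda>s'. s' = s(x := (s x)(val a s := val e s)))"
    using assms(1-3) by (rule runs_Assign) simp
qed (use assms(4) in auto)

lemma sum_indicator_card: "(\<Sum>l<n. if P l then 1 else 0 :: nat) = card {l :: nat. l < n \<and> P l}"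
  by (subst sum.If_cases) (auto intro: arg_cong[where f = card])

section \<open>The graph and the remaining vertices in memory\<close>

text \<open>Cell 0 of the input holds \<open>n\<close>, so the adjacency matrix starts at address
  1.\<close>

abbreviation adjE :: "string \<Rightarrow> string \<Rightarrow> exp" where
  "adjE a b \<equiv> Cell ''input'' (Add (Num 1) (Add (Mul (Reg a) (Reg ''n'')) (Reg b)))"

abbreviation At :: "string \<Rightarrow> string \<Rightarrow> exp" where
  "At a i \<equiv> Cell a (Reg i)"

definition graph_in :: "nat \<Rightarrow> nat set set \<Rightarrow> state \<Rightarrow> bool" where
  "graph_in n E s \<longleftrightarrow> s ''n'' 0 = n \<and>
    (\<forall>u<n. \<forall>v<n. s ''input'' (Suc (u * n + v)) = (if {u, v} \<in> E then 1 else 0))"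

definition alive_in :: "nat \<Rightarrow> nat set \<Rightarrow> state \<Rightarrow> bool" where
  "alive_in n X s \<longleftrightarrow> X \<subseteq> {..<n} \<and> (\<forall>u<n. s ''alive'' u = (if u \<in> X then 1 else 0))"

lemma graph_inD:
  assumes "graph_in n E s"
  shows "s ''n'' 0 = n" "u < n \<Longrightarrow> v < n \<Longrightarrow> s ''input'' (Suc (u * n + v)) = (if {u, v} \<in> E then 1 else 0)"
  using assms by (auto simp: graph_in_def)

lemma alive_inD:
  assumes "alive_in n X s"
  shows "u < n \<Longrightarrow> s ''alive'' u = (if u \<in> X then 1 else 0)" "u \<in> X \<Longrightarrow> u < n"
  using assms by (auto simp: alive_in_def)

lemma graph_in_agree:
  "graph_in n E s \<Longrightarrow> agree S s s' \<Longrightarrow> ''n'' \<notin> S \<Longrightarrow> ''input'' \<notin> S \<Longrightarrow> graph_in n E s'"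
  by (simp add: graph_in_def agree_def)

lemma alive_in_agree:
  "alive_in n X s \<Longrightarrow> agree S s s' \<Longrightarrow> ''alive'' \<notin> S \<Longrightarrow> alive_in n X s'"
  by (simp add: alive_in_def agree_def)

definition keys_com :: com where
  "keys_com = For ''v'' (Reg ''n'')
    (Seq (set_reg ''c'' (Num 0))
    (Seq (count_loop ''c'' [''y''] (Mul (At ''alive'' ''y'') (adjE ''v'' ''y'')))
      (Assign ''key'' (Reg ''v'') (Add (Mul (Reg ''c'') (Reg ''n'')) (Reg ''v'')))))"

lemma keys_runs:
  assumes s: "bounded_by L s" "graph_in n E s" "alive_in n X s" and L: "Suc n ^ 3 < 2 ^ L"
  shows "runs L keys_com s (2 + n * (4 * n + 6)) (\<lambda>s'. \<forall>u<n. s' ''key'' u = degree_key n E X u)"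
proof -
  let ?S = "{''v'', ''c'', ''y'', ''key''}"
  have "n < Suc n ^ 3" using self_le_power[of "Suc n" 3] by simp
  then have nL: "n < 2 ^ L" using L by simp
  have nnL: "n * n + n < 2 ^ L"
  proof -
    have "n * n + n < Suc n ^ 3" by (simp add: power3_eq_cube algebra_simps)
    then show ?thesis using L by simp
  qed
  have body: "runs L (Seq (set_reg ''c'' (Num 0))
    (Seq (count_loop ''c'' [''y''] (Mul (At ''alive'' ''y'') (adjE ''v'' ''y'')))
      (Assign ''key'' (Reg ''v'') (Add (Mul (Reg ''c'') (Reg ''n'')) (Reg ''v''))))) s1 (1 + ((4 * Suc n ^ length [''y''] - 2) + 1))
    (\<lambda>s'. s' ''v'' 0 = j \<and> agree ?S s (s'(''v'' := (s' ''v'')(0 := Suc j))) \<and>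
       (\<forall>u<Suc j. (s'(''v'' := (s' ''v'')(0 := Suc j))) ''key'' u = degree_key n E X u))"
    if j: "j < n" "bounded_by L s1" "agree ?S s s1" "\<forall>u<j. s1 ''key'' u = degree_key n E X u" "s1 ''v'' 0 = j"
    for j s1
  proof (rule runs_Assign_Seq, goal_cases)
    case 4
    let ?s2 = "s1(''c'' := (s1 ''c'')(val (Num 0) s1 := val (Num 0) s1))"
    let ?e = "Mul (At ''alive'' ''y'') (adjE ''v'' ''y'')"
    note g = graph_in_agree[OF s(2) j(3)] and al = alive_in_agree[OF s(3) j(3)]
    have g: "graph_in n E s1" and al: "alive_in n X s1" using g al by simp_all
    have "tuples n [''y''] ?e ?s2 = card {l. l < n \<and> val ?e (?s2(''y'' := (?s2 ''y'')(0 := l))) \<noteq> 0}"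
      by (simp only: tuples.simps sum_indicator_card)
    also have "{l. l < n \<and> val ?e (?s2(''y'' := (?s2 ''y'')(0 := l))) \<noteq> 0} = nbrs E X j"
      using j(1,5) graph_inD[OF g] alive_inD[OF al] by (auto split: if_splits)
    finally have t: "tuples n [''y''] ?e ?s2 = card (nbrs E X j)" .
    have cN: "card (nbrs E X j) \<le> n"
      using card_mono[of "{..<n}" "nbrs E X j"] alive_inD(2)[OF al] by auto
    show ?case
    proof (rule runs_Seq[OF runs_count_loop[where n = n]], goal_cases)
      case (11 s3)
      have "s3 ''c'' 0 = card (nbrs E X j)" using 11 t by simp
      moreover have "card (nbrs E X j) * n + j < 2 ^ L"
        using mult_le_mono1[OF cN, of n] nnL j(1) by linarith
      moreover have "s3 ''v'' 0 = j" "s3 ''n'' 0 = n" "s3 ''key'' = s1 ''key''"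
        using 11 j graph_inD[OF g] by (auto simp: fun_eq_iff)
      moreover have "agree ?S s s3" using 11 j(3) by (auto simp: agree_def fun_eq_iff)
      ultimately show ?case using 11 j
        by (intro runs_Assign) (auto simp: degree_key_def less_Suc_eq)
    qed (use 4 graph_inD[OF g] nL in auto)
  qed (use j in auto)
  have "runs L keys_com s (2 + n * ((1 + ((4 * Suc n ^ length [''y''] - 2) + 1)) + 2))
    (\<lambda>s'. \<forall>u<n. s' ''key'' u = degree_key n E X u)"
    unfolding keys_com_def
  proof (rule runs_For[where I = "\<lambda>j s'. agree ?S s s' \<and> (\<forall>u<j. s' ''key'' u = degree_key n E X u)"], goal_cases)
    case (7 j s')
    then show ?case by (intro body) auto
  qed (use s nL in \<open>auto simp: agree_def graph_in_def\<close>)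
  then show ?thesis by (rule runs_mono) (auto simp: algebra_simps)
qed

text \<open>Nonzero exactly if \<open>i\<close>, \<open>j\<close>, \<open>y\<close> in the roles of
  \<open>a\<close>, \<open>b\<close>, \<open>c\<close> refute nestedness at \<open>v\<close>.
  Products are conjunctions, a truncated difference is a comparison, \<open>Sub (Num 1)\<close> is
  negation, and the sum of both differences says that \<open>y\<close> and \<open>j\<close> are
  distinct.\<close>

definition nested_test :: exp where
  "nested_test = Mul (Mul (adjE ''v'' ''i'') (At ''alive'' ''i''))
    (Mul (Mul (adjE ''v'' ''j'') (At ''alive'' ''j''))
    (Mul (Sub (At ''key'' ''j'') (At ''key'' ''i''))
    (Mul (Mul (At ''alive'' ''y'') (Add (Sub (Reg ''y'') (Reg ''j'')) (Sub (Reg ''j'') (Reg ''y''))))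
      (Mul (adjE ''i'' ''y'') (Sub (Num 1) (adjE ''j'' ''y''))))))"

text \<open>There is no early exit: every remaining nested vertex overwrites \<open>x\<close>, and
  the last one stays. Until the first has been met, \<open>x\<close> carries no information.\<close>

definition find_com :: com where
  "find_com = For ''v'' (Reg ''n'')
    (Seq (set_reg ''c'' (Num 0))
    (Seq (count_loop ''c'' [''i'', ''j'', ''y''] nested_test)
      (If (Mul (At ''alive'' ''v'') (Sub (Num 1) (Reg ''c''))) (set_reg ''x'' (Reg ''v'')) Skip)))"

lemma tuples_nested_test:
  assumes g: "graph_in n E s" and al: "alive_in n X s"
    and key: "\<forall>u<n. s ''key'' u = key u" and v: "s ''v'' 0 = v" "v < n"
  shows "tuples n [''i'', ''j'', ''y''] nested_test s = 0 \<longleftrightarrow> nested_at E X key v"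
proof -
  let ?s = "\<lambda>a b c. s(''i'' := (s ''i'')(0 := a), ''j'' := (s ''j'')(0 := b), ''y'' := (s ''y'')(0 := c))"
  have "tuples n [''i'', ''j'', ''y''] nested_test s = 0 \<longleftrightarrow>
      (\<forall>a<n. \<forall>b<n. \<forall>c<n. val nested_test (?s a b c) = 0)"
    by (simp add: Ball_def) (metis not_gr_zero)
  also have "\<dots> \<longleftrightarrow> (\<forall>a<n. \<forall>b<n. \<forall>c<n. a \<in> nbrs E X v \<longrightarrow> b \<in> nbrs E X v \<longrightarrow> key a < key b \<longrightarrow>
      c \<in> X \<longrightarrow> c \<noteq> b \<longrightarrow> {a, c} \<in> E \<longrightarrow> {b, c} \<in> E)"
  proof (intro all_cong)
    fix a b c assume abc: "a < n" "b < n" "c < n"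
    have cb: "(c - b) + (b - c) = 0 \<longleftrightarrow> c = b" by auto
    show "val nested_test (?s a b c) = 0 \<longleftrightarrow> (a \<in> nbrs E X v \<longrightarrow> b \<in> nbrs E X v \<longrightarrow> key a < key b \<longrightarrow>
      c \<in> X \<longrightarrow> c \<noteq> b \<longrightarrow> {a, c} \<in> E \<longrightarrow> {b, c} \<in> E)"
      unfolding nested_test_def using abc v key graph_inD[OF g] alive_inD[OF al] cb
      by (auto split: if_splits)
  qed
  also have "\<dots> \<longleftrightarrow> nested_at E X key v"
    unfolding nested_at_def using alive_inD(2)[OF al] by blast
  finally show ?thesis .
qed

lemma find_runs:
  assumes s: "bounded_by L s" "graph_in n E s" "alive_in n X s" and L: "Suc n ^ 3 < 2 ^ L"
    and key: "\<forall>u<n. s ''key'' u = key u" and ex: "\<exists>v\<in>X. nested_at E X key v"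
  shows "runs L find_com s (2 + n * (4 * Suc n ^ 3 + 3)) (\<lambda>s'. s' ''x'' 0 \<in> X \<and> nested_at E X key (s' ''x'' 0))"
proof -
  let ?S = "{''v'', ''c'', ''i'', ''j'', ''y'', ''x''}"
  let ?xs = "[''i'', ''j'', ''y'']"
  have "n < Suc n ^ 3" using self_le_power[of "Suc n" 3] by simp
  then have nL: "n < 2 ^ L" using L by simp
  have "n ^ 3 \<le> Suc n ^ 3" by (intro power_mono) auto
  then have n3: "n ^ 3 < 2 ^ L" using L by (rule le_less_trans)
  let ?I = "\<lambda>j s'. agree ?S s s' \<and>
    ((\<exists>u<j. u \<in> X \<and> nested_at E X key u) \<longrightarrow> s' ''x'' 0 \<in> X \<and> nested_at E X key (s' ''x'' 0))"
  have body: "runs L (Seq (set_reg ''c'' (Num 0))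
    (Seq (count_loop ''c'' ?xs nested_test)
      (If (Mul (At ''alive'' ''v'') (Sub (Num 1) (Reg ''c''))) (set_reg ''x'' (Reg ''v'')) Skip)))
    s1 (1 + ((4 * Suc n ^ length ?xs - 2) + Suc 1))
    (\<lambda>s'. s' ''v'' 0 = j \<and> ?I (Suc j) (s'(''v'' := (s' ''v'')(0 := Suc j))))"
    if j: "j < n" "bounded_by L s1" "?I j s1" "s1 ''v'' 0 = j"
    for j s1
  proof (rule runs_Assign_Seq, goal_cases)
    case 4
    let ?s2 = "s1(''c'' := (s1 ''c'')(val (Num 0) s1 := val (Num 0) s1))"
    have ag: "agree ?S s ?s2" using j by simp
    have g: "graph_in n E ?s2" and al: "alive_in n X ?s2" and key2: "\<forall>u<n. ?s2 ''key'' u = key u"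
      using graph_in_agree[OF s(2) ag] alive_in_agree[OF s(3) ag] key agreeD[OF ag, of "''key''"] by simp_all
    have t: "tuples n ?xs nested_test ?s2 = 0 \<longleftrightarrow> nested_at E X key j"
      by (rule tuples_nested_test[OF g al key2]) (use j in auto)
    show ?case
    proof (rule runs_Seq[OF runs_count_loop[where n = n]], goal_cases)
      case (11 s3)
      have c: "s3 ''c'' 0 = 0 \<longleftrightarrow> nested_at E X key j" using 11 t by simp
      have fr: "s3 ''v'' 0 = j" "s3 ''x'' 0 = s1 ''x'' 0" using 11 j by auto
      have ag3: "agree ?S s s3" using 11 ag by (auto simp: agree_def fun_eq_iff)
      have al3: "s3 ''alive'' j = (if j \<in> X then 1 else 0)"
        using alive_inD(1)[OF alive_in_agree[OF s(3) ag3]] j(1) by simp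
      show ?case
      proof (rule runs_If)
        show "runs L (set_reg ''x'' (Reg ''v'')) s3 1
            (\<lambda>s'. s' ''v'' 0 = j \<and> ?I (Suc j) (s'(''v'' := (s' ''v'')(0 := Suc j))))"
          if "val (Mul (At ''alive'' ''v'') (Sub (Num 1) (Reg ''c''))) s3 \<noteq> 0"
        proof (rule runs_Assign)
          have "j \<in> X" "nested_at E X key j" using that fr al3 c by (auto split: if_splits)
          then show "(\<lambda>s'. s' ''v'' 0 = j \<and> ?I (Suc j) (s'(''v'' := (s' ''v'')(0 := Suc j))))
            (s3(''x'' := (s3 ''x'')(val (Num 0) s3 := val (Reg ''v'') s3)))"
            using fr ag3 by auto
          show "val (Reg ''v'') s3 < 2 ^ L" using 11(1) by (simp add: bounded_by_def)
        qed (use 11(1) in auto)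
        show "runs L Skip s3 1
            (\<lambda>s'. s' ''v'' 0 = j \<and> ?I (Suc j) (s'(''v'' := (s' ''v'')(0 := Suc j))))"
          if "val (Mul (At ''alive'' ''v'') (Sub (Num 1) (Reg ''c''))) s3 = 0"
        proof (rule runs_Skip)
          have "\<not> (j \<in> X \<and> nested_at E X key j)" using that fr al3 c by (auto split: if_splits)
          then show "s3 ''v'' 0 = j \<and> ?I (Suc j) (s3(''v'' := (s3 ''v'')(0 := Suc j)))"
            using fr ag3 j(3) by (auto simp: less_Suc_eq)
        qed (use 11 in auto)
      qed (use 11 in auto)
    qed (use 4 graph_inD[OF g] nL n3 in \<open>auto simp: nested_test_def power3_eq_cube\<close>)
  qed (use j in auto)
  have "runs L find_com s (2 + n * ((1 + ((4 * Suc n ^ length ?xs - 2) + Suc 1)) + 2))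
    (\<lambda>s'. s' ''x'' 0 \<in> X \<and> nested_at E X key (s' ''x'' 0))"
    unfolding find_com_def
  proof (rule runs_For[where I = ?I], goal_cases)
    case (7 j s')
    then show ?case by (intro body) auto
  next
    case (6 s')
    then show ?case using ex alive_inD(2)[OF s(3)] by blast
  qed (use s nL in \<open>auto simp: agree_def graph_in_def\<close>)
  then show ?thesis
  proof (rule runs_mono)
    have "1 \<le> Suc n ^ 3" by simp
    then have "(1 + ((4 * Suc n ^ length ?xs - 2) + Suc 1)) + 2 \<le> 4 * Suc n ^ 3 + 3"
      by (simp add: eval_nat_numeral)
    then show "2 + n * ((1 + ((4 * Suc n ^ length ?xs - 2) + Suc 1)) + 2) \<le> 2 + n * (4 * Suc n ^ 3 + 3)"
      by (intro add_left_mono mult_left_mono) auto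
  qed auto
qed

section \<open>Updating the weights\<close>

definition rat_weight :: "nat \<Rightarrow> (nat \<Rightarrow> nat) \<Rightarrow> nat \<Rightarrow> rat" where
  "rat_weight M W v = of_nat (W v) / of_nat M"

definition elim_round ::
  "nat set set \<Rightarrow> nat set \<Rightarrow> (nat \<Rightarrow> nat) \<Rightarrow> nat \<Rightarrow> (nat \<Rightarrow> nat) \<Rightarrow> nat \<Rightarrow> nat \<Rightarrow> nat" where
  "elim_round E X key M W x u = nat \<lfloor>of_nat M * elim_weight E X key (rat_weight M W) x u\<rfloor>"

abbreviation nbrs_before :: "nat set set \<Rightarrow> nat set \<Rightarrow> (nat \<Rightarrow> nat) \<Rightarrow> nat \<Rightarrow> nat \<Rightarrow> nat set" where
  "nbrs_before E X key x k \<equiv> {y \<in> nbrs E X x. key y < k}"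

lemma rat_weight_nonneg [simp]: "0 \<le> rat_weight M W v"
  by (simp add: rat_weight_def)

text \<open>Clearing denominators; it turns bounds on rational products into bounds on the integers
  in memory.\<close>

lemma prod_rat_weight:
  assumes "0 < M"
  shows "(of_nat M :: rat) ^ card A * (\<Prod>v\<in>A. 1 + rat_weight M W v) = of_nat (\<Prod>v\<in>A. M + W v)"
proof -
  have "(of_nat M :: rat) ^ card A * (\<Prod>v\<in>A. 1 + rat_weight M W v) =
      (\<Prod>v\<in>A. of_nat M * (1 + rat_weight M W v))"
    by (simp add: prod.distrib)
  also have "\<dots> = (\<Prod>v\<in>A. of_nat (M + W v))"
    by (rule prod.cong) (use assms in \<open>auto simp: rat_weight_def field_simps\<close>)
  finally show ?thesis by simp
qed

text \<open>Let \<open>a\<close> be the smallest neighbour of \<open>u\<close> among the earlier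
  members of the chain. By nestedness all later ones before \<open>u\<close> are adjacent to
  \<open>u\<close> as well, so the non-neighbours are those before \<open>a\<close>. The bound
  \<open>k \<le> key u\<close> means that their partition function has been tabulated
  already.\<close>

lemma below_eq_nbrs_before:
  assumes "finite X" "inj_on key X" "nested_at E X key x" "u \<in> nbrs E X x"
  shows "\<exists>k\<le>key u. below E X key x u = nbrs_before E X key x k"
proof (cases "\<exists>y\<in>nbrs_before E X key x (key u). {u, y} \<in> E")
  case False
  then have "below E X key x u = nbrs_before E X key x (key u)" by (auto simp: below_def)
  then show ?thesis by blast
next
  case True
  define a where "a = arg_min_on key {y \<in> nbrs_before E X key x (key u). {u, y} \<in> E}"
  have fin: "finite {y \<in> nbrs_before E X key x (key u). {u, y} \<in> E}" using assms(1) by simp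
  have a: "a \<in> {y \<in> nbrs_before E X key x (key u). {u, y} \<in> E}"
    unfolding a_def by (rule arg_min_if_finite(1)) (use fin True in auto)
  have min: "key a \<le> key y" if "y \<in> nbrs_before E X key x (key u)" "{u, y} \<in> E" for y
    unfolding a_def by (rule arg_min_least) (use fin that in auto)
  have "below E X key x u = nbrs_before E X key x (key a)"
  proof (intro equalityI subsetI)
    fix y assume y: "y \<in> below E X key x u"
    have "\<not> key a < key y"
    proof
      assume "key a < key y"
      moreover have "{a, u} \<in> E" "u \<noteq> y" "y \<in> nbrs E X x" "a \<in> nbrs E X x" "u \<in> X"
        using a y assms(4) by (auto simp: below_def insert_commute)
      ultimately have "{y, u} \<in> E" using assms(3) unfolding nested_at_def by blast
      then show False using y by (simp add: below_def insert_commute)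
    qed
    moreover have "key a \<noteq> key y"
      using a y assms(2) by (auto simp: below_def dest: inj_onD)
    ultimately show "y \<in> nbrs_before E X key x (key a)" using y by (auto simp: below_def)
  next
    fix y assume y: "y \<in> nbrs_before E X key x (key a)"
    then show "y \<in> below E X key x u" using min[of y] a by (auto simp: below_def)
  qed
  then show ?thesis using a by (intro exI[of _ "key a"]) auto
qed

text \<open>Multiplied by \<open>M ^ Suc r\<close>, numerator and denominator of \<open>M\<close>
  times the exact weight become integers, and the floor of a quotient of integers is
  \<open>div\<close>.\<close>

lemma elim_round_eq:
  assumes "0 < M" "finite X" "u \<in> nbrs E X x" "r = card (below E X key x u)"
    and q: "of_nat q = of_nat M ^ r * Z (below E X key x u) E (rat_weight M W)"
  shows "elim_round E X key M W x u = (W u * q * M) div (W x * M ^ r + q * M)"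
proof -
  let ?z = "Z (below E X key x u) E (rat_weight M W)"
  have z: "1 \<le> ?z" by (rule Z_ge_1) (use assms(2) in \<open>auto simp: below_def\<close>)
  have pos: "rat_weight M W x + ?z > 0" using z by (simp add: add_nonneg_pos)
  have M: "(of_nat M :: rat) > 0" using assms by simp
  have den: "(of_nat (W x * M ^ r + q * M) :: rat) = of_nat M ^ r * of_nat M * (rat_weight M W x + ?z)"
    using M by (simp add: q rat_weight_def field_simps)
  have num: "(of_nat (W u * q * M) :: rat) = of_nat M ^ r * of_nat M * (of_nat (W u) * ?z)"
    using M by (simp add: q field_simps)
  have "of_nat M * elim_weight E X key (rat_weight M W) x u
      = of_nat (W u) * ?z / (rat_weight M W x + ?z)"
    using assms(3) M by (simp add: elim_weight_def) (simp add: rat_weight_def)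
  also have "\<dots> = of_nat (W u * q * M) / of_nat (W x * M ^ r + q * M)"
    unfolding den num using M pos by simp
  finally have "of_nat M * elim_weight E X key (rat_weight M W) x u
      = of_nat (W u * q * M) / (of_nat (W x * M ^ r + q * M) :: rat)" .
  then show ?thesis unfolding elim_round_def by (simp only: floor_divide_of_nat_eq nat_int)
qed

section \<open>Programs that update the weights\<close>

definition rank_test :: exp where
  "rank_test = Mul (Mul (At ''alive'' ''y'') (adjE ''x'' ''y''))
    (Mul (Sub (Reg ''k'') (At ''key'' ''y'')) (Sub (Num 1) (adjE ''u'' ''y'')))"

definition is_next :: exp where
  "is_next = Mul (Mul (At ''alive'' ''u'') (adjE ''x'' ''u''))
    (Sub (Num 1) (Add (Sub (At ''key'' ''u'') (Reg ''k'')) (Sub (Reg ''k'') (At ''key'' ''u''))))"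

text \<open>The new entry of \<open>Q\<close> is computed before \<open>W\<close> at
  \<open>u\<close> is overwritten, since its recursion refers to the old weights. The power
  \<open>pw\<close> at \<open>t - c\<close> lifts an entry scaled by \<open>M ^ c\<close> to the
  scale \<open>M ^ t\<close>.\<close>

definition update_com :: com where
  "update_com = Seq (set_reg ''c'' (Num 0))
    (Seq (count_loop ''c'' [''y''] rank_test)
    (Seq (Assign ''Q'' (Add (Reg ''t'') (Num 1))
      (Add (Mul (Reg ''M'') (At ''Q'' ''t''))
        (Mul (At ''W'' ''u'') (Mul (At ''Q'' ''c'') (Cell ''pw'' (Sub (Reg ''t'') (Reg ''c'')))))))
    (Seq (Assign ''W'' (Reg ''u'')
      (Div (Mul (Mul (At ''W'' ''u'') (At ''Q'' ''c'')) (Reg ''M''))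
        (Add (Mul (At ''W'' ''x'') (At ''pw'' ''c'')) (Mul (At ''Q'' ''c'') (Reg ''M'')))))
    (set_reg ''t'' (Add (Reg ''t'') (Num 1))))))"

text \<open>Instead of sorting the neighbours, \<open>k\<close> runs through all numbers below
  \<open>n * (n + 1)\<close>, which include every key. The only vertex whose key can be
  \<open>k\<close> is \<open>k mod n\<close>.\<close>

definition elim_com :: com where
  "elim_com = For ''k'' (Mul (Reg ''n'') (Add (Reg ''n'') (Num 1)))
    (Seq (set_reg ''u'' (Sub (Reg ''k'') (Mul (Div (Reg ''k'') (Reg ''n'')) (Reg ''n''))))
      (If is_next update_com Skip))"

definition elim_vars :: "string set" where
  "elim_vars = {''k'', ''u'', ''c'', ''y'', ''Q'', ''W'', ''t''}"

text \<open>\<open>Q\<close> is indexed by cardinalities: the sets \<open>nbrs_before\<close> form a chain, and by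
  \<open>below_eq_nbrs_before\<close> every partition function needed is that of a member of this chain.
  Scaling by the power of \<open>M\<close> makes the entries integers.\<close>

definition elim_inv :: "nat set set \<Rightarrow> nat set \<Rightarrow> (nat \<Rightarrow> nat) \<Rightarrow> nat \<Rightarrow> (nat \<Rightarrow> nat) \<Rightarrow> nat \<Rightarrow>
    nat \<Rightarrow> state \<Rightarrow> bool" where
  "elim_inv E X key M W x k s \<longleftrightarrow>
    s ''t'' 0 = card (nbrs_before E X key x k) \<and>
    (\<forall>l\<le>k. of_nat (s ''Q'' (card (nbrs_before E X key x l))) =
       (of_nat M ^ card (nbrs_before E X key x l) * Z (nbrs_before E X key x l) E (rat_weight M W) :: rat)) \<and>
    (\<forall>v\<in>X. s ''W'' v = (if v \<in> nbrs E X x \<and> key v < k then elim_round E X key M W x v else W v))"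

lemma elim_round_le:
  assumes "0 < M" "finite X" "x \<in> X" "u \<in> X"
  shows "elim_round E X key M W x u \<le> W u"
proof -
  have "elim_weight E X key (rat_weight M W) x u \<le> rat_weight M W u"
    by (rule elim_weight_bounds) (use assms in auto)
  then have "of_nat M * elim_weight E X key (rat_weight M W) x u \<le> of_nat M * rat_weight M W u"
    by (intro mult_left_mono) auto
  also have "\<dots> = of_nat (W u)" using assms(1) by (simp add: rat_weight_def)
  finally have "\<lfloor>of_nat M * elim_weight E X key (rat_weight M W) x u\<rfloor> \<le> int (W u)"
    by (metis floor_mono floor_of_nat)
  then show ?thesis by (simp add: elim_round_def)
qed

lemma update_runs:
  assumes s: "bounded_by L s" "graph_in n E s" "alive_in n X s" and L: "Suc n ^ 3 < 2 ^ L"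
    and key: "\<forall>u<n. s ''key'' u = key u" and inj: "inj_on key X"
    and x: "x \<in> X" "s ''x'' 0 = x" "nested_at E X key x" and loopless: "\<And>v. v \<in> X \<Longrightarrow> {v} \<notin> E"
    and M: "s ''M'' 0 = M" "0 < M" and pw: "\<forall>i\<le>n. s ''pw'' i = M ^ i"
    and prodL: "(\<Prod>v\<in>X. M + W v) < 2 ^ L"
    and u: "s ''u'' 0 = u" "s ''k'' 0 = key u" "u \<in> nbrs E X x"
    and inv: "elim_inv E X key M W x (key u) s"
  shows "runs L update_com s (4 * n + 6) (\<lambda>s'. elim_inv E X key M W x (Suc (key u)) s')"
proof -
  let ?b = "below E X key x u" and ?N = "nbrs_before E X key x" and ?w = "rat_weight M W"
  define r where "r = card ?b"
  define s2 where "s2 = s(''c'' := (s ''c'')(val (Num 0) s := val (Num 0) s))"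
  have finX: "finite X" and X: "\<And>v. v \<in> X \<Longrightarrow> v < n"
    using s(3) finite_subset by (auto simp: alive_in_def)
  have finN: "finite (?N l)" for l using finX by simp
  have uX: "u \<in> X" and un: "u < n" and xn: "x < n" using u(3) x X by auto
  have ux: "u \<noteq> x" using u(3) loopless x by auto
  have nL: "n < 2 ^ L"
    using self_le_power[of "Suc n" 3] L by simp
  obtain k0 where k0: "k0 \<le> key u" "?b = ?N k0"
    using below_eq_nbrs_before[OF finX inj x(3) u(3)] by blast
  have Nsuc: "?N (Suc (key u)) = insert u (?N (key u))"
    using u(3) inj by (auto simp: less_Suc_eq dest: inj_onD)
  have uN: "u \<notin> ?N (key u)" by simp
  have cN: "card (?N (Suc (key u))) = Suc (card (?N (key u)))"
    unfolding Nsuc using finN uN by (rule card_insert_disjoint)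
  have bN: "?b \<subseteq> ?N (key u)" by (auto simp: below_def)
  have rt: "r \<le> s ''t'' 0"
    using card_mono[OF finN bN] inv by (simp add: elim_inv_def r_def)
  have "card (?N (key u)) \<le> card {..<n}" by (intro card_mono) (use X in auto)
  then have tn: "s ''t'' 0 \<le> n" using inv by (simp add: elim_inv_def)
  have Qr: "of_nat (s ''Q'' r) = (of_nat M ^ r * Z ?b E ?w :: rat)"
    using inv k0 by (simp add: elim_inv_def r_def)
  have Qt: "of_nat (s ''Q'' (s ''t'' 0)) = (of_nat M ^ (s ''t'' 0) * Z (?N (key u)) E ?w :: rat)"
    using inv by (simp add: elim_inv_def)
  have Wu: "s ''W'' u = W u" using inv uX by (simp add: elim_inv_def)
  have Wx: "s ''W'' x = W x"
    using inv x(1) loopless[OF x(1)] by (simp add: elim_inv_def)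
  define q where "q = M * s ''Q'' (s ''t'' 0) + W u * (s ''Q'' r * M ^ (s ''t'' 0 - r))"
  have Zrec: "Z (?N (Suc (key u))) E ?w = Z (?N (key u)) E ?w + ?w u * Z ?b E ?w"
  proof -
    have "insert u (?N (key u)) - {u} = ?N (key u)" by auto
    moreover have "{y \<in> insert u (?N (key u)) - {u}. {u, y} \<notin> E} = ?b" by (auto simp: below_def)
    ultimately show ?thesis
      using Z_rec[of "insert u (?N (key u))" u E ?w] loopless[OF uX] finN unfolding Nsuc by simp
  qed
  have Mpow: "(of_nat M :: rat) ^ (s ''t'' 0) = of_nat M ^ (s ''t'' 0 - r) * of_nat M ^ r"
    using rt by (simp flip: power_add)
  have q: "of_nat q = (of_nat M ^ card (?N (Suc (key u))) * Z (?N (Suc (key u))) E ?w :: rat)"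
  proof -
    have t: "card (?N (key u)) = s ''t'' 0" using inv by (simp add: elim_inv_def)
    have Wu': "of_nat (W u) = of_nat M * ?w u" using M(2) by (simp add: rat_weight_def)
    have "(of_nat (W u) :: rat) * (of_nat M ^ r * Z ?b E ?w * of_nat M ^ (s ''t'' 0 - r))
        = of_nat M * of_nat M ^ (s ''t'' 0) * (?w u * Z ?b E ?w)"
      unfolding Mpow Wu' by (simp only: mult_ac)
    then show ?thesis unfolding q_def cN Zrec t
      by (simp add: Qr Qt distrib_left)
  qed
  \<comment> \<open>With denominators cleared, \<open>Z_le_prod\<close> bounds the new entry by a
    product of terms \<open>M + W v\<close>. The missing factors over \<open>X\<close> are positive,
    so \<open>prodL\<close> applies.\<close>
  have "(of_nat q :: rat) \<le> of_nat (\<Prod>v\<in>?N (Suc (key u)). M + W v)"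
    unfolding q prod_rat_weight[OF M(2), symmetric]
    by (intro mult_left_mono Z_le_prod) (use finN in auto)
  then have "q \<le> (\<Prod>v\<in>?N (Suc (key u)). M + W v)" by (simp only: of_nat_le_iff)
  also have "\<dots> \<le> (\<Prod>v\<in>X. M + W v)"
    by (intro dvd_imp_le prod_dvd_prod_subset finX) (use M(2) finX in auto)
  finally have qL: "q < 2 ^ L" using prodL by simp
  have er: "elim_round E X key M W x u = (W u * s ''Q'' r * M) div (W x * M ^ r + s ''Q'' r * M)"
    by (rule elim_round_eq[OF M(2) finX u(3) r_def Qr])
  have tup: "tuples n [''y''] rank_test s2 = r"
  proof -
    have "tuples n [''y''] rank_test s2 =
        card {l. l < n \<and> val rank_test (s2(''y'' := (s2 ''y'')(0 := l))) \<noteq> 0}"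
      by (simp only: tuples.simps sum_indicator_card)
    also have "{l. l < n \<and> val rank_test (s2(''y'' := (s2 ''y'')(0 := l))) \<noteq> 0} = ?b"
      unfolding rank_test_def s2_def below_def
      using un xn u x key graph_inD[OF s(2)] alive_inD[OF s(3)] by (auto split: if_splits)
    finally show ?thesis by (simp add: r_def)
  qed
  have "runs L update_com s (1 + ((4 * Suc n ^ length [''y''] - 2) + (1 + (1 + 1))))
    (\<lambda>s'. elim_inv E X key M W x (Suc (key u)) s')"
    unfolding update_com_def
  proof (rule runs_Assign_Seq, goal_cases)
    case 4
    show ?case
    proof (rule runs_Seq[OF runs_count_loop[where n = n]], goal_cases)
      case (11 s3)
      have c3: "s3 ''c'' 0 = r" using 11(2) tup by (simp add: s2_def)
      have fr: "s3 y = s y" if "y \<notin> {''c'', ''y''}" for y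
        using 11(2) that by (auto simp: fun_eq_iff)
      have v1: "val (Add (Mul (Reg ''M'') (At ''Q'' ''t''))
        (Mul (At ''W'' ''u'') (Mul (At ''Q'' ''c'') (Cell ''pw'' (Sub (Reg ''t'') (Reg ''c'')))))) s3 = q"
        using tn by (simp add: fr c3 q_def M u Wu pw)
      define s4 where "s4 = s3(''Q'' := (s3 ''Q'')(Suc (s ''t'' 0) := q))"
      have s4: "bounded_by L s4" unfolding s4_def by (rule bounded_upd[OF 11(1) qL])
      define e where "e = elim_round E X key M W x u"
      have v2: "val (Div (Mul (Mul (At ''W'' ''u'') (At ''Q'' ''c'')) (Reg ''M''))
        (Add (Mul (At ''W'' ''x'') (At ''pw'' ''c'')) (Mul (At ''Q'' ''c'') (Reg ''M'')))) s4 = e"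
        using rt tn by (simp add: s4_def fr c3 M u x Wu Wx pw er e_def)
      have eL: "e < 2 ^ L"
        using elim_round_le[OF M(2) finX x(1) uX, of E key W] s(1) Wu
        unfolding e_def bounded_by_def by (metis le_less_trans)
      define s5 where "s5 = s4(''W'' := (s4 ''W'')(u := e))"
      have s5: "bounded_by L s5" unfolding s5_def by (rule bounded_upd[OF s4 eL])
      have "Suc (s ''t'' 0) < 2 ^ L"
        using tn self_le_power[of "Suc n" 3] L by simp
      then have tL: "val (Add (Reg ''t'') (Num 1)) s5 < 2 ^ L" by (simp add: s5_def s4_def fr)
      have final: "elim_inv E X key M W x (Suc (key u)) (s5(''t'' := (s5 ''t'')(0 := Suc (s ''t'' 0))))"
        unfolding elim_inv_def
      proof (intro conjI allI impI ballI, goal_cases)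
        case 1
        then show ?case using cN inv by (simp add: elim_inv_def)
      next
        case (2 l)
        show ?case
        proof (cases "l = Suc (key u)")
          case True
          have "card (?N (Suc (key u))) = Suc (s ''t'' 0)" using cN inv by (simp add: elim_inv_def)
          then show ?thesis using q True by (simp add: s5_def s4_def)
        next
          case False
          then have l: "l \<le> key u" using 2 by simp
          \<comment> \<open>Earlier sets of the chain have at most \<open>t\<close> elements, so
            their entries differ from the one just written at \<open>t + 1\<close>.\<close>
          have "card (?N l) \<le> card (?N (key u))"
            using l finN by (intro card_mono) auto
          also have "\<dots> = s ''t'' 0" using inv by (simp add: elim_inv_def)
          finally have "card (?N l) \<noteq> Suc (s ''t'' 0)" by simp
          then have "s5 ''Q'' (card (?N l)) = s ''Q'' (card (?N l))" by (simp add: s5_def s4_def fr)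
          then show ?thesis using inv l by (simp add: elim_inv_def)
        qed
      next
        case (3 v)
        show ?case
        proof (cases "v = u")
          case True
          then show ?thesis using u(3) by (simp add: s5_def e_def)
        next
          case False
          then have "key v \<noteq> key u" using inj 3 uX by (auto dest: inj_onD)
          then show ?thesis using inv 3 False by (simp add: s5_def s4_def fr elim_inv_def less_Suc_eq)
        qed
      qed
      have a1: "s3(''Q'' := (s3 ''Q'')(val (Add (Reg ''t'') (Num 1)) s3 := q)) = s4"
        by (simp add: s4_def fr)
      have a2: "s4(''W'' := (s4 ''W'')(val (Reg ''u'') s4 := e)) = s5"
        using u by (simp add: s5_def s4_def fr)
      have t5: "s5 ''t'' 0 = s ''t'' 0" by (simp add: s5_def s4_def fr)
      show ?case
        by (rule runs_Assign_Seq, rule 11(1), simp, simp only: v1 qL, unfold v1 a1,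
          rule runs_Assign_Seq, rule s4, simp, simp only: v2 eL, unfold v2 a2,
          rule runs_Assign, rule s5, simp, rule tL) (use final t5 in simp)
    qed (use 4 s graph_inD[OF s(2)] nL in \<open>auto simp: rank_test_def\<close>)
  qed (use s in auto)
  then show ?thesis by (rule runs_mono) auto
qed

lemma elim_runs:
  assumes s: "bounded_by L s" "graph_in n E s" "alive_in n X s" and L: "Suc n ^ 3 < 2 ^ L"
    and key: "\<forall>u<n. s ''key'' u = degree_key n E X u"
    and x: "x \<in> X" "s ''x'' 0 = x" "nested_at E X (degree_key n E X) x"
    and loopless: "\<And>v. v \<in> X \<Longrightarrow> {v} \<notin> E"
    and M: "s ''M'' 0 = M" "0 < M" and pw: "\<forall>i\<le>n. s ''pw'' i = M ^ i"
    and prodL: "(\<Prod>v\<in>X. M + W v) < 2 ^ L"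
    and init: "s ''t'' 0 = 0" "s ''Q'' 0 = 1" "\<forall>v\<in>X. s ''W'' v = W v"
  shows "runs L elim_com s (2 + n * Suc n * (4 * n + 10))
    (\<lambda>s'. \<forall>v\<in>X. s' ''W'' v = elim_round E X (degree_key n E X) M W x v)"
proof -
  define key where "key = degree_key n E X"
  let ?inv = "elim_inv E X key M W x"
  have X: "X \<subseteq> {..<n}" using s(3) by (simp add: alive_in_def)
  have finX: "finite X" using X finite_subset by blast
  have inj: "inj_on key X" unfolding key_def by (rule inj_on_degree_key[OF X])
  have k_mod: "key u mod n = u" if "u \<in> X" for u
    using that X by (auto simp: key_def degree_key_def)
  have k_less: "key u < n * Suc n" if "u \<in> X" for u
  proof -
    have "card (nbrs E X u) \<le> card {..<n}" using X by (intro card_mono) auto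
    then have "card (nbrs E X u) * n \<le> n * n" by simp
    moreover have "u < n" using that X by auto
    ultimately show ?thesis unfolding key_def degree_key_def mult_Suc_right by linarith
  qed
  have nn: "n * Suc n < Suc n ^ 3" by (simp add: power3_eq_cube algebra_simps)
  then have nnL: "n * Suc n < 2 ^ L" using L by simp
  have start: "?inv 0 (s(''k'' := (s ''k'')(0 := 0)))"
    using init by (simp add: elim_inv_def)
  have body: "runs L (Seq (set_reg ''u'' (Sub (Reg ''k'') (Mul (Div (Reg ''k'') (Reg ''n'')) (Reg ''n''))))
      (If is_next update_com Skip)) s1 (1 + Suc (4 * n + 6))
    (\<lambda>s'. s' ''k'' 0 = j \<and> agree elim_vars s (s'(''k'' := (s' ''k'')(0 := Suc j))) \<and>
      ?inv (Suc j) (s'(''k'' := (s' ''k'')(0 := Suc j))))"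
    if j: "j < n * Suc n" "bounded_by L s1" "agree elim_vars s s1" "?inv j s1" "s1 ''k'' 0 = j" for j s1
  proof -
    define u where "u = j mod n"
    have un: "u < n" using j(1) by (cases "n = 0") (auto simp: u_def)
    define s2 where "s2 = s1(''u'' := (s1 ''u'')(0 := u))"
    have ag2: "agree elim_vars s s2" using j(3) by (simp add: s2_def elim_vars_def)
    have g: "graph_in n E s2" using graph_in_agree[OF s(2) ag2] by (simp add: elim_vars_def)
    have al: "alive_in n X s2" using alive_in_agree[OF s(3) ag2] by (simp add: elim_vars_def)
    have eq: "s2 y = s y" if "y \<notin> elim_vars" for y using agreeD[OF ag2 that] .
    have key2: "\<forall>u<n. s2 ''key'' u = key u"
      using eq[of "''key''"] assms(5) by (simp add: elim_vars_def key_def)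
    have x2: "s2 ''x'' 0 = x" "s2 ''M'' 0 = M" "\<forall>i\<le>n. s2 ''pw'' i = M ^ i"
      using eq[of "''x''"] eq[of "''M''"] eq[of "''pw''"] x M pw by (simp_all add: elim_vars_def)
    have inv2: "?inv j s2" using j(4) by (simp add: s2_def elim_inv_def)
    have k2: "s2 ''k'' 0 = j" "s2 ''u'' 0 = u" using j by (simp_all add: s2_def)
    have n1: "s1 ''n'' 0 = n" using graph_inD(1)[OF g] by (simp add: s2_def)
    have val_u: "val (Sub (Reg ''k'') (Mul (Div (Reg ''k'') (Reg ''n'')) (Reg ''n''))) s1 = u"
      using j n1 by (simp add: u_def minus_div_mult_eq_mod)
    have "n \<le> n * Suc n" by simp
    then have uL: "u < 2 ^ L" using un nnL by linarith
    have b2: "bounded_by L s2" unfolding s2_def by (rule bounded_upd[OF j(2) uL])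
    have test: "val is_next s2 \<noteq> 0 \<longleftrightarrow> u \<in> nbrs E X x \<and> key u = j"
    proof -
      have "(key u - j) + (j - key u) = 0 \<longleftrightarrow> key u = j" by auto
      then show ?thesis
        unfolding is_next_def using un key2 x2 k2 graph_inD[OF g] alive_inD[OF al] x(1)
        by (auto split: if_splits)
    qed
    let ?Q = "\<lambda>s'. s' ''k'' 0 = j \<and> agree elim_vars s (s'(''k'' := (s' ''k'')(0 := Suc j))) \<and>
      ?inv (Suc j) (s'(''k'' := (s' ''k'')(0 := Suc j)))"
    have "runs L (If is_next update_com Skip) s2 (Suc (4 * n + 6)) ?Q"
    proof (rule runs_If[OF b2])
      assume "val is_next s2 \<noteq> 0"
      then have u: "u \<in> nbrs E X x" "key u = j" using test by auto
      have "runs L update_com s2 (4 * n + 6) (\<lambda>s'. ?inv (Suc (key u)) s')"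
        by (rule update_runs[OF b2 g al L key2 inj x(1) x2(1) x(3)[folded key_def] loopless x2(2) M(2) x2(3) prodL k2(2)])
          (use u inv2 k2 in auto)
      from runs_frame[OF this]
      show "runs L update_com s2 (4 * n + 6) ?Q"
      proof (rule runs_mono)
        fix s' assume "?inv (Suc (key u)) s' \<and> agree (mods update_com) s2 s'"
        then have *: "?inv (Suc j) s'" "agree (mods update_com) s2 s'" using u by auto
        have m: "mods update_com = {''c'', ''y'', ''Q'', ''W'', ''t''}" by (auto simp: update_com_def)
        have "s' ''k'' 0 = j" using agreeD[OF *(2), of "''k''"] k2 m by simp
        moreover have "agree elim_vars s s'"
          by (rule agree_trans[OF ag2 *(2)]) (auto simp: m elim_vars_def)
        ultimately show "?Q s'" using *(1) by (simp add: elim_inv_def elim_vars_def)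
      qed simp
    next
      assume "val is_next s2 = 0"
      then have *: "\<not> (u \<in> nbrs E X x \<and> key u = j)" using test by auto
      \<comment> \<open>A neighbour with key \<open>j\<close> would be the vertex
        \<open>j mod n\<close>, which the test has rejected; so the chain does not grow at this
        key.\<close>
      have no: "key v \<noteq> j" if "v \<in> nbrs E X x" for v
        using * k_mod[of v] that by (auto simp: u_def)
      then have **: "key v < Suc j \<longleftrightarrow> key v < j" if "v \<in> nbrs E X x" for v
        using that by (auto simp: less_Suc_eq)
      then have N: "nbrs_before E X key x (Suc j) = nbrs_before E X key x j" by auto
      have "?inv (Suc j) s2"
        unfolding elim_inv_def
      proof (intro conjI allI impI ballI, goal_cases)
        case 1
        then show ?case using inv2 N by (simp add: elim_inv_def)
      next
        case (2 l)
        then show ?case using inv2 N by (cases "l = Suc j") (simp_all add: elim_inv_def)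
      next
        case (3 v)
        then show ?case using inv2 ** by (auto simp: elim_inv_def)
      qed
      then have "?Q s2" using k2 ag2 by (simp add: elim_inv_def elim_vars_def)
      then have "runs L Skip s2 1 ?Q" by (rule runs_Skip[OF b2])
      then show "runs L Skip s2 (4 * n + 6) ?Q" by (rule runs_mono) auto
    qed (simp add: is_next_def)
    then show ?thesis
      by (intro runs_Assign_Seq) (use j val_u uL in \<open>simp_all add: s2_def\<close>)
  qed
  have "runs L elim_com s (2 + n * Suc n * ((1 + Suc (4 * n + 6)) + 2))
    (\<lambda>s'. \<forall>v\<in>X. s' ''W'' v = elim_round E X key M W x v)"
    unfolding elim_com_def
  proof (rule runs_For[where I = "\<lambda>j s'. agree elim_vars s s' \<and> ?inv j s'"], goal_cases)
    case 4
    then show ?case using start by (simp add: elim_vars_def)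
  next
    case (5 j s')
    then have "agree elim_vars s s'" by simp
    then have "s' ''n'' = s ''n''" by (rule agreeD) (simp add: elim_vars_def)
    then show ?case using graph_inD(1)[OF s(2)] by simp
  next
    case (6 s')
    \<comment> \<open>Weights of non-neighbours are multiples of \<open>1 / M\<close> already, so
      rounding leaves them alone.\<close>
    have "elim_round E X key M W x v = W v" if "v \<in> X" "v \<notin> nbrs E X x" for v
    proof -
      have "elim_weight E X key (rat_weight M W) x v = rat_weight M W v"
        using that(2) by (simp only: elim_weight_def if_False)
      then show ?thesis using M(2) by (simp add: elim_round_def rat_weight_def)
    qed
    then show ?case using 6(2) k_less by (auto simp: elim_inv_def)
  next
    case (7 j s')
    then show ?case by (intro body) auto
  qed (use s nnL in auto)
  then show ?thesis unfolding key_def by (rule runs_mono) (auto simp: algebra_simps)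
qed

section \<open>The elimination loop and its rounding error\<close>

text \<open>\<open>a\<close> is the product of the factors \<open>1 + w x\<close> split off so far,
  with its denominator \<open>M ^ m\<close> kept implicit in memory. \<open>Suc m\<close> counts the
  rounding of the input and one rounding per elimination. The last clause is the potential.\<close>

definition approx_inv :: "nat \<Rightarrow> nat set set \<Rightarrow> (nat \<Rightarrow> rat) \<Rightarrow> nat \<Rightarrow> nat \<Rightarrow> nat set \<Rightarrow>
    (nat \<Rightarrow> nat) \<Rightarrow> nat \<Rightarrow> bool" where
  "approx_inv n E w M m X W A \<longleftrightarrow> card X + m = n \<and> 0 < A \<and>
    (let a = of_nat A / of_nat M ^ m; z = Z X E (rat_weight M W); B = (\<Prod>v<n. 1 + w v) in
      a * z \<le> Z {..<n} E w \<and>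
      Z {..<n} E w \<le> a * z + of_nat (Suc m) * (of_nat n / of_nat M) * B \<and>
      a * (\<Prod>v\<in>X. 1 + rat_weight M W v) \<le> B)"

lemma elim_round_approx:
  assumes "0 < M" "finite X" "x \<in> X" "u \<in> X"
  shows "rat_weight M (elim_round E X key M W x) u \<le> elim_weight E X key (rat_weight M W) x u"
    "elim_weight E X key (rat_weight M W) x u
      \<le> rat_weight M (elim_round E X key M W x) u + 1 / of_nat M"
proof -
  let ?e = "elim_weight E X key (rat_weight M W) x u"
  have e: "0 \<le> ?e" by (rule elim_weight_bounds) (use assms in auto)
  have M: "(0 :: rat) < of_nat M" using assms(1) by simp
  have fl: "of_nat (elim_round E X key M W x u) = (of_int \<lfloor>of_nat M * ?e\<rfloor> :: rat)"
    using e by (simp add: elim_round_def)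
  have "of_nat (elim_round E X key M W x u) \<le> of_nat M * ?e" unfolding fl by (rule of_int_floor_le)
  then show "rat_weight M (elim_round E X key M W x) u \<le> ?e"
    using M by (simp add: rat_weight_def divide_le_eq mult.commute)
  have "of_nat M * ?e \<le> of_nat (elim_round E X key M W x u) + 1"
    unfolding fl by linarith
  then show "?e \<le> rat_weight M (elim_round E X key M W x) u + 1 / of_nat M"
    using M by (simp add: rat_weight_def le_divide_eq mult.commute flip: add_divide_distrib)
qed

text \<open>\<open>Z_perturb\<close> bounds the error by \<open>n / M\<close> times the product over
  the remaining weights, and that product times the factors split off is within the potential. So an
  elimination adds at most \<open>n / M * B\<close>, however many came before it.\<close>

lemma approx_step:
  assumes inv: "approx_inv n E w M m X W A"
    and X: "X \<subseteq> {..<n}" and x: "x \<in> X" "nested_at E X key x" and inj: "inj_on key X"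
    and loopless: "\<And>v. v \<in> X \<Longrightarrow> {v} \<notin> E" and M: "0 < M"
    and W': "\<And>v. v \<in> X \<Longrightarrow> W' v = elim_round E X key M W x v"
  shows "approx_inv n E w M (Suc m) (X - {x}) W' (A * (M + W x))"
proof -
  have finX: "finite X" using X finite_subset by blast
  define a where "a = (of_nat A / of_nat M ^ m :: rat)"
  define B where "B = (\<Prod>v<n. 1 + w v)"
  define e where "e = elim_weight E X key (rat_weight M W) x"
  let ?w = "rat_weight M W" and ?w' = "rat_weight M W'" and ?Y = "X - {x}"
  have M': "(0 :: rat) < of_nat M" using M by simp
  have i: "card X + m = n" "0 < A" "a * Z X E ?w \<le> Z {..<n} E w"
    "Z {..<n} E w \<le> a * Z X E ?w + of_nat (Suc m) * (of_nat n / of_nat M) * B"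
    "a * (\<Prod>v\<in>X. 1 + ?w v) \<le> B"
    using inv by (simp_all add: approx_inv_def Let_def a_def B_def)
  have a0: "0 \<le> a" by (simp add: a_def)
  have a': "of_nat (A * (M + W x)) / of_nat M ^ Suc m = a * (1 + ?w x)"
    using M' by (simp add: a_def rat_weight_def field_simps)
  have w': "0 \<le> ?w' v" "?w' v \<le> e v" "e v \<le> ?w' v + 1 / of_nat M" "0 \<le> e v" "e v \<le> ?w v"
    if "v \<in> X" for v
  proof -
    have "?w' v = rat_weight M (elim_round E X key M W x) v" using W'[OF that] by (simp add: rat_weight_def)
    then show "?w' v \<le> e v" "e v \<le> ?w' v + 1 / of_nat M"
      using elim_round_approx[OF M finX x(1) that] by (simp_all add: e_def)
    show "0 \<le> e v" "e v \<le> ?w v"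
      unfolding e_def by (rule elim_weight_bounds; use finX x that in simp)+
  qed simp
  have Zx: "Z X E ?w = (1 + ?w x) * Z ?Y E e"
    unfolding e_def by (rule Z_eliminate[OF finX x(1) loopless inj _ x(2)]) auto
  have low: "Z ?Y E ?w' \<le> Z ?Y E e"
    by (rule Z_mono_weights) (use finX w' in auto)
  have "Z ?Y E e \<le> Z ?Y E ?w' + of_nat (card ?Y) * (1 / of_nat M) * (\<Prod>v\<in>?Y. 1 + e v)"
    by (rule Z_perturb) (use finX w' loopless in auto)
  also have "\<dots> \<le> Z ?Y E ?w' + of_nat n * (1 / of_nat M) * (\<Prod>v\<in>?Y. 1 + e v)"
  proof -
    have "card ?Y \<le> n" using i(1) card_Diff1_le[of X x] by linarith
    moreover have "0 \<le> (\<Prod>v\<in>?Y. 1 + e v)" by (intro prod_nonneg) (use w' in force)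
    ultimately show ?thesis using M' by (intro add_left_mono mult_right_mono) auto
  qed
  finally have high: "Z ?Y E e \<le> Z ?Y E ?w' + of_nat n / of_nat M * (\<Prod>v\<in>?Y. 1 + e v)" by simp
  \<comment> \<open>The error term of \<open>Z_perturb\<close> involves the weights before rounding,
    so the potential is bounded for these first.\<close>
  have P: "a * (1 + ?w x) * (\<Prod>v\<in>?Y. 1 + e v) \<le> B"
  proof -
    have "(\<Prod>v\<in>?Y. 1 + e v) \<le> (\<Prod>v\<in>?Y. 1 + ?w v)"
      by (intro prod_mono) (use w' in force)
    then have "a * (1 + ?w x) * (\<Prod>v\<in>?Y. 1 + e v) \<le> a * (1 + ?w x) * (\<Prod>v\<in>?Y. 1 + ?w v)"
      using a0 by (intro mult_left_mono) (auto simp: add_nonneg_nonneg)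
    also have "\<dots> = a * (\<Prod>v\<in>X. 1 + ?w v)" 
      using prod.remove[OF finX x(1), of "\<lambda>v. 1 + ?w v"] by (simp only: mult.assoc)
    finally show ?thesis using i(5) by simp
  qed
  have P': "a * (1 + ?w x) * (\<Prod>v\<in>?Y. 1 + ?w' v) \<le> B"
  proof -
    have "(\<Prod>v\<in>?Y. 1 + ?w' v) \<le> (\<Prod>v\<in>?Y. 1 + e v)"
      by (intro prod_mono) (use w' in force)
    then have "a * (1 + ?w x) * (\<Prod>v\<in>?Y. 1 + ?w' v) \<le> a * (1 + ?w x) * (\<Prod>v\<in>?Y. 1 + e v)"
      using a0 by (intro mult_left_mono) (auto simp: add_nonneg_nonneg)
    then show ?thesis using P by simp
  qed
  have c0: "0 \<le> a * (1 + ?w x)" using a0 by (simp add: add_nonneg_nonneg)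
  have "a * (1 + ?w x) * Z ?Y E ?w' \<le> a * (1 + ?w x) * Z ?Y E e"
    using low c0 by (rule mult_left_mono)
  then have L: "a * (1 + ?w x) * Z ?Y E ?w' \<le> Z {..<n} E w"
    using i(3) unfolding Zx by (simp only: mult.assoc)
  have "a * (1 + ?w x) * Z ?Y E e
      \<le> a * (1 + ?w x) * (Z ?Y E ?w' + of_nat n / of_nat M * (\<Prod>v\<in>?Y. 1 + e v))"
    using high c0 by (rule mult_left_mono)
  also have "\<dots> = a * (1 + ?w x) * Z ?Y E ?w'
      + of_nat n / of_nat M * (a * (1 + ?w x) * (\<Prod>v\<in>?Y. 1 + e v))"
    by (simp only: distrib_left mult_ac)
  also have "\<dots> \<le> a * (1 + ?w x) * Z ?Y E ?w' + of_nat n / of_nat M * B"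
    using P by (intro add_left_mono mult_left_mono) auto
  finally have "Z {..<n} E w \<le> a * (1 + ?w x) * Z ?Y E ?w' + of_nat n / of_nat M * B
      + of_nat (Suc m) * (of_nat n / of_nat M) * B"
    using i(4) unfolding Zx by (simp only: mult.assoc)
  also have "\<dots> = a * (1 + ?w x) * Z ?Y E ?w' + of_nat (Suc (Suc m)) * (of_nat n / of_nat M) * B"
    by (simp add: algebra_simps add_divide_distrib)
  finally have H: "Z {..<n} E w
      \<le> a * (1 + ?w x) * Z ?Y E ?w' + of_nat (Suc (Suc m)) * (of_nat n / of_nat M) * B" .
  have "card ?Y + Suc m = n" using i(1) card_Suc_Diff1[OF finX x(1)] by simp
  then show ?thesis
    unfolding approx_inv_def Let_def a' B_def[symmetric] using L H P' i(2) M by simp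
qed

text \<open>The input weights need not be multiples of \<open>1 / M\<close>; their rounding is why
  the error count starts at one.\<close>

lemma approx_start:
  assumes "0 < M" "\<And>v. v < n \<Longrightarrow> {v} \<notin> E" "\<And>v. v < n \<Longrightarrow> 0 \<le> w v"
    and W: "\<And>v. v < n \<Longrightarrow> W v = nat \<lfloor>of_nat M * w v\<rfloor>"
  shows "approx_inv n E w M 0 {..<n} W 1"
proof -
  let ?w = "rat_weight M W"
  have M: "(0 :: rat) < of_nat M" using assms(1) by simp
  have w: "?w v \<le> w v" "w v \<le> ?w v + 1 / of_nat M" if "v < n" for v
  proof -
    have fl: "of_nat (W v) = (of_int \<lfloor>of_nat M * w v\<rfloor> :: rat)"
      using W[OF that] assms(3)[OF that] by simp
    have "of_nat (W v) \<le> of_nat M * w v" unfolding fl by (rule of_int_floor_le)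
    then show "?w v \<le> w v" using M by (simp add: rat_weight_def divide_le_eq mult.commute)
    have "of_nat M * w v \<le> of_nat (W v) + 1" unfolding fl by linarith
    then show "w v \<le> ?w v + 1 / of_nat M"
      using M by (simp add: rat_weight_def le_divide_eq mult.commute flip: add_divide_distrib)
  qed
  have "Z {..<n} E ?w \<le> Z {..<n} E w" by (rule Z_mono_weights) (use w in auto)
  moreover have "Z {..<n} E w \<le> Z {..<n} E ?w + of_nat (card {..<n}) * (1 / of_nat M) * (\<Prod>v<n. 1 + w v)"
    by (rule Z_perturb) (use assms(2) w in auto)
  moreover have "(\<Prod>v<n. 1 + ?w v) \<le> (\<Prod>v<n. 1 + w v)"
    by (intro prod_mono) (use w in \<open>auto simp: add_nonneg_nonneg\<close>)
  ultimately show ?thesis by (simp add: approx_inv_def Let_def)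
qed

text \<open>Multiplied by \<open>M ^ n\<close>, where \<open>n = m + card X\<close>, the potential
  becomes the integer on the left. This limits \<open>A\<close> throughout the loop and, as
  \<open>A\<close> is positive, also the product that bounds the table \<open>Q\<close>.\<close>

lemma approx_inv_bound:
  assumes inv: "approx_inv n E w M m X W A" and "0 < M"
    and L: "of_nat M ^ n * (\<Prod>v<n. 1 + w v) < 2 ^ L"
  shows "A * (\<Prod>v\<in>X. M + W v) < 2 ^ L"
proof -
  have M: "(0 :: rat) < of_nat M" using assms(2) by simp
  have n: "n = m + card X" and P: "of_nat A / of_nat M ^ m * (\<Prod>v\<in>X. 1 + rat_weight M W v) \<le> (\<Prod>v<n. 1 + w v)"
    using inv by (simp_all add: approx_inv_def Let_def)
  have "(of_nat (A * (\<Prod>v\<in>X. M + W v)) :: rat)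
      = of_nat A * (of_nat M ^ card X * (\<Prod>v\<in>X. 1 + rat_weight M W v))"
    unfolding prod_rat_weight[OF assms(2)] by simp
  also have "\<dots> = of_nat M ^ n * (of_nat A / of_nat M ^ m * (\<Prod>v\<in>X. 1 + rat_weight M W v))"
    using M by (simp add: n power_add)
  also have "\<dots> \<le> of_nat M ^ n * (\<Prod>v<n. 1 + w v)" using P M by (intro mult_left_mono) auto
  also have "\<dots> < of_nat (2 ^ L)" using L by simp
  finally show ?thesis by (simp only: of_nat_less_iff)
qed

section \<open>The elimination loop\<close>

definition main_com :: com where
  "main_com = For ''m'' (Reg ''n'') (Seq keys_com (Seq find_com
    (Seq (Assign ''Q'' (Num 0) (Num 1)) (Seq (set_reg ''t'' (Num 0)) (Seq elim_com
    (Seq (set_reg ''A'' (Mul (Reg ''A'') (Add (Reg ''M'') (At ''W'' ''x''))))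
      (Assign ''alive'' (Reg ''x'') (Num 0))))))))"

definition main_vars :: "string set" where
  "main_vars = {''m'', ''k'', ''u'', ''c'', ''y'', ''Q'', ''W'', ''t'', ''A'', ''alive'', ''x'',
    ''v'', ''i'', ''j'', ''key''}"

lemma mods_coms: "mods keys_com = {''v'', ''c'', ''y'', ''key''}"
  "mods find_com = {''v'', ''c'', ''i'', ''j'', ''y'', ''x''}"
  "mods elim_com = {''k'', ''u'', ''c'', ''y'', ''Q'', ''W'', ''t''}"
  by (auto simp: keys_com_def find_com_def elim_com_def update_com_def)

lemma main_runs:
  assumes so: "strongly_orderable {..<n} E"
    and s: "bounded_by L s" "graph_in n E s" and L: "Suc n ^ 3 < 2 ^ L"
    and M: "s ''M'' 0 = M" "0 < M" and pw: "\<forall>i\<le>n. s ''pw'' i = M ^ i"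
    and prodL: "of_nat M ^ n * (\<Prod>v<n. 1 + w v) < (2 :: rat) ^ L"
    and init: "alive_in n {..<n} s" "approx_inv n E w M 0 {..<n} (s ''W'') (s ''A'' 0)"
  shows "runs L main_com s (2 + n * (33 * Suc n ^ 4 + 2))
    (\<lambda>s'. approx_inv n E w M n {} (s' ''W'') (s' ''A'' 0))"
proof -
  obtain vs where G: "simple_graph {..<n} E" and vs: "strong_ordering {..<n} E vs"
    using so by (auto simp: strongly_orderable_def)
  have loopless: "{v} \<notin> E" for v using G by (auto simp: simple_graph_def doubleton_eq_iff)
  have nL: "n < 2 ^ L" using self_le_power[of "Suc n" 3] L by simp
  let ?I = "\<lambda>m s'. agree main_vars s s' \<and>
    (\<exists>X. alive_in n X s' \<and> approx_inv n E w M m X (s' ''W'') (s' ''A'' 0))"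
  let ?post = "\<lambda>m s'. s' ''m'' 0 = m \<and> ?I (Suc m) (s'(''m'' := (s' ''m'')(0 := Suc m)))"
  have body: "runs L (Seq keys_com (Seq find_com
      (Seq (Assign ''Q'' (Num 0) (Num 1)) (Seq (set_reg ''t'' (Num 0)) (Seq elim_com
      (Seq (set_reg ''A'' (Mul (Reg ''A'') (Add (Reg ''M'') (At ''W'' ''x''))))
        (Assign ''alive'' (Reg ''x'') (Num 0)))))))) s1
     ((2 + n * (4 * n + 6)) + ((2 + n * (4 * Suc n ^ 3 + 3)) + (1 + (1 +
       ((2 + n * Suc n * (4 * n + 10)) + (1 + 1)))))) (?post m)"
    if m: "m < n" "bounded_by L s1" "?I m s1" "s1 ''m'' 0 = m" for m s1
  proof -
    obtain X where al: "alive_in n X s1" and inv: "approx_inv n E w M m X (s1 ''W'') (s1 ''A'' 0)"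
      and ag: "agree main_vars s s1" using m(3) by blast
    have X: "X \<subseteq> {..<n}" using al by (simp add: alive_in_def)
    have finX: "finite X" using X finite_subset by blast
    have "X \<noteq> {}" using inv m(1) by (auto simp: approx_inv_def)
    define key where "key = degree_key n E X"
    have inj: "inj_on key X" unfolding key_def by (rule inj_on_degree_key[OF X])
    have ex: "\<exists>v\<in>X. nested_at E X key v"
      unfolding key_def by (rule exists_nested[OF vs G X \<open>X \<noteq> {}\<close>])
    have g: "graph_in n E s1" using graph_in_agree[OF s(2) ag] by (simp add: main_vars_def)
    have M1: "s1 ''M'' 0 = M" "\<forall>i\<le>n. s1 ''pw'' i = M ^ i"
      using agreeD[OF ag, of "''M''"] agreeD[OF ag, of "''pw''"] M pw by (simp_all add: main_vars_def)
    have bound: "s1 ''A'' 0 * (\<Prod>v\<in>X. M + s1 ''W'' v) < 2 ^ L"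
      by (rule approx_inv_bound[OF inv M(2) prodL])
    have A0: "0 < s1 ''A'' 0" using inv by (simp add: approx_inv_def)
    then have "(\<Prod>v\<in>X. M + s1 ''W'' v) \<le> s1 ''A'' 0 * (\<Prod>v\<in>X. M + s1 ''W'' v)" by simp
    then have prodX: "(\<Prod>v\<in>X. M + s1 ''W'' v) < 2 ^ L" using bound by linarith
    have "runs L keys_com s1 (2 + n * (4 * n + 6)) (\<lambda>s'. (\<forall>u<n. s' ''key'' u = key u) \<and>
        agree (mods keys_com) s1 s')"
      unfolding key_def by (rule runs_frame[OF keys_runs[OF m(2) g al L]])
    then show ?thesis
    proof (rule runs_Seq)
      fix s2 assume b2: "bounded_by L s2" and s2: "(\<forall>u<n. s2 ''key'' u = key u) \<and> agree (mods keys_com) s1 s2"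
      have ag2: "agree (mods keys_com) s1 s2" using s2 by simp
      have g2: "graph_in n E s2" and al2: "alive_in n X s2"
        using graph_in_agree[OF g ag2] alive_in_agree[OF al ag2] by (simp_all add: mods_coms)
      have "runs L find_com s2 (2 + n * (4 * Suc n ^ 3 + 3))
        (\<lambda>s'. (s' ''x'' 0 \<in> X \<and> nested_at E X key (s' ''x'' 0)) \<and> agree (mods find_com) s2 s')"
        by (rule runs_frame[OF find_runs[OF b2 g2 al2 L _ ex]]) (use s2 in simp)
      then show "runs L (Seq find_com
        (Seq (Assign ''Q'' (Num 0) (Num 1)) (Seq (set_reg ''t'' (Num 0)) (Seq elim_com
        (Seq (set_reg ''A'' (Mul (Reg ''A'') (Add (Reg ''M'') (At ''W'' ''x''))))
        (Assign ''alive'' (Reg ''x'') (Num 0))))))) s2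
        ((2 + n * (4 * Suc n ^ 3 + 3)) + (1 + (1 +
         ((2 + n * Suc n * (4 * n + 10)) + (1 + 1))))) (?post m)"
      proof (rule runs_Seq)
        fix s3 assume b3: "bounded_by L s3" and s3: "(s3 ''x'' 0 \<in> X \<and> nested_at E X key (s3 ''x'' 0)) \<and>
          agree (mods find_com) s2 s3"
        define x where "x = s3 ''x'' 0"
        have x: "x \<in> X" "nested_at E X key x" using s3 by (simp_all add: x_def)
        have ag3: "agree (mods find_com) s2 s3" using s3 by simp
        define s4 where "s4 = s3(''Q'' := (s3 ''Q'')(0 := 1))"
        define s5 where "s5 = s4(''t'' := (s4 ''t'')(0 := 0))"
        have one: "(1 :: nat) < 2 ^ L" using b3 one_less_power[of "2 :: nat" L] by (simp add: bounded_by_def)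
        have b4: "bounded_by L s4" unfolding s4_def by (rule bounded_upd[OF b3 one])
        have b5: "bounded_by L s5" unfolding s5_def by (rule bounded_upd[OF b4]) simp
        have eq3: "s3 y = s1 y" if "y \<notin> mods find_com \<union> mods keys_com" for y
          using agreeD[OF ag3] agreeD[OF ag2] that by simp
        define S5 where "S5 = mods find_com \<union> mods keys_com \<union> {''Q'', ''t''}"
        have ag5: "agree S5 s1 s5"
          using eq3 by (simp add: agree_def s5_def s4_def S5_def)
        have S5: "S5 \<subseteq> main_vars" by (auto simp: S5_def mods_coms main_vars_def)
        have g5: "graph_in n E s5" and al5: "alive_in n X s5"
          using graph_in_agree[OF g ag5] alive_in_agree[OF al ag5] by (simp_all add: mods_coms S5_def)
        have key5: "\<forall>u<n. s5 ''key'' u = key u"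
          using s2 agreeD[OF ag3, of "''key''"] by (simp add: s5_def s4_def mods_coms)
        have e5: "s5 ''M'' 0 = M" "\<forall>i\<le>n. s5 ''pw'' i = M ^ i" "s5 ''W'' = s1 ''W''" "s5 ''A'' = s1 ''A''"
            "s5 ''m'' 0 = m" "s5 ''x'' 0 = x" "s5 ''t'' 0 = 0" "s5 ''Q'' 0 = 1"
          using M1 eq3 m(4) by (simp_all add: s5_def s4_def mods_coms x_def)
        have "runs L elim_com s5 (2 + n * Suc n * (4 * n + 10))
          (\<lambda>s'. (\<forall>v\<in>X. s' ''W'' v = elim_round E X (degree_key n E X) M (s1 ''W'') x v)
            \<and> agree (mods elim_com) s5 s')"
          by (rule runs_frame, rule elim_runs[OF b5 g5 al5 L])
            (use key5 e5 x loopless M(2) prodX in \<open>simp_all add: key_def\<close>)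
        then have "runs L (Seq elim_com
          (Seq (set_reg ''A'' (Mul (Reg ''A'') (Add (Reg ''M'') (At ''W'' ''x''))))
          (Assign ''alive'' (Reg ''x'') (Num 0)))) s5
          ((2 + n * Suc n * (4 * n + 10)) + (1 + 1)) (?post m)"
        proof (rule runs_Seq)
          fix s6 assume b6: "bounded_by L s6"
            and s6: "(\<forall>v\<in>X. s6 ''W'' v = elim_round E X (degree_key n E X) M (s1 ''W'') x v)
              \<and> agree (mods elim_com) s5 s6"
          have ag6: "agree (mods elim_com) s5 s6" using s6 by simp
          have W6: "\<And>v. v \<in> X \<Longrightarrow> s6 ''W'' v = elim_round E X key M (s1 ''W'') x v"
            using s6 by (simp add: key_def)
          have eq6: "s6 ''x'' 0 = x" "s6 ''M'' 0 = M" "s6 ''A'' 0 = s1 ''A'' 0" "s6 ''m'' 0 = m"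
            using agreeD[OF ag6] e5 by (simp_all add: mods_coms)
          \<comment> \<open>\<open>x\<close> is not its own neighbour, so its weight is still the
            old one when it enters \<open>A\<close>.\<close>
          have Wx: "s6 ''W'' x = s1 ''W'' x"
          proof -
            have "x \<notin> nbrs E X x" using loopless[of x] by simp
            then have "elim_weight E X key (rat_weight M (s1 ''W'')) x x = rat_weight M (s1 ''W'') x"
              by (simp only: elim_weight_def if_False)
            then show ?thesis using W6[OF x(1)] M(2) by (simp add: elim_round_def rat_weight_def)
          qed
          let ?A = "s1 ''A'' 0 * (M + s1 ''W'' x)"
          have "M + s1 ''W'' x \<le> (\<Prod>v\<in>X. M + s1 ''W'' v)"
            by (intro dvd_imp_le dvd_prodI finX x) (use M(2) finX in auto)
          then have "?A \<le> s1 ''A'' 0 * (\<Prod>v\<in>X. M + s1 ''W'' v)" by (rule mult_le_mono2)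
          then have AL: "?A < 2 ^ L" using bound by linarith
          have "approx_inv n E w M (Suc m) (X - {x}) (s6 ''W'') ?A"
            by (rule approx_step[OF inv X x inj loopless M(2) W6])
          moreover have al6: "alive_in n X s6"
            using alive_in_agree[OF al5 ag6] by (simp add: mods_coms)
          then have "alive_in n (X - {x}) (s6(''A'' := (s6 ''A'')(0 := ?A), ''alive'' := (s6 ''alive'')(x := 0),
              ''m'' := (s6 ''m'')(0 := Suc m)))"
            by (auto simp: alive_in_def)
          moreover have "agree main_vars s s6"
          proof (rule agree_trans[OF ag])
            show "agree (S5 \<union> mods elim_com) s1 s6"
              using ag5 ag6 by (simp add: agree_def)
            show "S5 \<union> mods elim_com \<subseteq> main_vars"
              using S5 by (auto simp: mods_coms main_vars_def)
          qed
          ultimately have fin: "?post m (s6(''A'' := (s6 ''A'')(0 := ?A), ''alive'' := (s6 ''alive'')(x := 0)))"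
            using eq6 by (auto simp: main_vars_def)
          show "runs L (Seq (set_reg ''A'' (Mul (Reg ''A'') (Add (Reg ''M'') (At ''W'' ''x''))))
            (Assign ''alive'' (Reg ''x'') (Num 0))) s6 (1 + 1) (?post m)"
            by (rule runs_Assign_Seq[OF b6], simp, simp add: eq6 Wx AL, rule runs_Assign)
              (use fin eq6 Wx in simp_all)
        qed
        then show "runs L (Seq (Assign ''Q'' (Num 0) (Num 1)) (Seq (set_reg ''t'' (Num 0)) (Seq elim_com
          (Seq (set_reg ''A'' (Mul (Reg ''A'') (Add (Reg ''M'') (At ''W'' ''x''))))
          (Assign ''alive'' (Reg ''x'') (Num 0)))))) s3
          (1 + (1 + ((2 + n * Suc n * (4 * n + 10)) + (1 + 1)))) (?post m)"
          by (intro runs_Assign_Seq b3) (use one b4 in \<open>simp_all add: s5_def s4_def\<close>)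
      qed
    qed
  qed
  let ?N = "Suc n"
  have "runs L main_com s (2 + n * (((2 + n * (4 * n + 6)) + ((2 + n * (4 * Suc n ^ 3 + 3)) + (1 + (1 +
       ((2 + n * Suc n * (4 * n + 10)) + (1 + 1)))))) + 2))
    (\<lambda>s'. approx_inv n E w M n {} (s' ''W'') (s' ''A'' 0))"
    unfolding main_com_def
  proof (rule runs_For[where I = ?I], goal_cases)
    case 4
    have "alive_in n {..<n} (s(''m'' := (s ''m'')(0 := 0)))" using init(1) by (simp add: alive_in_def)
    then show ?case using init(2) by (auto simp: main_vars_def)
  next
    case (5 j s')
    then have "agree main_vars s s'" by simp
    then have "s' ''n'' = s ''n''" by (rule agreeD) (simp add: main_vars_def)
    then show ?case using graph_inD(1)[OF s(2)] by simp
  next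
    case (6 s')
    then obtain X where X: "alive_in n X s'" "approx_inv n E w M n X (s' ''W'') (s' ''A'' 0)" by blast
    have "finite X" using X(1) finite_subset by (auto simp: alive_in_def)
    then have "X = {}" using X(2) by (simp add: approx_inv_def)
    then show ?case using X(2) by simp
  next
    case (7 j s')
    then show ?case by (intro body) auto
  qed (use s nL in auto)
  then show ?thesis
  proof (rule runs_mono)
    \<comment> \<open>The constant 33 is 6 + 7 + 10 for the loops of the three phases, plus 10 for
      the steps outside them, all measured against \<open>Suc n ^ 4\<close>.\<close>
    have p: "?N ^ a \<le> ?N ^ 4" if "a \<le> 4" for a by (rule power_increasing) (use that in auto)
    have "n * (4 * n + 6) \<le> ?N * (6 * ?N)" by (intro mult_le_mono) auto
    also have "\<dots> = 6 * ?N ^ 2" by (simp only: power2_eq_square mult_ac)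
    also have "\<dots> \<le> 6 * ?N ^ 4" using p[of 2] by simp
    finally have 1: "n * (4 * n + 6) \<le> 6 * ?N ^ 4" .
    have "n * (4 * ?N ^ 3 + 3) \<le> ?N * (4 * ?N ^ 3 + 3)" by (intro mult_le_mono) auto
    also have "\<dots> = 4 * ?N ^ 4 + 3 * ?N" by (simp add: eval_nat_numeral algebra_simps)
    finally have 2: "n * (4 * ?N ^ 3 + 3) \<le> 7 * ?N ^ 4" using p[of 1] by simp
    have "n * ?N * (4 * n + 10) \<le> ?N * ?N * (10 * ?N)" by (intro mult_le_mono) auto
    also have "\<dots> = 10 * ?N ^ 3" by (simp only: power3_eq_cube mult_ac)
    finally have 3: "n * ?N * (4 * n + 10) \<le> 10 * ?N ^ 4" using p[of 3] by simp
    have 4: "1 \<le> ?N ^ 4" by simp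
    show "2 + n * (((2 + n * (4 * n + 6)) + ((2 + n * (4 * Suc n ^ 3 + 3)) + (1 + (1 +
       ((2 + n * Suc n * (4 * n + 10)) + (1 + 1)))))) + 2) \<le> 2 + n * (33 * Suc n ^ 4 + 2)"
      by (intro add_left_mono mult_left_mono) (use 1 2 3 4 in linarith, simp)
  qed auto
qed

section \<open>Initialization and output\<close>

text \<open>The \<open>1 + n * n\<close> entries of the graph come first; after them numerators and
  denominators alternate.\<close>

abbreviation numE :: exp where
  "numE \<equiv> Cell ''input'' (Add (Num 1) (Add (Mul (Reg ''n'') (Reg ''n'')) (Mul (Num 2) (Reg ''i''))))"

abbreviation denE :: exp where
  "denE \<equiv> Cell ''input'' (Add (Num 2) (Add (Mul (Reg ''n'') (Reg ''n'')) (Mul (Num 2) (Reg ''i''))))"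

text \<open>\<open>P\<close> is \<open>D\<close> times the product of all \<open>1 + w v\<close>,
  hence an upper bound for the integer \<open>D * Z\<close>.\<close>

definition products_com :: com where
  "products_com = For ''i'' (Reg ''n'')
    (Seq (set_reg ''D'' (Mul (Reg ''D'') denE)) (set_reg ''P'' (Mul (Reg ''P'') (Add numE denE))))"

definition weights_com :: com where
  "weights_com = For ''i'' (Reg ''n'')
    (Seq (Assign ''W'' (Reg ''i'') (Div (Mul numE (Reg ''M'')) denE))
    (Seq (Assign ''alive'' (Reg ''i'') (Num 1))
      (Assign ''pw'' (Add (Reg ''i'') (Num 1)) (Mul (At ''pw'' ''i'') (Reg ''M'')))))"

definition weights_at :: "nat \<Rightarrow> (nat \<Rightarrow> nat) \<Rightarrow> (nat \<Rightarrow> nat) \<Rightarrow> state \<Rightarrow> bool" where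
  "weights_at n nu de s \<longleftrightarrow>
    (\<forall>v<n. s ''input'' (Suc (n * n + 2 * v)) = nu v \<and> s ''input'' (Suc (Suc (n * n + 2 * v))) = de v)"

lemma products_runs:
  assumes s: "bounded_by L s" "s ''n'' 0 = n" "weights_at n nu de s" and init: "s ''D'' 0 = 1" "s ''P'' 0 = 1"
    and pos: "\<And>v. v < n \<Longrightarrow> 0 < nu v" "\<And>v. v < n \<Longrightarrow> 0 < de v"
    and L: "n < 2 ^ L" "(\<Prod>v<n. nu v + de v) < 2 ^ L"
  shows "runs L products_com s (2 + n * 4)
    (\<lambda>s'. s' ''D'' 0 = (\<Prod>v<n. de v) \<and> s' ''P'' 0 = (\<Prod>v<n. nu v + de v))"
proof -
  let ?S = "{''i'', ''D'', ''P''}"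
  let ?I = "\<lambda>j s'. agree ?S s s' \<and> s' ''D'' 0 = (\<Prod>v<j. de v) \<and> s' ''P'' 0 = (\<Prod>v<j. nu v + de v)"
  have "runs L products_com s (2 + n * ((1 + 1) + 2))
    (\<lambda>s'. s' ''D'' 0 = (\<Prod>v<n. de v) \<and> s' ''P'' 0 = (\<Prod>v<n. nu v + de v))"
    unfolding products_com_def
  proof (rule runs_For[where I = ?I], goal_cases)
    case (5 j s')
    then have "agree ?S s s'" by simp
    then have "s' ''n'' = s ''n''" by (rule agreeD) simp
    then show ?case using s(2) by simp
  next
    case (7 j s')
    then have ag: "agree ?S s s'" by simp
    have e: "s' ''n'' 0 = n" "s' ''input'' (Suc (n * n + 2 * j)) = nu j"
      "s' ''input'' (Suc (Suc (n * n + 2 * j))) = de j"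
      using s 7 agreeD[OF ag, of "''n''"] agreeD[OF ag, of "''input''"] by (simp_all add: weights_at_def)
    \<comment> \<open>A partial product divides the full one, which is positive.\<close>
    have "(\<Prod>v<Suc j. nu v + de v) \<le> (\<Prod>v<n. nu v + de v)"
      by (intro dvd_imp_le prod_dvd_prod_subset) (use 7(1) pos in auto)
    then have P: "(\<Prod>v<j. nu v + de v) * (nu j + de j) < 2 ^ L" using L(2) by simp
    have "(\<Prod>v<j. de v) * de j \<le> (\<Prod>v<j. nu v + de v) * (nu j + de j)"
      by (intro mult_le_mono prod_mono) auto
    then have D: "(\<Prod>v<j. de v) * de j < 2 ^ L" using P by linarith
    show ?case
      by (rule runs_Assign_Seq[OF 7(2)], simp, use 7 e D in simp, rule runs_Assign)
        (use 7 e P D in simp_all)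
  qed (use s init L in auto)
  then show ?thesis by (rule runs_mono) auto
qed

lemma weights_runs:
  assumes s: "bounded_by L s" "s ''n'' 0 = n" "weights_at n nu de s" and init: "s ''pw'' 0 = 1" "s ''M'' 0 = M" "0 < M"
    and L: "Suc n < 2 ^ L" "M ^ n < 2 ^ L" "\<And>v. v < n \<Longrightarrow> nu v * M < 2 ^ L"
  shows "runs L weights_com s (2 + n * 5) (\<lambda>s'. (\<forall>v<n. s' ''W'' v = nu v * M div de v) \<and>
    (\<forall>v<n. s' ''alive'' v = 1) \<and> (\<forall>l\<le>n. s' ''pw'' l = M ^ l))"
proof -
  let ?S = "{''i'', ''W'', ''alive'', ''pw''}"
  let ?I = "\<lambda>j s'. agree ?S s s' \<and> (\<forall>v<j. s' ''W'' v = nu v * M div de v) \<and>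
    (\<forall>v<j. s' ''alive'' v = 1) \<and> (\<forall>l\<le>j. s' ''pw'' l = M ^ l)"
  have one: "(1 :: nat) < 2 ^ L" using s(1) one_less_power[of "2 :: nat" L] by (simp add: bounded_by_def)
  have "runs L weights_com s (2 + n * ((1 + (1 + 1)) + 2)) (\<lambda>s'. (\<forall>v<n. s' ''W'' v = nu v * M div de v) \<and>
    (\<forall>v<n. s' ''alive'' v = 1) \<and> (\<forall>l\<le>n. s' ''pw'' l = M ^ l))"
    unfolding weights_com_def
  proof (rule runs_For[where I = ?I], goal_cases)
    case (5 j s')
    then have "agree ?S s s'" by simp
    then have "s' ''n'' = s ''n''" by (rule agreeD) simp
    then show ?case using s(2) by simp
  next
    case (7 j s')
    then have ag: "agree ?S s s'" by simp
    have e: "s' ''n'' 0 = n" "s' ''M'' 0 = M" "s' ''input'' (Suc (n * n + 2 * j)) = nu j"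
      "s' ''input'' (Suc (Suc (n * n + 2 * j))) = de j"
      using s init 7 agreeD[OF ag, of "''n''"] agreeD[OF ag, of "''M''"] agreeD[OF ag, of "''input''"]
      by (simp_all add: weights_at_def)
    have W: "nu j * M div de j < 2 ^ L" using L(3)[OF 7(1)] div_le_dividend le_less_trans by blast
    have "M ^ Suc j \<le> M ^ n" using 7(1) init(3) by (intro power_increasing) auto
    then have pw: "M ^ j * M < 2 ^ L" using L(2) by (simp add: mult.commute)
    show ?case
      by (rule runs_Assign_Seq[OF 7(2)], simp, use 7 e W in simp, rule runs_Assign_Seq, assumption, simp,
          use one in simp, rule runs_Assign)
        (use 7 e W pw one in \<open>auto simp: less_Suc_eq le_Suc_eq mult.commute\<close>)
  qed (use s init L in auto)
  then show ?thesis by (rule runs_mono) auto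
qed

text \<open>At the end \<open>D\<close> times the error is at most
  \<open>(n + 1) * n * P / M\<close>; this \<open>M\<close> makes it less than 1.\<close>

definition init_com :: com where
  "init_com = Seq (set_reg ''n'' (Cell ''input'' (Num 0)))
    (Seq (set_reg ''D'' (Num 1)) (Seq (set_reg ''P'' (Num 1)) (Seq (set_reg ''A'' (Num 1))
    (Seq (Assign ''pw'' (Num 0) (Num 1)) (Seq products_com
    (Seq (set_reg ''M'' (Mul (Reg ''P'') (Mul (Add (Reg ''n'') (Num 1)) (Add (Reg ''n'') (Num 1)))))
      weights_com))))))"

lemma init_runs:
  assumes s: "bounded_by L s" "s ''input'' 0 = n" "weights_at n nu de s"
    and pos: "\<And>v. v < n \<Longrightarrow> 0 < nu v" "\<And>v. v < n \<Longrightarrow> 0 < de v"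
    and M: "M = (\<Prod>v<n. nu v + de v) * (Suc n * Suc n)"
    and L: "Suc n < 2 ^ L" "M < 2 ^ L" "M ^ n < 2 ^ L" "\<And>v. v < n \<Longrightarrow> nu v * M < 2 ^ L"
  shows "runs L init_com s (10 + n * 9) (\<lambda>s'. agree {''n'', ''D'', ''P'', ''A'', ''pw'', ''i'', ''M'', ''W'', ''alive''} s s' \<and>
    s' ''n'' 0 = n \<and> s' ''D'' 0 = (\<Prod>v<n. de v) \<and> s' ''A'' 0 = 1 \<and> s' ''M'' 0 = M \<and>
    (\<forall>v<n. s' ''W'' v = nu v * M div de v) \<and>
    (\<forall>v<n. s' ''alive'' v = 1) \<and> (\<forall>l\<le>n. s' ''pw'' l = M ^ l))"
proof -
  let ?D = "\<Prod>v<n. de v" and ?P = "\<Prod>v<n. nu v + de v"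
  let ?S = "{''n'', ''D'', ''P'', ''A'', ''pw'', ''i'', ''M'', ''W'', ''alive''}"
  have one: "(1 :: nat) < 2 ^ L" using s(1) one_less_power[of "2 :: nat" L] by (simp add: bounded_by_def)
  have nL: "n < 2 ^ L" using L(1) by simp
  have "?P \<le> M" unfolding M by simp
  then have PL: "?P < 2 ^ L" using L(2) by linarith
  have "0 < ?P" by (intro prod_pos) (use pos in auto)
  then have M0: "0 < M" unfolding M by simp
  define s1 where "s1 = s(''n'' := (s ''n'')(0 := n), ''D'' := (s ''D'')(0 := 1), ''P'' := (s ''P'')(0 := 1),
    ''A'' := (s ''A'')(0 := 1), ''pw'' := (s ''pw'')(0 := 1))"
  have b1: "bounded_by L s1" using s(1) one nL by (auto simp: s1_def bounded_by_def)
  have w1: "weights_at n nu de s1" using s(3) by (simp add: weights_at_def s1_def)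
  have ag1: "agree ?S s s1" by (simp add: s1_def)
  have "runs L products_com s1 (2 + n * 4)
    (\<lambda>s'. (s' ''D'' 0 = ?D \<and> s' ''P'' 0 = ?P) \<and> agree (mods products_com) s1 s')"
    by (rule runs_frame, rule products_runs[OF b1 _ w1 _ _ pos nL PL]) (simp_all add: s1_def)
  then have "runs L (Seq products_com
      (Seq (set_reg ''M'' (Mul (Reg ''P'') (Mul (Add (Reg ''n'') (Num 1)) (Add (Reg ''n'') (Num 1)))))
      weights_com)) s1 ((2 + n * 4) + (1 + (2 + n * 5)))
    (\<lambda>s'. agree ?S s s' \<and> s' ''n'' 0 = n \<and> s' ''D'' 0 = ?D \<and> s' ''A'' 0 = 1 \<and> s' ''M'' 0 = M \<and>
    (\<forall>v<n. s' ''W'' v = nu v * M div de v) \<and>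
    (\<forall>v<n. s' ''alive'' v = 1) \<and> (\<forall>l\<le>n. s' ''pw'' l = M ^ l))"
  proof (rule runs_Seq)
    fix s2 assume b2: "bounded_by L s2" and s2: "(s2 ''D'' 0 = ?D \<and> s2 ''P'' 0 = ?P) \<and> agree (mods products_com) s1 s2"
    have m: "mods products_com = {''i'', ''D'', ''P''}" by (auto simp: products_com_def)
    have ag2: "agree {''i'', ''D'', ''P''} s1 s2" using s2 m by simp
    have e2: "s2 y = s1 y" if "y \<notin> {''i'', ''D'', ''P''}" for y using agreeD[OF ag2 that] .
    define s3 where "s3 = s2(''M'' := (s2 ''M'')(0 := M))"
    have b3: "bounded_by L s3" unfolding s3_def by (rule bounded_upd[OF b2 L(2)])
    have n2: "s2 ''n'' 0 = n" by (simp add: e2 s1_def)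
    have ag3: "agree ?S s s3" using ag1 ag2 by (simp add: agree_def s3_def)
    have "runs L weights_com s3 (2 + n * 5) (\<lambda>s'. ((\<forall>v<n. s' ''W'' v = nu v * M div de v) \<and>
      (\<forall>v<n. s' ''alive'' v = 1) \<and> (\<forall>l\<le>n. s' ''pw'' l = M ^ l)) \<and> agree (mods weights_com) s3 s')"
    proof (rule runs_frame, rule weights_runs[OF b3 _ _ _ _ M0 L(1,3)])
      show "weights_at n nu de s3" using w1 by (simp add: weights_at_def s3_def e2)
    qed (use L(4) in \<open>simp_all add: s3_def e2 s1_def\<close>)
    then have w: "runs L weights_com s3 (2 + n * 5) (\<lambda>s'. agree ?S s s' \<and> s' ''n'' 0 = n \<and> s' ''D'' 0 = ?D \<and>
        s' ''A'' 0 = 1 \<and> s' ''M'' 0 = M \<and> (\<forall>v<n. s' ''W'' v = nu v * M div de v) \<and>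
        (\<forall>v<n. s' ''alive'' v = 1) \<and> (\<forall>l\<le>n. s' ''pw'' l = M ^ l))"
    proof (rule runs_mono)
      fix s4 assume s4: "((\<forall>v<n. s4 ''W'' v = nu v * M div de v) \<and>
        (\<forall>v<n. s4 ''alive'' v = 1) \<and> (\<forall>l\<le>n. s4 ''pw'' l = M ^ l)) \<and> agree (mods weights_com) s3 s4"
      have "mods weights_com = {''i'', ''W'', ''alive'', ''pw''}" by (auto simp: weights_com_def)
      then have ag4: "agree {''i'', ''W'', ''alive'', ''pw''} s3 s4" using s4 by simp
      have "agree ?S s s4" by (rule agree_trans[OF ag3 ag4]) auto
      moreover have "s4 ''n'' 0 = n" "s4 ''D'' 0 = ?D" "s4 ''A'' 0 = 1" "s4 ''M'' 0 = M"
        using agreeD[OF ag4] s2 by (simp_all add: s3_def e2 s1_def)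
      ultimately show "agree ?S s s4 \<and> s4 ''n'' 0 = n \<and> s4 ''D'' 0 = ?D \<and>
        s4 ''A'' 0 = 1 \<and> s4 ''M'' 0 = M \<and> (\<forall>v<n. s4 ''W'' v = nu v * M div de v) \<and>
        (\<forall>v<n. s4 ''alive'' v = 1) \<and> (\<forall>l\<le>n. s4 ''pw'' l = M ^ l)" using s4 by simp
    qed simp
    have v: "val (Mul (Reg ''P'') (Mul (Add (Reg ''n'') (Num 1)) (Add (Reg ''n'') (Num 1)))) s2 = M"
      using s2 n2 by (simp add: M)
    show "runs L (Seq (set_reg ''M'' (Mul (Reg ''P'') (Mul (Add (Reg ''n'') (Num 1)) (Add (Reg ''n'') (Num 1)))))
      weights_com) s2 (1 + (2 + n * 5)) (\<lambda>s'. agree ?S s s' \<and> s' ''n'' 0 = n \<and> s' ''D'' 0 = ?D \<and>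
        s' ''A'' 0 = 1 \<and> s' ''M'' 0 = M \<and> (\<forall>v<n. s' ''W'' v = nu v * M div de v) \<and>
        (\<forall>v<n. s' ''alive'' v = 1) \<and> (\<forall>l\<le>n. s' ''pw'' l = M ^ l))"
      by (rule runs_Assign_Seq[OF b2], simp, simp only: v L(2), unfold v, use w in \<open>simp add: s3_def\<close>)
  qed
  note seq = this
  have "runs L init_com s (1 + (1 + (1 + (1 + (1 + ((2 + n * 4) + (1 + (2 + n * 5))))))))
    (\<lambda>s'. agree ?S s s' \<and> s' ''n'' 0 = n \<and> s' ''D'' 0 = ?D \<and> s' ''A'' 0 = 1 \<and> s' ''M'' 0 = M \<and>
    (\<forall>v<n. s' ''W'' v = nu v * M div de v) \<and>
    (\<forall>v<n. s' ''alive'' v = 1) \<and> (\<forall>l\<le>n. s' ''pw'' l = M ^ l))"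
    unfolding init_com_def
    by (rule runs_Assign_Seq[OF s(1)], simp, use nL s in simp,
        rule runs_Assign_Seq, assumption, simp, use one in simp,
        rule runs_Assign_Seq, assumption, simp, use one in simp,
        rule runs_Assign_Seq, assumption, simp, use one in simp,
        rule runs_Assign_Seq, assumption, simp, use one in simp)
      (use seq s in \<open>simp add: s1_def\<close>)
  then show ?thesis by (rule runs_mono) auto
qed

section \<open>Euclid's algorithm and the output\<close>

definition gcd_com :: com where
  "gcd_com = While (Reg ''b'')
    (Seq (set_reg ''c'' (Sub (Reg ''a'') (Mul (Div (Reg ''a'') (Reg ''b'')) (Reg ''b''))))
    (Seq (set_reg ''a'' (Reg ''b'')) (set_reg ''b'' (Reg ''c''))))"

lemma floorlog_less_half:
  assumes "2 * x < y"
  shows "floorlog 2 x < floorlog 2 y"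
proof (cases "x = 0")
  case True
  then show ?thesis using assms by (simp add: floorlog_def)
next
  case False
  then have "floorlog 2 (x * 2) = Suc (floorlog 2 x)" using compute_floorlog[of 2 "x * 2"] by simp
  moreover have "floorlog 2 (x * 2) \<le> floorlog 2 y" using assms by (intro floorlog_mono) simp
  ultimately show ?thesis by simp
qed

text \<open>For \<open>b \<le> a\<close> the remainder \<open>a mod b\<close> is less than half of
  \<open>a\<close>, so each pass shortens the product of the two registers by a binary digit;
  initially it has at most \<open>2 * L\<close> digits. The order \<open>b \<le> a\<close> is
  assumed so that the first pass shortens the product too.\<close>

lemma gcd_runs:
  assumes s: "bounded_by L s" "s ''b'' 0 \<le> s ''a'' 0"
  shows "runs L gcd_com s (1 + 2 * L * 4) (\<lambda>s'. s' ''a'' 0 = gcd (s ''a'' 0) (s ''b'' 0))"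
proof -
  let ?P = "\<lambda>s'. s' ''b'' 0 \<le> s' ''a'' 0 \<and> gcd (s' ''a'' 0) (s' ''b'' 0) = gcd (s ''a'' 0) (s ''b'' 0)"
  let ?mu = "\<lambda>s'. floorlog 2 (s' ''a'' 0 * s' ''b'' 0)"
  have "runs L gcd_com s (1 + ?mu s * Suc (1 + (1 + 1))) (\<lambda>s'. s' ''a'' 0 = gcd (s ''a'' 0) (s ''b'' 0))"
    unfolding gcd_com_def
  proof (rule runs_While[where P = ?P and \<mu> = ?mu], goal_cases)
    case (5 s')
    let ?a = "s' ''a'' 0" and ?b = "s' ''b'' 0"
    have b0: "0 < ?b" using 5 by simp
    have aL: "?a < 2 ^ L" "?b < 2 ^ L" using 5(1) by (auto simp: bounded_by_def)
    have mL: "?a mod ?b < 2 ^ L" using aL(1) mod_less_eq_dividend le_less_trans by blast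
    have "?a = ?a div ?b * ?b + ?a mod ?b" by simp
    moreover have "1 \<le> ?a div ?b" using 5 b0 by (simp add: Suc_le_eq div_greater_zero_iff)
    then have "1 * ?b \<le> ?a div ?b * ?b" by (rule mult_le_mono1)
    moreover have "?a mod ?b < ?b" using b0 by simp
    ultimately have "2 * (?a mod ?b) < ?a" by linarith
    then have "2 * (?b * (?a mod ?b)) < ?a * ?b" using b0 by (simp add: mult.commute mult.left_commute)
    then have mu: "floorlog 2 (?b * (?a mod ?b)) < floorlog 2 (?a * ?b)" by (rule floorlog_less_half)
    have g: "gcd ?b (?a mod ?b) = gcd ?a ?b" by (simp add: gcd_red_nat[symmetric])
    have v: "val (Sub (Reg ''a'') (Mul (Div (Reg ''a'') (Reg ''b'')) (Reg ''b''))) s' = ?a mod ?b"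
      by (simp add: minus_div_mult_eq_mod)
    have final: "?P (s'(''c'' := (s' ''c'')(0 := ?a mod ?b), ''a'' := (s' ''a'')(0 := ?b), ''b'' := (s' ''b'')(0 := ?a mod ?b))) \<and>
       ?mu (s'(''c'' := (s' ''c'')(0 := ?a mod ?b), ''a'' := (s' ''a'')(0 := ?b), ''b'' := (s' ''b'')(0 := ?a mod ?b))) < ?mu s'"
      using 5 b0 mu g by simp
    show ?case
      by (rule runs_Assign_Seq[OF 5(1)], simp, simp only: v mL, unfold v,
          rule runs_Assign_Seq, assumption, simp, use aL in simp, rule runs_Assign)
        (use final aL mL in simp_all)
  qed (use s in auto)
  then show ?thesis
  proof (rule runs_mono)
    have "s ''a'' 0 * s ''b'' 0 < 2 ^ L * 2 ^ L" using s(1) by (intro mult_strict_mono) (auto simp: bounded_by_def)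
    then have "s ''a'' 0 * s ''b'' 0 < 2 ^ (2 * L)" by (simp add: mult_2 power_add)
    from bit_size_le[OF this] have "?mu s \<le> 2 * L" by (simp add: bit_size_def)
    then show "1 + ?mu s * Suc (1 + (1 + 1)) \<le> 1 + 2 * L * 4"
      by (intro add_left_mono mult_le_mono) auto
  qed auto
qed

text \<open>The first division rounds up: \<open>A / M ^ n\<close> is below \<open>Z\<close> by less
  than \<open>1 / D\<close>, so the integer \<open>D * Z\<close> is the ceiling of
  \<open>D * A / M ^ n\<close>.\<close>

definition output_com :: com where
  "output_com = Seq (set_reg ''a'' (Div (Add (Mul (Reg ''D'') (Reg ''A'')) (Sub (At ''pw'' ''n'') (Num 1))) (At ''pw'' ''n'')))
    (Seq (set_reg ''N'' (Reg ''a'')) (Seq (set_reg ''b'' (Reg ''D'')) (Seq gcd_com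
    (Seq (Assign ''output'' (Num 0) (Div (Reg ''N'') (Reg ''a'')))
      (Assign ''output'' (Num 1) (Div (Reg ''D'') (Reg ''a'')))))))"

text \<open>\<open>K\<close> stands for \<open>D * Z\<close>. The premise \<open>D \<le> K\<close>,
  which amounts to \<open>Z \<ge> 1\<close>, supplies the order of the registers required by
  \<open>gcd_runs\<close>.\<close>

lemma output_runs:
  assumes s: "bounded_by L s" "s ''n'' 0 = n" "s ''pw'' n = q" "s ''D'' 0 = D" "s ''A'' 0 = A" "0 < q"
    and K: "D * A \<le> K * q" "K * q < D * A + q" "K < 2 ^ L" "D \<le> K"
  shows "runs L output_com s (8 + 8 * L) (\<lambda>s'. s' ''output'' 0 = K div gcd K D \<and> s' ''output'' 1 = D div gcd K D)"
proof -
  have Keq: "(D * A + (q - 1)) div q = K"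
    by (rule div_nat_eqI) (use K s(6) in \<open>simp_all add: mult.commute\<close>)
  have v: "val (Div (Add (Mul (Reg ''D'') (Reg ''A'')) (Sub (At ''pw'' ''n'') (Num 1))) (At ''pw'' ''n'')) s = K"
    using s Keq by simp
  have DL: "D < 2 ^ L" using s by (auto simp: bounded_by_def)
  define s1 where "s1 = s(''a'' := (s ''a'')(0 := K), ''N'' := (s ''N'')(0 := K), ''b'' := (s ''b'')(0 := D))"
  have b1: "bounded_by L s1" using s(1) K(3) DL by (simp add: s1_def bounded_by_def)
  have "runs L gcd_com s1 (1 + 2 * L * 4) (\<lambda>s'. s' ''a'' 0 = gcd (s1 ''a'' 0) (s1 ''b'' 0) \<and> agree (mods gcd_com) s1 s')"
    by (rule runs_frame, rule gcd_runs[OF b1]) (use K(4) in \<open>simp add: s1_def\<close>)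
  then have g: "runs L (Seq gcd_com (Seq (Assign ''output'' (Num 0) (Div (Reg ''N'') (Reg ''a'')))
      (Assign ''output'' (Num 1) (Div (Reg ''D'') (Reg ''a''))))) s1 ((1 + 2 * L * 4) + (1 + 1))
    (\<lambda>s'. s' ''output'' 0 = K div gcd K D \<and> s' ''output'' 1 = D div gcd K D)"
  proof (rule runs_Seq)
    fix s2 assume b2: "bounded_by L s2" and s2: "s2 ''a'' 0 = gcd (s1 ''a'' 0) (s1 ''b'' 0) \<and> agree (mods gcd_com) s1 s2"
    have m: "mods gcd_com = {''a'', ''b'', ''c''}" by (auto simp: gcd_com_def)
    have ag: "agree {''a'', ''b'', ''c''} s1 s2" using s2 m by simp
    have e: "s2 ''a'' 0 = gcd K D" "s2 ''N'' 0 = K" "s2 ''D'' 0 = D"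
      using s2 agreeD[OF ag] s by (simp_all add: s1_def)
    have KL: "K div gcd K D < 2 ^ L" "D div gcd K D < 2 ^ L"
      using K(3) DL by (meson div_le_dividend le_less_trans)+
    show "runs L (Seq (Assign ''output'' (Num 0) (Div (Reg ''N'') (Reg ''a'')))
      (Assign ''output'' (Num 1) (Div (Reg ''D'') (Reg ''a'')))) s2 (1 + 1)
      (\<lambda>s'. s' ''output'' 0 = K div gcd K D \<and> s' ''output'' 1 = D div gcd K D)"
      by (rule runs_Assign_Seq[OF b2], simp, use e KL in simp, rule runs_Assign) (use e KL in simp_all)
  qed
  have "runs L output_com s (1 + (1 + (1 + ((1 + 2 * L * 4) + (1 + 1)))))
    (\<lambda>s'. s' ''output'' 0 = K div gcd K D \<and> s' ''output'' 1 = D div gcd K D)"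
    unfolding output_com_def
    by (rule runs_Assign_Seq[OF s(1)], simp, simp only: v K(3), unfold v,
        rule runs_Assign_Seq, assumption, simp, use K in simp,
        rule runs_Assign_Seq, assumption, simp, use s DL in simp)
      (use g s in \<open>simp add: s1_def\<close>)
  then show ?thesis by (rule runs_mono) auto
qed

section \<open>The complete program\<close>

lemma length_concat_block:
  "(\<And>u. u < n \<Longrightarrow> length (f u) = k) \<Longrightarrow> length (concat (map f [0..<n])) = n * k"
  by (induction n) auto

lemma nth_concat_block:
  assumes "\<And>u. u < n \<Longrightarrow> length (f u) = k" "u < n" "v < k"
  shows "concat (map f [0..<n]) ! (u * k + v) = f u ! v"
  using assms
proof (induction n)
  case (Suc n)
  have len: "length (concat (map f [0..<n])) = n * k"
    by (rule length_concat_block) (use Suc.prems in auto)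
  show ?case
  proof (cases "u < n")
    case True
    have "u * k + v < Suc u * k" using Suc.prems by simp
    also have "\<dots> \<le> n * k" using True by (intro mult_le_mono1) simp
    finally show ?thesis using Suc True len by (simp add: nth_append)
  next
    case False
    then have "u = n" using Suc.prems by simp
    then show ?thesis using Suc.prems len by (simp add: nth_append)
  qed
qed simp

lemma encode_instance_nth:
  fixes n E w
  defines "xs \<equiv> encode_instance n E w"
  shows "xs ! 0 = n"
    and "u < n \<Longrightarrow> v < n \<Longrightarrow> xs ! Suc (u * n + v) = (if {u, v} \<in> E then 1 else 0)"
    and "v < n \<Longrightarrow> xs ! Suc (n * n + 2 * v) = nat (fst (quotient_of (w v)))"
    and "v < n \<Longrightarrow> xs ! Suc (Suc (n * n + 2 * v)) = nat (snd (quotient_of (w v)))"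
    and "length xs = Suc (n * n + 2 * n)"
proof -
  let ?f = "\<lambda>u. map (\<lambda>v. if {u, v} \<in> E then 1 else 0 :: nat) [0..<n]"
  let ?g = "\<lambda>v. encode_rat (w v)"
  have xs: "xs = n # concat (map ?f [0..<n]) @ concat (map ?g [0..<n])"
    by (simp add: xs_def encode_instance_def encode_graph_def)
  have lf: "length (concat (map ?f [0..<n])) = n * n" by (rule length_concat_block) simp
  have lg: "length (concat (map ?g [0..<n])) = n * 2"
    by (rule length_concat_block) (simp add: encode_rat_def)
  show "xs ! 0 = n" by (simp add: xs)
  show "length xs = Suc (n * n + 2 * n)" unfolding xs by (simp only: length_Cons length_append lf lg)
  show "xs ! Suc (u * n + v) = (if {u, v} \<in> E then 1 else 0)" if "u < n" "v < n"
  proof -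
    have "u * n + v < Suc u * n" using that by simp
    also have "\<dots> \<le> n * n" using that by (intro mult_le_mono1) simp
    finally have "u * n + v < n * n" .
    moreover have "concat (map ?f [0..<n]) ! (u * n + v) = ?f u ! v"
      by (rule nth_concat_block) (use that in auto)
    ultimately show ?thesis using that unfolding xs by (simp add: nth_append lf)
  qed
  have g: "xs ! Suc (n * n + (v * 2 + i)) = ?g v ! i" if "v < n" "i < 2" for v i
  proof -
    have "concat (map ?g [0..<n]) ! (v * 2 + i) = ?g v ! i"
      by (rule nth_concat_block) (use that in \<open>auto simp: encode_rat_def\<close>)
    then show ?thesis unfolding xs by (simp add: nth_append lf)
  qed
  show "xs ! Suc (n * n + 2 * v) = nat (fst (quotient_of (w v)))" if "v < n"
    using g[OF that, of 0] by (simp add: encode_rat_def mult.commute)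
  show "xs ! Suc (Suc (n * n + 2 * v)) = nat (snd (quotient_of (w v)))" if "v < n"
    using g[OF that, of 1] by (simp add: encode_rat_def mult.commute)
qed

lemma sum_list_concat_map:
  fixes f :: "'b \<Rightarrow> 'c :: monoid_add"
  shows "(\<Sum>x\<leftarrow>concat (map g vs). f x) = (\<Sum>v\<leftarrow>vs. \<Sum>x\<leftarrow>g v. f x)"
  by (induction vs) auto

lemma less_two_power_bit_size: "k < 2 ^ bit_size k"
proof -
  have "k < 2 ^ floorlog 2 k" using floorlog_bounds[of k 2] by (cases "k = 0") auto
  then show ?thesis by (simp add: bit_size_def)
qed

text \<open>\<open>quotient_of\<close> reduces by the gcd, so division by the result of Euclid's
  algorithm gives literally the required encoding.\<close>

lemma encode_rat_quotient:
  assumes "0 < d"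
  shows "encode_rat (of_nat k / of_nat d) = [k div gcd k d, d div gcd k d]"
proof -
  have "(of_nat k / of_nat d :: rat) = Fract (int k) (int d)"
    by (simp add: Fract_of_int_quotient)
  then have "quotient_of (of_nat k / of_nat d) = Rat.normalize (int k, int d)"
    by (simp add: quotient_of_Fract)
  then show ?thesis using assms
    by (simp add: encode_rat_def Rat.normalize_def Let_def gcd_int_int_eq zdiv_int[symmetric])
qed

section \<open>Correctness and polynomial running time\<close>

definition counting_com :: com where
  "counting_com = Seq init_com (Seq main_com output_com)"

text \<open>Multiplying the weight of \<open>S\<close> by all denominators leaves the numerators
  inside \<open>S\<close> and the denominators outside it.\<close>

lemma Z_common_denominator:
  fixes n :: nat
  assumes de: "\<And>v. v < n \<Longrightarrow> 0 < de v" and w: "\<And>v. v < n \<Longrightarrow> w v = of_nat (nu v) / of_nat (de v)"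
  shows "\<exists>k :: nat. Z {..<n} E w = of_nat k / of_nat (\<Prod>v<n. de v)"
proof -
  let ?k = "\<Sum>S\<in>independent_sets {..<n} E. (\<Prod>v\<in>S. nu v) * (\<Prod>v\<in>{..<n} - S. de v)"
  have "of_nat (\<Prod>v<n. de v) * Z {..<n} E w = of_nat ?k"
    unfolding Z_def of_nat_sum sum_distrib_left
  proof (rule sum.cong[OF refl])
    fix S assume "S \<in> independent_sets {..<n} E"
    then have S: "S \<subseteq> {..<n}" by (simp add: independent_sets_def)
    have "(of_nat (\<Prod>v<n. de v) :: rat) = of_nat (\<Prod>v\<in>{..<n} - S. de v) * of_nat (\<Prod>v\<in>S. de v)"
      using prod.subset_diff[OF S finite_lessThan, of de] by (simp only: of_nat_mult)
    moreover have "(of_nat (\<Prod>v\<in>S. de v) :: rat) * (\<Prod>v\<in>S. w v) = of_nat (\<Prod>v\<in>S. nu v)"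
      unfolding of_nat_prod prod.distrib[symmetric]
      by (rule prod.cong) (use S de w in \<open>auto simp: subset_iff\<close>)
    ultimately show "of_nat (\<Prod>v<n. de v) * (\<Prod>v\<in>S. w v)
        = of_nat ((\<Prod>v\<in>S. nu v) * (\<Prod>v\<in>{..<n} - S. de v))" by (simp add: mult.commute mult.left_commute)
  qed
  moreover have "0 < (\<Prod>v<n. de v)" by (intro prod_pos) (use de in auto)
  then have "(of_nat (\<Prod>v<n. de v) :: rat) \<noteq> 0" by (simp only: of_nat_eq_0_iff)
  ultimately have "Z {..<n} E w = of_nat ?k / of_nat (\<Prod>v<n. de v)"
    by (simp add: eq_divide_eq mult.commute)
  then show ?thesis by blast
qed

lemma counting_runs:
  assumes so: "strongly_orderable {..<n} E"
    and s: "bounded_by L s" "s ''input'' 0 = n" "weights_at n nu de s"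
      "\<forall>u<n. \<forall>v<n. s ''input'' (Suc (u * n + v)) = (if {u, v} \<in> E then 1 else 0)"
    and pos: "\<And>v. v < n \<Longrightarrow> 0 < nu v" "\<And>v. v < n \<Longrightarrow> 0 < de v"
    and w: "\<And>v. v < n \<Longrightarrow> w v = of_nat (nu v) / of_nat (de v)"
    and M: "M = (\<Prod>v<n. nu v + de v) * (Suc n * Suc n)"
    and L: "Suc n ^ 3 < 2 ^ L" "M < 2 ^ L" "M ^ n * (\<Prod>v<n. nu v + de v) < 2 ^ L"
      "\<And>v. v < n \<Longrightarrow> nu v * M < 2 ^ L"
  shows "runs L counting_com s ((10 + n * 9) + ((2 + n * (33 * Suc n ^ 4 + 2)) + (8 + 8 * L)))
    (\<lambda>s'. output_is s' (encode_rat (Z {..<n} E w)))"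
proof -
  let ?D = "\<Prod>v<n. de v" and ?P = "\<Prod>v<n. nu v + de v" and ?B = "\<Prod>v<n. 1 + w v"
  have loopless: "{v} \<notin> E" for v
    using so by (auto simp: strongly_orderable_def simple_graph_def doubleton_eq_iff)
  have P0: "0 < ?P" and D0: "0 < ?D" by (intro prod_pos; use pos in auto)+
  have M0: "0 < M" unfolding M using P0 by simp
  have w0: "0 \<le> w v" if "v < n" for v using w[OF that] by simp
  have DB: "of_nat ?D * ?B = (of_nat ?P :: rat)"
    unfolding of_nat_prod prod.distrib[symmetric]
    by (rule prod.cong) (use w pos in \<open>auto simp: field_simps\<close>)
  have B1: "1 \<le> ?B" by (intro prod_ge_1) (use w0 in auto)
  have BP: "?B \<le> of_nat ?P"
  proof -
    have "1 * ?B \<le> of_nat ?D * ?B"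
    proof (rule mult_right_mono)
      show "(1 :: rat) \<le> of_nat ?D" using D0 by (metis Suc_leI One_nat_def of_nat_1 of_nat_mono)
    qed (use B1 in simp)
    then show ?thesis using DB by simp
  qed
  have prodL: "of_nat M ^ n * ?B < (2 :: rat) ^ L"
  proof -
    have "of_nat M ^ n * ?B \<le> of_nat M ^ n * of_nat ?P" using BP by (intro mult_left_mono) auto
    also have "\<dots> = of_nat (M ^ n * ?P)" by simp
    also have "\<dots> < of_nat (2 ^ L)" using L(3) by (simp only: of_nat_less_iff)
    finally show ?thesis by simp
  qed
  obtain K where K: "Z {..<n} E w = of_nat K / of_nat ?D"
    using Z_common_denominator[of n de w nu E] pos w by blast
  have DQ: "(0 :: rat) < of_nat ?D" using D0 by (simp only: of_nat_0_less_iff)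
  have KZ: "of_nat K = of_nat ?D * Z {..<n} E w" 
    unfolding K using DQ by (metis less_irrefl nonzero_mult_div_cancel_left times_divide_eq_right)
  have Z1: "1 \<le> Z {..<n} E w" by (rule Z_ge_1) (use w0 in auto)
  have "(of_nat ?D :: rat) * 1 \<le> of_nat K" unfolding KZ using Z1 DQ by (intro mult_left_mono) auto
  then have DK: "?D \<le> K" by (simp only: mult_1_right of_nat_le_iff)
  have "Z {..<n} E w \<le> ?B" by (rule Z_le_prod) (use w0 in auto)
  then have "(of_nat K :: rat) \<le> of_nat ?P" unfolding KZ DB[symmetric] using DQ by (intro mult_left_mono) auto
  then have "K \<le> ?P" by (simp only: of_nat_le_iff)
  moreover have "1 * ?P \<le> M ^ n * ?P" using M0 by (intro mult_le_mono1) simp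
  ultimately have KL: "K < 2 ^ L" using L(3) by linarith
  have "M ^ n * 1 \<le> M ^ n * ?P"
    using P0 by (intro mult_le_mono2) (simp only: One_nat_def Suc_le_eq)
  then have MnL: "M ^ n < 2 ^ L" using L(3) by linarith
  have nL: "Suc n < 2 ^ L"
  proof (cases "n = 0")
    case True
    then show ?thesis using L(1) s(1) one_less_power[of "2 :: nat" L] by (simp add: bounded_by_def)
  next
    case False
    then show ?thesis using self_le_power[of "Suc n" 3] L(1) by linarith
  qed
  let ?S = "{''n'', ''D'', ''P'', ''A'', ''pw'', ''i'', ''M'', ''W'', ''alive''}"
  have "runs L init_com s (10 + n * 9) (\<lambda>s'. agree ?S s s' \<and>
    s' ''n'' 0 = n \<and> s' ''D'' 0 = ?D \<and> s' ''A'' 0 = 1 \<and> s' ''M'' 0 = M \<and>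
    (\<forall>v<n. s' ''W'' v = nu v * M div de v) \<and>
    (\<forall>v<n. s' ''alive'' v = 1) \<and> (\<forall>l\<le>n. s' ''pw'' l = M ^ l))"
    by (rule init_runs[OF s(1-3) pos M nL L(2) MnL L(4)])
  then show ?thesis unfolding counting_com_def
  proof (rule runs_Seq)
    fix s1 assume b1: "bounded_by L s1" and s1: "agree ?S s s1 \<and>
      s1 ''n'' 0 = n \<and> s1 ''D'' 0 = ?D \<and> s1 ''A'' 0 = 1 \<and> s1 ''M'' 0 = M \<and>
      (\<forall>v<n. s1 ''W'' v = nu v * M div de v) \<and>
      (\<forall>v<n. s1 ''alive'' v = 1) \<and> (\<forall>l\<le>n. s1 ''pw'' l = M ^ l)"
    have in1: "s1 ''input'' = s ''input''" using agreeD[of ?S s s1 "''input''"] s1 by simp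
    have g: "graph_in n E s1" using s1 s(4) in1 by (simp add: graph_in_def)
    have al: "alive_in n {..<n} s1" using s1 by (simp add: alive_in_def)
    have inv: "approx_inv n E w M 0 {..<n} (s1 ''W'') (s1 ''A'' 0)"
    proof -
      have "s1 ''W'' v = nat \<lfloor>of_nat M * w v\<rfloor>" if "v < n" for v
      proof -
        have "of_nat M * w v = of_nat (nu v * M) / of_nat (de v)" using w[OF that] by (simp add: mult.commute)
        then show ?thesis using s1 that by (simp only: floor_divide_of_nat_eq nat_int)
      qed
      then have "approx_inv n E w M 0 {..<n} (s1 ''W'') 1"
        using M0 loopless w0 by (intro approx_start) auto
      then show ?thesis using s1 by simp
    qed
    have "runs L main_com s1 (2 + n * (33 * Suc n ^ 4 + 2))
      (\<lambda>s'. approx_inv n E w M n {} (s' ''W'') (s' ''A'' 0) \<and> agree (mods main_com) s1 s')"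
      by (rule runs_frame, rule main_runs[OF so b1 g L(1) _ M0 _ prodL al inv]) (use s1 in auto)
    then show "runs L (Seq main_com output_com) s1 ((2 + n * (33 * Suc n ^ 4 + 2)) + (8 + 8 * L))
      (\<lambda>s'. output_is s' (encode_rat (Z {..<n} E w)))"
    proof (rule runs_Seq)
      fix s2 assume b2: "bounded_by L s2" and s2: "approx_inv n E w M n {} (s2 ''W'') (s2 ''A'' 0) \<and> agree (mods main_com) s1 s2"
      have m: "mods main_com = main_vars" by (auto simp: main_com_def mods_coms main_vars_def)
      have ag: "agree main_vars s1 s2" using s2 m by simp
      have e: "s2 ''n'' 0 = n" "s2 ''D'' 0 = ?D" "s2 ''pw'' n = M ^ n"
        using agreeD[OF ag] s1 by (simp_all add: main_vars_def)
      define A where "A = s2 ''A'' 0"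
      have low: "of_nat A / of_nat M ^ n \<le> Z {..<n} E w"
        and high: "Z {..<n} E w \<le> of_nat A / of_nat M ^ n + of_nat (Suc n) * (of_nat n / of_nat M) * ?B"
        using s2 by (simp_all add: approx_inv_def Let_def A_def)
      have MQ: "(0 :: rat) < of_nat M ^ n" "(0 :: rat) < of_nat M" using M0 by simp_all
      have DA: "(of_nat (?D * A) :: rat) = of_nat M ^ n * (of_nat ?D * (of_nat A / of_nat M ^ n))"
        using MQ by simp
      have "(of_nat (?D * A) :: rat) \<le> of_nat M ^ n * (of_nat ?D * Z {..<n} E w)"
        unfolding DA using low DQ MQ by (intro mult_left_mono) auto
      also have "\<dots> = of_nat (K * M ^ n)" unfolding KZ[symmetric] by simp
      finally have K1: "?D * A \<le> K * M ^ n" by (simp only: of_nat_le_iff)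
      have err: "of_nat ?D * (of_nat (Suc n) * (of_nat n / of_nat M) * ?B) < (1 :: rat)"
      proof -
        have "of_nat ?D * (of_nat (Suc n) * (of_nat n / of_nat M) * ?B)
            = of_nat (Suc n) * of_nat n / of_nat M * (of_nat ?D * ?B)" by simp
        also have "\<dots> = of_nat (Suc n * n * ?P) / of_nat M"
          unfolding DB by (simp only: of_nat_mult times_divide_eq_left)
        also have "\<dots> < 1"
        proof -
          have "Suc n * n * ?P < Suc n * Suc n * ?P" using P0 by (intro mult_strict_right_mono) auto
          then have "Suc n * n * ?P < M" unfolding M by (simp only: mult.commute)
          then have "(of_nat (Suc n * n * ?P) :: rat) < of_nat M" by (simp only: of_nat_less_iff)
          then show ?thesis using MQ by (simp add: divide_less_eq)
        qed
        finally show ?thesis .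
      qed
      \<comment> \<open>Together with \<open>K1\<close> this confines \<open>K\<close> to the
        half-open interval of length one that starts at \<open>D * A / M ^ n\<close>.\<close>
      have "(of_nat K :: rat) \<le> of_nat ?D * (of_nat A / of_nat M ^ n + of_nat (Suc n) * (of_nat n / of_nat M) * ?B)"
        unfolding KZ using high DQ by (intro mult_left_mono) auto
      also have "\<dots> < of_nat ?D * (of_nat A / of_nat M ^ n) + 1"
        using err by (simp only: distrib_left add_strict_left_mono)
      finally have "of_nat M ^ n * of_nat K < (of_nat M ^ n * (of_nat ?D * (of_nat A / of_nat M ^ n) + 1) :: rat)"
        using MQ by (intro mult_strict_left_mono) auto
      also have "\<dots> = of_nat (?D * A + M ^ n)"
        using DA by (simp only: distrib_left of_nat_add of_nat_power mult_1_right)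
      finally have "(of_nat (K * M ^ n) :: rat) < of_nat (?D * A + M ^ n)" by (simp add: mult.commute)
      then have K2: "K * M ^ n < ?D * A + M ^ n" by (simp only: of_nat_less_iff)
      have "runs L output_com s2 (8 + 8 * L)
        (\<lambda>s'. s' ''output'' 0 = K div gcd K ?D \<and> s' ''output'' 1 = ?D div gcd K ?D)"
        by (rule output_runs[OF b2 e(1,3,2) A_def[symmetric] _ K1 K2 KL DK]) (use M0 in simp)
      then show "runs L output_com s2 (8 + 8 * L) (\<lambda>s'. output_is s' (encode_rat (Z {..<n} E w)))"
      proof (rule runs_mono)
        fix s' :: state assume "s' ''output'' 0 = K div gcd K ?D \<and> s' ''output'' 1 = ?D div gcd K ?D"
        then show "output_is s' (encode_rat (Z {..<n} E w))"
          unfolding K encode_rat_quotient[OF D0] output_is_def by (auto simp: less_Suc_eq)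
      qed simp
    qed
  qed
qed

theorem theorem1:
  shows "\<exists>(c :: com) (p :: nat poly). \<forall>(n :: nat) (E :: nat set set) (w :: nat \<Rightarrow> rat).
    strongly_orderable {..<n} E \<longrightarrow> (\<forall>v<n. w v > 0) \<longrightarrow>
      computes_within c (encode_instance n E w) (encode_rat (Z {..<n} E w))
        (poly p (input_size (encode_instance n E w)))"
proof (intro exI allI impI)
  fix n :: nat and E :: "nat set set" and w :: "nat \<Rightarrow> rat"
  assume so: "strongly_orderable {..<n} E" and wpos: "\<forall>v<n. w v > 0"
  define xs where "xs = encode_instance n E w"
  define N where "N = input_size xs"
  \<comment> \<open>The largest number is \<open>M ^ n\<close> times the product of all
    \<open>nu v + de v\<close>. As \<open>M \<le> 2 ^ (2 * N)\<close> and \<open>n < N\<close>, its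
    exponent is at most \<open>2 * N * n + N \<le> 2 * N * N\<close>. The factor 4 makes this strict
    and also covers the exponent \<open>3 * N\<close> used for \<open>Suc n ^ 3\<close> and
    \<open>nu v * M\<close>.\<close>
  define L where "L = 4 * N * N"
  define nu where "nu v = nat (fst (quotient_of (w v)))" for v
  define de where "de v = nat (snd (quotient_of (w v)))" for v
  define M where "M = (\<Prod>v<n. nu v + de v) * (Suc n * Suc n)"
  have nth: "xs ! 0 = n"
    "\<And>u v. u < n \<Longrightarrow> v < n \<Longrightarrow> xs ! Suc (u * n + v) = (if {u, v} \<in> E then 1 else 0)"
    "\<And>v. v < n \<Longrightarrow> xs ! Suc (n * n + 2 * v) = nu v"
    "\<And>v. v < n \<Longrightarrow> xs ! Suc (Suc (n * n + 2 * v)) = de v"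
    and len: "length xs = Suc (n * n + 2 * n)"
    using encode_instance_nth[where n = n and E = E and w = w] by (simp_all add: xs_def nu_def de_def)
  have pos: "0 < nu v" "0 < de v" "w v = of_nat (nu v) / of_nat (de v)" if "v < n" for v
  proof -
    obtain a b where ab: "quotient_of (w v) = (a, b)" by fastforce
    have "0 < b" using quotient_of_denom_pos[OF ab] .
    moreover have q: "w v = of_int a / of_int b" using quotient_of_div[OF ab] .
    moreover have "0 < a" using wpos[rule_format, OF that] \<open>0 < b\<close>
      unfolding q by (simp add: zero_less_divide_iff)
    ultimately show "0 < nu v" "0 < de v" "w v = of_nat (nu v) / of_nat (de v)"
      using ab by (simp_all add: nu_def de_def)
  qed
  have bs1: "1 \<le> bit_size x" for x by (simp add: bit_size_def)
  have "(\<Sum>x\<leftarrow>xs. 1) \<le> N" unfolding N_def input_size_def by (intro sum_list_mono bs1)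
  \<comment> \<open>The input has \<open>1 + n * n + 2 * n\<close> entries, a square, and each
    contributes at least 1 to the size, even the entry 0.\<close>
  then have nN: "Suc n * Suc n \<le> N" using len by (simp add: sum_list_triv)
  then have nN': "Suc n \<le> N" using le_trans[OF _ nN, of "Suc n"] by simp
  have N1: "1 \<le> N" using nN' by simp
  have entry: "bit_size x \<le> N" if "x \<in> set xs" for x
    unfolding N_def input_size_def using that by (intro member_le_sum_list) auto
  have entryL: "x < 2 ^ N" if "x \<in> set xs" for x
    by (rule less_le_trans[OF less_two_power_bit_size power_increasing[OF entry[OF that]]]) simp
  have N2: "N \<le> N * N" using N1 by simp
  have PN: "(\<Prod>v<n. nu v + de v) \<le> 2 ^ N"
  proof -
    \<comment> \<open>By \<open>add_less_power2\<close> a sum is bounded by adding the two bit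
      sizes, so the exponents sum to the size of the weight part of the input.\<close>
    have "(\<Prod>v<n. nu v + de v) \<le> (\<Prod>v<n. 2 ^ (bit_size (nu v) + bit_size (de v)))"
      by (intro prod_mono) (auto intro!: less_imp_le add_less_power2 less_two_power_bit_size bs1)
    also have "\<dots> = 2 ^ (\<Sum>v<n. bit_size (nu v) + bit_size (de v))" by (simp add: power_sum)
    also have "\<dots> \<le> 2 ^ N"
    proof (rule power_increasing)
      have "(\<Sum>v<n. bit_size (nu v) + bit_size (de v))
          = (\<Sum>v\<leftarrow>[0..<n]. \<Sum>x\<leftarrow>encode_rat (w v). bit_size x)"
        by (simp add: encode_rat_def nu_def de_def interv_sum_list_conv_sum_set_nat atLeast0LessThan)
      also have "\<dots> = (\<Sum>x\<leftarrow>concat (map (\<lambda>v. encode_rat (w v)) [0..<n]). bit_size x)"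
        by (rule sum_list_concat_map[symmetric])
      also have "\<dots> \<le> N"
        unfolding N_def input_size_def xs_def encode_instance_def by simp
      finally show "(\<Sum>v<n. bit_size (nu v) + bit_size (de v)) \<le> N" .
    qed simp
    finally show ?thesis .
  qed
  have NN: "N \<le> 2 ^ N" by (rule less_imp_le[OF less_exp])
  have MN: "M \<le> 2 ^ (2 * N)"
  proof -
    have "M \<le> 2 ^ N * 2 ^ N" unfolding M_def by (rule mult_le_mono[OF PN le_trans[OF nN NN]])
    then show ?thesis by (simp add: mult_2 power_add)
  qed
  have pL: "(2 :: nat) ^ k < 2 ^ L" if "k < L" for k using that by simp
  have L3: "3 * N < L" using N2 N1 by (simp add: L_def)
  have L1: "Suc n ^ 3 < 2 ^ L"
  proof -
    have "Suc n ^ 3 \<le> (2 ^ N) ^ 3" by (rule power_mono[OF le_trans[OF nN' NN]]) simp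
    also have "\<dots> = 2 ^ (3 * N)" by (simp add: power_mult[symmetric] mult.commute)
    also have "\<dots> < 2 ^ L" by (rule pL[OF L3])
    finally show ?thesis .
  qed
  have L2: "M < 2 ^ L" by (rule le_less_trans[OF MN pL]) (use L3 in simp)
  have L4: "nu v * M < 2 ^ L" if "v < n" for v
  proof -
    have "Suc (n * n + 2 * v) < length xs" using that len by simp
    then have "xs ! Suc (n * n + 2 * v) \<in> set xs" by (rule nth_mem)
    then have "nu v < 2 ^ N" using nth(3)[OF that] entryL by metis
    then have "nu v * M \<le> 2 ^ N * 2 ^ (2 * N)" using MN by (intro mult_le_mono) auto
    also have "\<dots> = 2 ^ (3 * N)" by (simp flip: power_add)
    also have "\<dots> < 2 ^ L" by (rule pL[OF L3])
    finally show ?thesis .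
  qed
  have L5: "M ^ n * (\<Prod>v<n. nu v + de v) < 2 ^ L"
  proof -
    have "M ^ n * (\<Prod>v<n. nu v + de v) \<le> (2 ^ (2 * N)) ^ n * 2 ^ N"
      using MN PN by (intro mult_le_mono power_mono) auto
    also have "\<dots> = 2 ^ (2 * N * n + N)" by (simp add: power_mult power_add)
    also have "\<dots> < 2 ^ L"
    proof (rule pL)
      have "2 * N * n + N \<le> 2 * N * Suc n" by simp
      also have "\<dots> \<le> 2 * N * N" using nN' by (intro mult_le_mono2)
      also have "\<dots> < L" using N1 by (simp add: L_def)
      finally show "2 * N * n + N < L" .
    qed
    finally show ?thesis .
  qed
  let ?s = "start_state xs"
  have s: "bounded_by L ?s"
    unfolding bounded_by_def
  proof (intro conjI allI)
    show "1 \<le> L" using L3 by simp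
    have "(2 :: nat) ^ N \<le> 2 ^ L" using L3 by (intro power_increasing) auto
    then show "?s x i < 2 ^ L" for x i
      using entryL[of "xs ! i"] by (auto simp: start_state_def intro: less_le_trans)
  qed
  have lin: "u * n + v < n * n" if "u < n" "v < n" for u v
  proof -
    have "u * n + v < Suc u * n" using that by simp
    also have "\<dots> \<le> n * n" using that by (intro mult_le_mono1) simp
    finally show ?thesis .
  qed
  have in0: "?s ''input'' 0 = n" using nth(1) len by (simp add: start_state_def)
  have ingraph: "\<forall>u<n. \<forall>v<n. ?s ''input'' (Suc (u * n + v)) = (if {u, v} \<in> E then 1 else 0)"
    using nth(2) len lin by (force simp: start_state_def)
  have inw: "weights_at n nu de ?s"
    using nth(3,4) len by (simp add: weights_at_def start_state_def)
  let ?k = "(10 + n * 9) + ((2 + n * (33 * Suc n ^ 4 + 2)) + (8 + 8 * L))"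
  have "runs L counting_com ?s ?k (\<lambda>s'. output_is s' (encode_rat (Z {..<n} E w)))"
    by (rule counting_runs[OF so s in0 inw ingraph pos M_def L1 L2 L5 L4])
  then obtain t s' where t: "exec counting_com ?s t s'" "t \<le> ?k * unit_cost L"
    "output_is s' (encode_rat (Z {..<n} E w))"
    by (auto simp: runs_def)
  \<comment> \<open>With \<open>n \<le> N\<close> and \<open>L = 4 * N ^ 2\<close> every term is at
    most a multiple of \<open>N ^ 5\<close>; the coefficients sum to 96.\<close>
  have kN: "?k \<le> 100 * N ^ 5"
  proof -
    have "n * (33 * Suc n ^ 4 + 2) \<le> N * (33 * N ^ 4 + 2)"
      using nN' by (intro mult_le_mono add_mono power_mono) auto
    also have "\<dots> = 33 * N ^ 5 + 2 * N" by (simp add: eval_nat_numeral algebra_simps)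
    finally have 1: "n * (33 * Suc n ^ 4 + 2) \<le> 33 * N ^ 5 + 2 * N" .
    have p: "N ^ a \<le> N ^ 5" if "a \<le> 5" for a using N1 that by (intro power_increasing) auto
    have "L = 4 * N ^ 2" by (simp add: L_def power2_eq_square)
    then show ?thesis using 1 p[of 0] p[of 1] p[of 2] nN' by simp
  qed
  \<comment> \<open>For this \<open>L\<close> the unit cost is
    \<open>201 + 160000 * N ^ 2\<close>.\<close>
  have uN: "unit_cost L \<le> 160201 * N ^ 2"
  proof -
    have "L = 4 * N ^ 2" "1 \<le> N ^ 2" using N1 by (simp_all add: L_def power2_eq_square)
    then show ?thesis by (simp add: unit_cost_def)
  qed
  have "?k * unit_cost L \<le> (100 * N ^ 5) * (160201 * N ^ 2)" by (rule mult_le_mono[OF kN uN])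
  also have "\<dots> = poly (monom 16020100 7) N"
    by (simp add: poly_monom power_add[symmetric])
  finally have "t \<le> poly (monom 16020100 7) (input_size xs)" using t(2) by (simp add: N_def)
  then show "computes_within counting_com (encode_instance n E w) (encode_rat (Z {..<n} E w))
      (poly (monom 16020100 7) (input_size (encode_instance n E w)))"
    unfolding computes_within_def xs_def[symmetric] using t by blast
qed

end
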